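(* Let $\mathcal{D}\subset\mathbb{R}^N$ be open, bounded, connected and walk-regular. Then for every continuous $F:\partial\mathcal{D}\to\mathbb{R}$, the family $\{u^\epsilon\}_{\epsilon\in(0,1)}$, $u^\epsilon(x)=\mathbb{E}[F\circ X^{\epsilon,x}]$, satisfies $u^\epsilon\to u$ as $\epsilon\to0$, where $u\in C(\bar{\mathcal{D}})$ is the unique solution of the boundary value problem $\Delta u=0$ in $\mathcal{D}$, $u=F$ on $\partial\mathcal{D}$.
   Context: Probability space: $\Omega_1=B_1(0)\subset\mathbb{R}^N$ with Borel $\sigma$-algebra and normalised Lebesgue measure; $(\Omega,\mathcal{F},\mathbb{P})$ is the countable product $\Omega=(\Omega_1)^{\mathbb{N}}$, $\omega=\{w_i\}_{i\ge1}$. The $\epsilon$-ball walk started at $x\in\mathcal{D}$: $X_0^{\epsilon,x}\equiv x$, $X_n^{\epsilon,x}=X_{n-1}^{\epsilon,x}+\big(\epsilon\wedge\operatorname{dist}(X_{n-1}^{\epsilon,x},\partial\mathcal{D})\big)w_n$ for $n\ge1$; it converges $\mathbb{P}$-a.s. to a random variable $X^{\epsilon,x}:\Omega\to\partial\mathcal{D}$. A point $y_0\in\partial\mathcal{D}$ is walk-regular if for every $\eta,\delta>0$ there exist $\hat\delta\in(0,\delta)$ and $\hat\epsilon\in(0,1)$ such that $\mathbb{P}(X^{\epsilon,x_0}\in B_\delta(y_0))\ge1-\eta$ for all $\epsilon\in(0,\hat\epsilon)$ and all $x_0\in B_{\hat\delta}(y_0)\cap\mathcal{D}$; $\mathcal{D}$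 is walk-regular if every $y_0\in\partial\mathcal{D}$ is walk-regular. *)

theory Defs
  imports "HOL-Probability.Probability"
begin

definition ball_prob :: "'a::euclidean_space measure" where
  "ball_prob = uniform_measure lborel (ball 0 1)"

text \<open>The countable product (Omega_1)^N; coordinate 0 is unused (increments are w_1, w_2, ...).
  We take the completion so that expectations of functions that are a.s. equal to measurable
  ones are well defined.\<close>
definition walk_space :: "(nat \<Rightarrow> 'a::euclidean_space) measure" where
  "walk_space = completion (PiM UNIV (\<lambda>_. ball_prob))"

fun walk :: "'a::euclidean_space set \<Rightarrow> real \<Rightarrow> 'a \<Rightarrow> (nat \<Rightarrow> 'a) \<Rightarrow> nat \<Rightarrow> 'a" where
  "walk D \<epsilon> x \<omega> 0 = x"
| "walk D \<epsilon> x \<omega> (Suc n) =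
     walk D \<epsilon> x \<omega> n + (min \<epsilon> (infdist (walk D \<epsilon> x \<omega> n) (frontier D))) *\<^sub>R \<omega> (Suc n)"

definition walk_limit :: "'a::euclidean_space set \<Rightarrow> real \<Rightarrow> 'a \<Rightarrow> (nat \<Rightarrow> 'a) \<Rightarrow> 'a" where
  "walk_limit D \<epsilon> x \<omega> = lim (walk D \<epsilon> x \<omega>)"

definition walk_regular_point :: "'a::euclidean_space set \<Rightarrow> 'a \<Rightarrow> bool" where
  "walk_regular_point D y0 \<longleftrightarrow>
     (\<forall>\<eta>>0. \<forall>\<delta>>0. \<exists>\<delta>'. 0 < \<delta>' \<and> \<delta>' < \<delta> \<and> (\<exists>\<epsilon>'. 0 < \<epsilon>' \<and> \<epsilon>' < 1 \<and>
        (\<forall>\<epsilon>. 0 < \<epsilon> \<and> \<epsilon> < \<epsilon>' \<longrightarrow> (\<forall>x0 \<in> ball y0 \<delta>' \<inter> D.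
           measure walk_space {\<omega> \<in> space walk_space. walk_limit D \<epsilon> x0 \<omega> \<in> ball y0 \<delta>} \<ge> 1 - \<eta>))))"

definition walk_regular :: "'a::euclidean_space set \<Rightarrow> bool" where
  "walk_regular D \<longleftrightarrow> (\<forall>y0 \<in> frontier D. walk_regular_point D y0)"

definition u_eps :: "'a::euclidean_space set \<Rightarrow> ('a \<Rightarrow> real) \<Rightarrow> real \<Rightarrow> 'a \<Rightarrow> real" where
  "u_eps D F \<epsilon> x = integral\<^sup>L walk_space (\<lambda>\<omega>. F (walk_limit D \<epsilon> x \<omega>))"

definition harmonic_on :: "'a::euclidean_space set \<Rightarrow> ('a \<Rightarrow> real) \<Rightarrow> bool" where
  "harmonic_on D u \<longleftrightarrow>
     (\<exists>u' u''. (\<forall>x\<in>D. (u has_derivative u' x) (at x)) \<and>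
        (\<forall>x\<in>D. \<forall>v. ((\<lambda>y. u' y v) has_derivative u'' x v) (at x)) \<and>
        (\<forall>v w. continuous_on D (\<lambda>y. u'' y v w)) \<and>
        (\<forall>x\<in>D. (\<Sum>i\<in>Basis. u'' x i i) = 0))"

end

theory Submission
  imports Defs
begin

text \<open>
  By the Markov property, \<open>u\<^sub>\<epsilon>\<close> equals its mean over the ball of radius \<open>\<epsilon>\<close> at every point whose distance
  from the boundary is at least \<open>\<epsilon>\<close>, and walk regularity makes \<open>u\<^sub>\<epsilon>\<close> uniformly close to \<open>F\<close> near the boundary.
  The difference \<open>u\<^sub>\<epsilon> (x + h) - u\<^sub>\<epsilon> x\<close> has the same mean value property, so a discrete maximum principle
  makes the family asymptotically equicontinuous. Convolving with a fixed kernel \<open>(s\<^sup>2 - |z|\<^sup>2)\<^sub>+\<^sup>k\<close> therefore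
  changes \<open>u\<^sub>\<epsilon>\<close> very little; the result is smooth and, by Taylor expansion of the kernel, has a
  Laplacian of order \<open>\<epsilon>\<close>. The classical maximum principle then shows that the family is uniformly Cauchy.
  Its limit \<open>u\<close> satisfies \<open>\<integral> u(y) \<Delta>\<phi>(x - y) dy = 0\<close> for these kernels \<open>\<phi>\<close>. Read as a differential equation in
  the radius \<open>s\<close>, this says that \<open>\<integral> u(y) (s\<^sup>2 - |x - y|\<^sup>2)\<^sub>+\<^sup>k dy\<close> is a multiple of \<open>s\<^bsup>N + 2k\<^esup>\<close>; so \<open>u\<close> is
  reproduced by convolution with the normalised kernel, hence is \<open>C\<^sup>2\<close> and harmonic.
\<close>

subsection \<open>The uniform distribution on the unit ball\<close>

text \<open>Nothing supplies continuity of the functions \<open>u_eps D F \<epsilon>\<close>, and at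
  an interior point they are averaged at one radius only, so neither the maximum nor the Laplacian
  of such a function can be used directly. The discrete maximum principle therefore works with
  near-maximisers, and derivatives are always put on the kernel. Truncated polynomials serve as
  kernels because multiplication by |z|^2 and differentiation in the radius lead to kernels of
  neighbouring order; Laplacian and radius derivative are thereby tied together by an Euler
  equation, and Taylor remainders are uniform in \<open>z\<close>, which is what differentiation
  under the integral asks for. Averaging over radius \<epsilon> differs from the identity by a
  multiple of \<epsilon>^2 times the Laplacian plus O(\<epsilon>^3); dividing by \<epsilon>^2 leaves
  the order \<epsilon>. A separate obstacle is that \<open>F\<close> is controlled on the frontier
  only, while \<open>lim\<close> also returns a value for divergent paths. The integrand is
  therefore replaced by a bounded Borel one that agrees with it at that value as well.\<close>

lemma emeasure_lborel_unit_ball: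
  "emeasure lborel (ball (0::'a::euclidean_space) 1) \<noteq> 0"
  "emeasure lborel (ball (0::'a::euclidean_space) 1) \<noteq> \<infinity>"
  using emeasure_lborel_ball_finite[of "0::'a" 1] open_not_negligible[of "ball (0::'a) 1"]
  by (auto simp: negligible_iff_emeasure0 null_sets_def)

lemma prob_space_ball_prob: "prob_space (ball_prob :: 'a::euclidean_space measure)"
  unfolding ball_prob_def
  using emeasure_lborel_unit_ball by (intro prob_space_uniform_measure) auto

interpretation ball_prob: prob_space "ball_prob :: 'a::euclidean_space measure"
  by (rule prob_space_ball_prob)

lemma sets_ball_prob [measurable_cong, simp]: "sets ball_prob = sets borel"
  by (simp add: ball_prob_def)

lemma space_ball_prob [simp]: "space ball_prob = UNIV"
  by (simp add: ball_prob_def)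

lemma AE_ball_prob:
  "(AE w in ball_prob. P w) \<longleftrightarrow> (AE w in lborel. norm (w::'a::euclidean_space) < 1 \<longrightarrow> P w)"
  unfolding ball_prob_def using emeasure_lborel_unit_ball
  by (subst AE_uniform_measure) (auto simp: top.not_eq_extremum)

lemma AE_ball_prob_norm: "AE w in ball_prob. norm (w::'a::euclidean_space) < 1"
  unfolding AE_ball_prob by simp

lemma integrable_ball_prob_bounded:
  fixes f :: "'a::euclidean_space \<Rightarrow> real"
  assumes "f \<in> borel_measurable borel" and "\<And>w. norm w < 1 \<Longrightarrow> \<bar>f w\<bar> \<le> B"
  shows "integrable ball_prob f"
  by (rule ball_prob.integrable_const_bound[of _ B])
     (use assms AE_ball_prob_norm in \<open>auto elim!: eventually_mono\<close>)

text \<open>A norm-preserving map pulls the unit ball back to itself, so invariance of Lebesgue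
  measure restricts to it. Sign changes and permutations of coordinates are the instances that
  determine the moments.\<close>

lemma distr_ball_prob_isometry:
  fixes T :: "'a::euclidean_space \<Rightarrow> 'a"
  assumes [measurable]: "T \<in> borel_measurable borel"
    and T: "distr lborel borel T = lborel" and norm: "\<And>w. norm (T w) = norm w"
  shows "distr ball_prob borel T = ball_prob"
proof (rule measure_eqI)
  show "sets (distr ball_prob borel T) = sets ball_prob" by simp
  fix B assume "B \<in> sets (distr ball_prob borel T)"
  then have B [measurable]: "B \<in> sets borel" by simp
  have "emeasure lborel (ball 0 1 \<inter> T -` B) = emeasure lborel (T -` (ball 0 1 \<inter> B) \<inter> space lborel)"
    by (rule arg_cong[where f="emeasure lborel"]) (auto simp: norm)
  also have "\<dots> = emeasure (distr lborel borel T) (ball 0 1 \<inter> B)"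
    by (subst emeasure_distr) auto
  also have "\<dots> = emeasure lborel (ball 0 1 \<inter> B)" by (simp add: T)
  finally have eq: "emeasure lborel (ball 0 1 \<inter> T -` B) = emeasure lborel (ball 0 1 \<inter> B)" .
  have [measurable]: "T -` B \<in> sets borel"
    using measurable_sets[OF assms(1) B] by simp
  have "emeasure (distr ball_prob borel T) B = emeasure ball_prob (T -` B)"
    by (subst emeasure_distr) auto
  then show "emeasure (distr ball_prob borel T) B = emeasure ball_prob B"
    unfolding ball_prob_def by (simp add: eq)
qed

lemma integral_ball_prob_isometry:
  fixes T :: "'a::euclidean_space \<Rightarrow> 'a" and f :: "'a \<Rightarrow> real"
  assumes "T \<in> borel_measurable borel" "f \<in> borel_measurable borel"
    and "distr lborel borel T = lborel" "\<And>w. norm (T w) = norm w"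
  shows "(\<integral>w. f (T w) \<partial>ball_prob) = (\<integral>w. f w \<partial>ball_prob)"
proof -
  have "(\<integral>w. f (T w) \<partial>ball_prob) = integral\<^sup>L (distr ball_prob borel T) f"
    using assms by (subst integral_distr) auto
  then show ?thesis by (simp add: distr_ball_prob_isometry[OF assms(1,3,4)])
qed

lemma norm_eq_of_coordinates:
  fixes x y :: "'a::euclidean_space"
  assumes "(\<Sum>b\<in>Basis. (x \<bullet> b)\<^sup>2) = (\<Sum>b\<in>Basis. (y \<bullet> b)\<^sup>2)"
  shows "norm x = norm y"
  using assms by (simp add: norm_eq euclidean_inner[of x x] euclidean_inner[of y y] power2_eq_square)

lemma integral_ball_prob_reflect:
  fixes f :: "'a::euclidean_space \<Rightarrow> real"
  assumes i: "i \<in> Basis" and [measurable]: "f \<in> borel_measurable borel"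
  shows "(\<integral>w. f (\<Sum>j\<in>Basis. ((if j = i then -1 else 1) * (w \<bullet> j)) *\<^sub>R j) \<partial>ball_prob)
    = (\<integral>w. f w \<partial>ball_prob)"
proof (rule integral_ball_prob_isometry)
  let ?c = "\<lambda>j. if j = i then -1 else 1 :: real"
  let ?T = "\<lambda>w. \<Sum>j\<in>Basis. (?c j * (w \<bullet> j)) *\<^sub>R j"
  have "(\<Prod>j\<in>Basis. \<bar>?c j\<bar>) = 1" by (intro prod.neutral) auto
  then show "distr lborel borel ?T = lborel"
    using lborel_affine_euclidean[of ?c 0] by (simp add: density_1 flip: one_ennreal_def)
  show "norm (?T w) = norm w" for w
    by (rule norm_eq_of_coordinates) (auto intro!: sum.cong simp: power2_eq_square)
qed auto

text \<open>Pulling a box back along a permutation of coordinates only permutes its edge lengths,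
  and Lebesgue measure is determined by boxes.\<close>

lemma integral_ball_prob_permute:
  fixes f :: "'a::euclidean_space \<Rightarrow> real"
  assumes \<sigma>: "\<And>b. b \<in> Basis \<Longrightarrow> \<sigma> b \<in> Basis" "\<And>b. b \<in> Basis \<Longrightarrow> \<sigma> (\<sigma> b) = b"
    and [measurable]: "f \<in> borel_measurable borel"
  shows "(\<integral>w. f (\<Sum>j\<in>Basis. (w \<bullet> \<sigma> j) *\<^sub>R j) \<partial>ball_prob) = (\<integral>w. f w \<partial>ball_prob)"
proof (rule integral_ball_prob_isometry)
  let ?T = "\<lambda>w::'a. \<Sum>j\<in>Basis. (w \<bullet> \<sigma> j) *\<^sub>R j"
  have bij: "bij_betw \<sigma> Basis Basis"
    by (rule bij_betw_byWitness[where f'=\<sigma>]) (use \<sigma> in auto)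
  have T: "?T w \<bullet> b = w \<bullet> \<sigma> b" if "b \<in> Basis" for w b
    using that by simp
  show [measurable]: "?T \<in> borel_measurable borel" by simp
  show "norm (?T w) = norm w" for w
    by (rule norm_eq_of_coordinates)
       (use sum.reindex_bij_betw[OF bij, of "\<lambda>b. (w \<bullet> b)\<^sup>2"] in simp)
  show "distr lborel borel ?T = lborel"
  proof (rule lborel_eqI[symmetric])
    fix l u :: 'a assume le: "\<And>b. b \<in> Basis \<Longrightarrow> l \<bullet> b \<le> u \<bullet> b"
    have "?T w \<in> box l u \<longleftrightarrow> w \<in> box (?T l) (?T u)" for w
      using \<sigma> by (simp add: mem_box) metis
    then have vim: "?T -` box l u = box (?T l) (?T u)" by auto
    have "emeasure (distr lborel borel ?T) (box l u) = emeasure lborel (box (?T l) (?T u))"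
      by (subst emeasure_distr) (auto simp: vim)
    also have "\<dots> = (\<Prod>b\<in>Basis. (?T u - ?T l) \<bullet> b)"
      using le \<sigma> by (subst emeasure_lborel_box) auto
    also have "\<dots> = (\<Prod>b\<in>Basis. (u - l) \<bullet> \<sigma> b)"
      by (simp add: inner_diff_left)
    also have "\<dots> = (\<Prod>b\<in>Basis. (u - l) \<bullet> b)"
      by (subst prod.reindex_bij_betw[OF bij]) simp
    finally show "emeasure (distr lborel borel ?T) (box l u) = (\<Prod>b\<in>Basis. (u - l) \<bullet> b)" .
  qed simp
qed simp

section \<open>First and second moments of the uniform distribution\<close>

lemma abs_inner_le: "norm w \<le> 1 \<Longrightarrow> \<bar>z \<bullet> w\<bar> \<le> norm z"
  for z w :: "'a::real_inner"
  using Cauchy_Schwarz_ineq2[of z w] mult_left_mono[of "norm w" 1 "norm z"] by simp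

lemma integrable_ball_prob_inner [simp]:
  "integrable ball_prob (\<lambda>w. z \<bullet> w)" "integrable ball_prob (\<lambda>w. w \<bullet> w)"
  "integrable ball_prob (\<lambda>w. (z \<bullet> w)\<^sup>2)" "integrable ball_prob (\<lambda>w. (z \<bullet> w) * (z' \<bullet> w))"
  for z z' :: "'a::euclidean_space"
proof -
  show "integrable ball_prob (\<lambda>w. z \<bullet> w)"
    by (rule integrable_ball_prob_bounded[of _ "norm z"]) (auto intro: abs_inner_le)
  show "integrable ball_prob (\<lambda>w. w \<bullet> w)" for z :: 'a
    by (rule integrable_ball_prob_bounded[of _ 1])
       (auto simp: dot_square_norm power_le_one)
  show *: "integrable ball_prob (\<lambda>w. (z \<bullet> w) * (z' \<bullet> w))" for z z' :: 'a
    by (rule integrable_ball_prob_bounded[of _ "norm z * norm z'"])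
       (auto simp: abs_mult intro!: mult_mono abs_inner_le)
  show "integrable ball_prob (\<lambda>w. (z \<bullet> w)\<^sup>2)"
    using *[of z z] by (simp add: power2_eq_square)
qed

lemma integral_ball_prob_reflect_odd:
  fixes f :: "'a::euclidean_space \<Rightarrow> real"
  assumes i: "i \<in> Basis" and f: "f \<in> borel_measurable borel"
    and odd: "\<And>w. f (\<Sum>j\<in>Basis. ((if j = i then -1 else 1) * (w \<bullet> j)) *\<^sub>R j) = - f w"
  shows "(\<integral>w. f w \<partial>ball_prob) = 0"
  using integral_ball_prob_reflect[OF i f] unfolding odd by simp

lemma integral_ball_prob_inner: "(\<integral>w. z \<bullet> w \<partial>ball_prob) = 0" for z :: "'a::euclidean_space"
proof -
  have 0: "(\<integral>w. w \<bullet> i \<partial>ball_prob) = 0" if "i \<in> Basis" for i :: 'a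
    by (rule integral_ball_prob_reflect_odd[OF that]) (use that in auto)
  have "(\<integral>w. z \<bullet> w \<partial>ball_prob) = (\<integral>w. (\<Sum>i\<in>Basis. (z \<bullet> i) * (i \<bullet> w)) \<partial>ball_prob)"
    by (subst euclidean_inner) (simp add: inner_commute)
  also have "\<dots> = (\<Sum>i\<in>Basis. (z \<bullet> i) * (\<integral>w. w \<bullet> i \<partial>ball_prob))"
    by (subst Bochner_Integration.integral_sum) (auto simp: inner_commute)
  finally show ?thesis by (simp add: 0)
qed

text \<open>The covariance matrix is invariant under sign changes and coordinate swaps, hence a
  multiple of the identity. Its factor \<open>c\<close> is never evaluated; what matters is that it
  is positive and the same in the quadratic form and in the trace.\<close>

lemma integral_ball_prob_second_moment:
  obtains c where "c > 0" "\<And>z :: 'a::euclidean_space. (\<integral>w. (z \<bullet> w)\<^sup>2 \<partial>ball_prob) = c * (z \<bullet> z)"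
    "(\<integral>w. (w::'a) \<bullet> w \<partial>ball_prob) = c * DIM('a)"
proof -
  obtain i0 :: 'a where i0: "i0 \<in> Basis" using nonempty_Basis by blast
  define c where "c = (\<integral>w. (i0 \<bullet> w)\<^sup>2 \<partial>ball_prob)"
  have diag: "(\<integral>w. (i \<bullet> w) * (i \<bullet> w) \<partial>ball_prob) = c" if i: "i \<in> Basis" for i :: 'a
  proof -
    \<comment> \<open>The transposition of \<open>i\<close> and \<open>i0\<close>, the identity when
      they coincide.\<close>
    let ?\<sigma> = "\<lambda>b. if b = i then i0 else if b = i0 then i else b"
    have "(\<integral>w. ((\<Sum>j\<in>Basis. (w \<bullet> ?\<sigma> j) *\<^sub>R j) \<bullet> i)\<^sup>2 \<partial>ball_prob) = (\<integral>w. (w \<bullet> i)\<^sup>2 \<partial>ball_prob)"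
      using i i0 by (intro integral_ball_prob_permute) auto
    then show ?thesis using i by (simp add: c_def power2_eq_square inner_commute[of i] inner_commute[of i0])
  qed
  have off: "(\<integral>w. (i \<bullet> w) * (j \<bullet> w) \<partial>ball_prob) = 0"
    if i: "i \<in> Basis" and j: "j \<in> Basis" "i \<noteq> j" for i j :: 'a
    by (rule integral_ball_prob_reflect_odd[OF i])
       (use that in \<open>auto simp: inner_commute[of i] inner_commute[of j]\<close>)
  have quad: "(\<integral>w. (z \<bullet> w)\<^sup>2 \<partial>ball_prob) = c * (z \<bullet> z)" for z :: 'a
  proof -
    have "(z \<bullet> w)\<^sup>2 = (\<Sum>i\<in>Basis. \<Sum>j\<in>Basis. ((z \<bullet> i) * (z \<bullet> j)) * ((i \<bullet> w) * (j \<bullet> w)))" for w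
      by (subst euclidean_inner)
         (simp add: power2_eq_square sum_product inner_commute[of w] ac_simps)
    then have "(\<integral>w. (z \<bullet> w)\<^sup>2 \<partial>ball_prob) = (\<Sum>i\<in>Basis. \<Sum>j\<in>Basis.
        ((z \<bullet> i) * (z \<bullet> j)) * (\<integral>w. (i \<bullet> w) * (j \<bullet> w) \<partial>ball_prob))"
      by (simp add: Bochner_Integration.integral_sum)
    also have "\<dots> = (\<Sum>i\<in>Basis. \<Sum>j\<in>Basis. if j = i then (z \<bullet> i) * (z \<bullet> i) * c else 0)"
      by (intro sum.cong) (auto simp: diag off)
    also have "\<dots> = c * (z \<bullet> z)"
      by (simp add: euclidean_inner[of z z] sum_distrib_left ac_simps)
    finally show ?thesis .
  qed
  \<comment> \<open>With \<open>c = 0\<close> almost every point of the ball would lie in the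
    hyperplane orthogonal to \<open>i0\<close>, which is a null set.\<close>
  have "c \<noteq> 0"
  proof
    assume "c = 0"
    then have "AE w in ball_prob. (i0 \<bullet> w)\<^sup>2 = 0"
      unfolding c_def by (subst (asm) integral_nonneg_eq_0_iff_AE) auto
    moreover have "AE w in ball_prob. w \<notin> {w. i0 \<bullet> w = 0}"
    proof -
      have "negligible {w. i0 \<bullet> w = 0}" using i0 by (intro negligible_hyperplane) auto
      then have "{w. i0 \<bullet> w = 0} \<in> null_sets lborel"
        by (auto simp: negligible_iff_null_sets null_sets_completion_iff)
      from AE_not_in[OF this] show ?thesis unfolding AE_ball_prob by eventually_elim auto
    qed
    ultimately have "AE w in (ball_prob :: 'a measure). False" by eventually_elim auto
    then show False by simp
  qed
  moreover have "c \<ge> 0" unfolding c_def by simp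
  moreover have "(\<integral>w. (w::'a) \<bullet> w \<partial>ball_prob) = (\<Sum>i\<in>Basis. \<integral>w. (i \<bullet> w) * (i \<bullet> w) \<partial>(ball_prob :: 'a measure))"
    by (subst euclidean_inner) (simp add: Bochner_Integration.integral_sum inner_commute)
  ultimately show ?thesis using diag quad by (intro that[of c]) auto
qed

subsection \<open>The polynomial kernels\<close>

text \<open>The differentiability test behind all convolution derivatives: a quadratic remainder
  bound for a kernel that is uniform in position passes through the integral as it stands.\<close>

lemma has_derivative_quadratic_remainder:
  fixes f :: "'a::real_normed_vector \<Rightarrow> 'b::real_normed_vector"
  assumes "bounded_linear f'"
    and rem: "\<And>h. norm h \<le> 1 \<Longrightarrow> norm (f (x + h) - f x - f' h) \<le> C * (norm h)\<^sup>2"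
  shows "(f has_derivative f') (at x)"
  unfolding has_derivative_at
proof
  have "eventually (\<lambda>h::'a. norm h \<le> 1) (at 0)"
    using eventually_at_ball[of 1 "0::'a" UNIV] by (auto elim!: eventually_mono)
  then have "eventually (\<lambda>h. norm (norm (f (x + h) - f x - f' h) / norm h) \<le> C * norm h) (at 0)"
  proof eventually_elim
    case (elim h)
    show ?case
      using rem[OF elim] by (cases "h = 0") (auto simp: divide_le_eq power2_eq_square ac_simps)
  qed
  moreover have "((\<lambda>h::'a. C * norm h) \<longlongrightarrow> 0) (at 0)"
    by (intro tendsto_eq_intros | simp)+
  ultimately show "(\<lambda>h. norm (f (x + h) - f x - f' h) / norm h) \<midarrow>0\<rightarrow> 0"
    by (rule Lim_null_comparison)
qed fact

text \<open>The delicate point is the kink at 0, where \<open>k \<ge> 2\<close> bounds the function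
  itself by \<open>h\<^sup>2\<close>.\<close>

lemma DERIV_pos_part_power:
  assumes "k \<ge> 2"
  shows "((\<lambda>t::real. (max 0 t) ^ k) has_real_derivative real k * (max 0 t) ^ (k - 1)) (at t)"
proof -
  consider "t > 0" | "t < 0" | "t = 0" by linarith
  then show ?thesis
  proof cases
    case 1
    have "((\<lambda>t. t ^ k) has_real_derivative real k * t ^ (k - 1)) (at t)"
      by (auto intro!: derivative_eq_intros)
    then have "((\<lambda>t. (max 0 t) ^ k) has_real_derivative real k * t ^ (k - 1)) (at t)"
      by (rule has_field_derivative_transform_within_open[of _ _ _ "{0<..}"]) (use 1 in auto)
    then show ?thesis using 1 by simp
  next
    case 2
    have "((\<lambda>t. 0) has_real_derivative 0) (at t)" by simp
    then have "((\<lambda>t. (max 0 t) ^ k) has_real_derivative 0) (at t)"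
      by (rule has_field_derivative_transform_within_open[of _ _ _ "{..<0}"]) (use 2 assms in auto)
    then show ?thesis using 2 assms by (simp add: zero_power)
  next
    case 3
    have "norm ((max 0 (0 + h)) ^ k - (max 0 0) ^ k - 0 * h) \<le> 1 * (norm h)\<^sup>2"
      if "norm h \<le> 1" for h :: real
      using that assms power_decreasing[of 2 k h] by (auto simp: max_def zero_power)
    then have "((\<lambda>t. (max 0 t) ^ k) has_derivative (*) 0) (at (0::real))"
      by (rule has_derivative_quadratic_remainder[OF bounded_linear_mult_right])
    then show ?thesis using 3 assms by (simp add: has_field_derivative_def zero_power)
  qed
qed

text \<open>Lagrange's form of the remainder, with the derivative bounded through the upper bound
  \<open>b\<close> alone because negative arguments contribute 0. The condition \<open>n < k\<close>
  keeps the derivatives of order below \<open>n\<close> differentiable across the kink.\<close>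

lemma Taylor_pos_part_power:
  assumes n: "0 < n" "n < k" and le: "t \<le> b" "t + a \<le> b" "0 \<le> b"
  shows "\<bar>(max 0 (t + a)) ^ k
      - (\<Sum>m<n. (\<Prod>i<m. real (k - i)) * (max 0 t) ^ (k - m) / fact m * a ^ m)\<bar>
    \<le> real k ^ n * b ^ (k - n) * \<bar>a\<bar> ^ n"
\<comment> \<open>\<open>Taylor\<close> requires two distinct points.\<close>
proof (cases "a = 0")
  case True
  have "(\<Sum>m<n. (\<Prod>i<m. real (k - i)) * (max 0 t) ^ (k - m) / fact m * 0 ^ m) = (max 0 t) ^ k"
    using n by (subst sum.remove[of _ 0]) (auto intro!: sum.neutral)
  then show ?thesis using True le by simp
next
  case False
  let ?d = "\<lambda>m t. (\<Prod>i<m. real (k - i)) * (max 0 t) ^ (k - m)"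
  have "\<exists>\<xi>. (if t + a < t then t + a < \<xi> \<and> \<xi> < t else t < \<xi> \<and> \<xi> < t + a) \<and>
      (max 0 (t + a)) ^ k = (\<Sum>m<n. ?d m t / fact m * (t + a - t) ^ m) + ?d n \<xi> / fact n * (t + a - t) ^ n"
  proof (rule Taylor[where a="min t (t + a)" and b="max t (t + a)"])
    show "\<forall>m x. m < n \<and> min t (t + a) \<le> x \<and> x \<le> max t (t + a) \<longrightarrow>
        DERIV (?d m) x :> ?d (Suc m) x"
    proof (intro allI impI)
      fix m x assume "m < n \<and> min t (t + a) \<le> x \<and> x \<le> max t (t + a)"
      then have "k - m \<ge> 2" using n by auto
      from DERIV_cmult[OF DERIV_pos_part_power[OF this, of x], of "\<Prod>i<m. real (k - i)"]
      show "DERIV (?d m) x :> ?d (Suc m) x" by (simp add: mult.assoc)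
    qed
  qed (use n False in auto)
  then obtain \<xi> where \<xi>': "if t + a < t then t + a < \<xi> \<and> \<xi> < t else t < \<xi> \<and> \<xi> < t + a"
    and eq: "(max 0 (t + a)) ^ k = (\<Sum>m<n. ?d m t / fact m * a ^ m) + ?d n \<xi> / fact n * a ^ n"
    by auto
  have \<xi>: "\<xi> \<le> b" using \<xi>' le by (auto split: if_splits)
  have "(\<Prod>i<n. real (k - i)) \<le> real k ^ n"
    using prod_mono[of "{..<n}" "\<lambda>i. real (k - i)" "\<lambda>_. real k"] by simp
  moreover have "(max 0 \<xi>) ^ (k - n) \<le> b ^ (k - n)"
    using \<xi> le by (intro power_mono) auto
  ultimately have 1: "?d n \<xi> \<le> real k ^ n * b ^ (k - n)"
    using le by (intro mult_mono) auto
  have 2: "\<bar>?d n \<xi>\<bar> = ?d n \<xi>" by (simp add: prod_nonneg)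
  have "\<bar>?d n \<xi> / fact n * a ^ n\<bar> = ?d n \<xi> / fact n * \<bar>a\<bar> ^ n"
    using 2 by (simp add: abs_mult power_abs prod_nonneg)
  also have "?d n \<xi> / fact n \<le> ?d n \<xi> / 1"
    by (intro divide_left_mono) (auto simp: fact_ge_1 prod_nonneg)
  finally have "\<bar>?d n \<xi> / fact n * a ^ n\<bar> \<le> ?d n \<xi> * \<bar>a\<bar> ^ n"
    by (simp add: mult_right_mono)
  also have "\<dots> \<le> real k ^ n * b ^ (k - n) * \<bar>a\<bar> ^ n"
    by (intro mult_right_mono 1) auto
  finally show ?thesis unfolding eq by simp
qed

definition bump :: "nat \<Rightarrow> real \<Rightarrow> 'a::euclidean_space \<Rightarrow> real" where
  "bump k s z = (max 0 (s\<^sup>2 - z \<bullet> z)) ^ k"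

text \<open>The Laplacian of \<open>bump k s\<close> computed by the chain rule;
  \<open>sum_bump_hess\<close> identifies it with the trace of the Hessian kernel.\<close>

definition bump_laplacian :: "nat \<Rightarrow> real \<Rightarrow> 'a::euclidean_space \<Rightarrow> real" where
  "bump_laplacian k s z = - 2 * real k * DIM('a) * bump (k - 1) s z
     + 4 * real k * real (k - 1) * (z \<bullet> z) * bump (k - 2) s z"

lemma bump_nonneg [simp]: "bump k s z \<ge> 0"
  by (simp add: bump_def)

lemma bump_eq_0: "0 \<le> s \<Longrightarrow> s \<le> norm z \<Longrightarrow> 0 < k \<Longrightarrow> bump k s z = 0"
  by (simp add: bump_def dot_square_norm power_mono)

lemma bump_le: "0 \<le> s \<Longrightarrow> bump k s z \<le> (s\<^sup>2) ^ k"
  unfolding bump_def by (intro power_mono) auto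

lemma continuous_on_bump [continuous_intros]:
  "continuous_on A f \<Longrightarrow> continuous_on A (\<lambda>x. bump k s (f x))"
  unfolding bump_def by (intro continuous_intros)

text \<open>The quantity is the change of \<open>s\<^sup>2 - z \<bullet> z\<close> when
  \<open>z\<close> moves to \<open>z + h\<close>. Beyond radius \<open>s + 1\<close> both kernel
  values vanish.\<close>

lemma bump_increment:
  fixes z h :: "'a::euclidean_space"
  assumes "0 \<le> s" "norm h \<le> 1" "norm z \<le> s + 1"
  shows "\<bar>- 2 * (z \<bullet> h) - h \<bullet> h\<bar> \<le> (2 * s + 3) * norm h"
proof -
  have 1: "\<bar>z \<bullet> h\<bar> \<le> (s + 1) * norm h"
    using Cauchy_Schwarz_ineq2[of z h] mult_right_mono[OF assms(3), of "norm h"] by simp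
  have "h \<bullet> h \<le> 1 * norm h"
    unfolding dot_square_norm power2_eq_square using assms by (intro mult_right_mono) auto
  moreover have "0 \<le> h \<bullet> h" by simp
  moreover have "(2 * s + 3) * norm h = 2 * ((s + 1) * norm h) + norm h" by (simp add: algebra_simps)
  ultimately show ?thesis using 1 unfolding abs_le_iff by linarith
qed

text \<open>One-variable Taylor expansion in \<open>s\<^sup>2 - z \<bullet> z\<close>. The constant
  is uniform in \<open>z\<close> because all terms vanish beyond radius
  \<open>s + 1\<close>.\<close>

lemma bump_Taylor1:
  assumes k: "k \<ge> 3" and s: "0 \<le> s"
  obtains C where "0 \<le> C" "\<And>z h :: 'a::euclidean_space. norm h \<le> 1 \<Longrightarrow>
    \<bar>bump k s (z + h) - bump k s z + 2 * real k * (z \<bullet> h) * bump (k - 1) s z\<bar> \<le> C * (norm h)\<^sup>2"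
proof
  \<comment> \<open>The first summand is the one-variable remainder; the second pays for the part
    \<open>h \<bullet> h\<close> of the linear term in \<open>a\<close>.\<close>
  define C where "C = real k ^ 2 * (s\<^sup>2) ^ (k - 2) * (2 * s + 3)\<^sup>2 + real k * (s\<^sup>2) ^ (k - 1)"
  show "0 \<le> C" using s by (simp add: C_def)
  fix z h :: 'a assume h: "norm h \<le> 1"
  show "\<bar>bump k s (z + h) - bump k s z + 2 * real k * (z \<bullet> h) * bump (k - 1) s z\<bar> \<le> C * (norm h)\<^sup>2"
  proof (cases "norm z \<le> s + 1")
    case False
    then have "norm z \<ge> s" "norm (z + h) \<ge> s" using norm_diff_ineq[of z h] h by linarith+
    then show ?thesis using k s \<open>0 \<le> C\<close> by (simp add: bump_eq_0)
  next
    case True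
    define a where "a = - 2 * (z \<bullet> h) - h \<bullet> h"
    define t where "t = s\<^sup>2 - z \<bullet> z"
    have ta: "t + a = s\<^sup>2 - (z + h) \<bullet> (z + h)"
      by (simp add: a_def t_def inner_add_left inner_add_right inner_commute)
    then have t: "t + a \<le> s\<^sup>2" "t \<le> s\<^sup>2"
      by (simp_all add: t_def)
    have bump: "bump m s (z + h) = (max 0 (t + a)) ^ m" "bump m s z = (max 0 t) ^ m" for m
      unfolding ta by (simp_all add: bump_def t_def)
    have sums: "(\<Sum>m<2. f m) = f 0 + f (1::nat)" "(\<Sum>m<3. f m) = f 0 + f 1 + f (2::nat)"
      "(\<Prod>m<2. f m) = f 0 * f (1::nat)" for f :: "nat \<Rightarrow> real"
      by (simp_all add: numeral_2_eq_2 numeral_3_eq_3)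
    have "\<bar>bump k s (z + h) - (bump k s z + k * bump (k - 1) s z * a)\<bar> \<le> real k ^ 2 * (s\<^sup>2) ^ (k - 2) * \<bar>a\<bar> ^ 2"
      using Taylor_pos_part_power[of 2 k t "s\<^sup>2" a] k by (simp add: sums t bump)
    also have "\<dots> \<le> real k ^ 2 * (s\<^sup>2) ^ (k - 2) * ((2 * s + 3) * norm h) ^ 2"
      using bump_increment[OF s h True] unfolding a_def[symmetric]
      by (intro mult_left_mono power_mono) auto
    finally have 1: "\<bar>bump k s (z + h) - (bump k s z + k * bump (k - 1) s z * a)\<bar>
        \<le> real k ^ 2 * (s\<^sup>2) ^ (k - 2) * (2 * s + 3)\<^sup>2 * (norm h)\<^sup>2"
      by (simp add: power_mult_distrib mult.assoc)
    have 2: "\<bar>k * bump (k - 1) s z * (h \<bullet> h)\<bar> \<le> real k * (s\<^sup>2) ^ (k - 1) * (norm h)\<^sup>2"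
      by (auto simp: abs_mult dot_square_norm intro!: mult_mono bump_le s)
    have "bump k s (z + h) - bump k s z + 2 * real k * (z \<bullet> h) * bump (k - 1) s z
       = (bump k s (z + h) - (bump k s z + k * bump (k - 1) s z * a)) - k * bump (k - 1) s z * (h \<bullet> h)"
      by (simp add: a_def algebra_simps)
    then show ?thesis using 1 2 unfolding C_def distrib_right by linarith
  qed
qed

lemma bump_Taylor2:
  assumes k: "k \<ge> 4" and s: "0 \<le> s"
  obtains C where "0 \<le> C" "\<And>z h :: 'a::euclidean_space. norm h \<le> 1 \<Longrightarrow>
    \<bar>bump k s (z + h) - bump k s z + 2 * real k * (z \<bullet> h) * bump (k - 1) s z
      + real k * (h \<bullet> h) * bump (k - 1) s z
      - 2 * real k * real (k - 1) * (z \<bullet> h)\<^sup>2 * bump (k - 2) s z\<bar> \<le> C * (norm h) ^ 3"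
proof
  \<comment> \<open>The first summand is the third-order remainder. In \<open>a\<^sup>2\<close> only
    \<open>4 * (z \<bullet> h)\<^sup>2\<close> is kept, as the Hessian term; the second summand
    covers the cubic and quartic rest, for which \<open>norm z \<le> s + 1\<close> and
    \<open>norm h \<le> 1\<close> give the factor \<open>4 * (s + 1) + 1\<close>.\<close>
  define C where "C = real k ^ 3 * (s\<^sup>2) ^ (k - 3) * (2 * s + 3) ^ 3
    + real k * real (k - 1) / 2 * (s\<^sup>2) ^ (k - 2) * (4 * (s + 1) + 1)"
  show "0 \<le> C" using s by (simp add: C_def)
  fix z h :: 'a assume h: "norm h \<le> 1"
  show "\<bar>bump k s (z + h) - bump k s z + 2 * real k * (z \<bullet> h) * bump (k - 1) s z
      + real k * (h \<bullet> h) * bump (k - 1) s z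
      - 2 * real k * real (k - 1) * (z \<bullet> h)\<^sup>2 * bump (k - 2) s z\<bar> \<le> C * (norm h) ^ 3" (is "\<bar>?L\<bar> \<le> _")
  proof (cases "norm z \<le> s + 1")
    case False
    then have "norm z \<ge> s" "norm (z + h) \<ge> s" using norm_diff_ineq[of z h] h by linarith+
    then show ?thesis using k s \<open>0 \<le> C\<close> by (simp add: bump_eq_0)
  next
    case True
    define a where "a = - 2 * (z \<bullet> h) - h \<bullet> h"
    define t where "t = s\<^sup>2 - z \<bullet> z"
    have ta: "t + a = s\<^sup>2 - (z + h) \<bullet> (z + h)"
      by (simp add: a_def t_def inner_add_left inner_add_right inner_commute)
    then have t: "t + a \<le> s\<^sup>2" "t \<le> s\<^sup>2"
      by (simp_all add: t_def)
    have bump: "bump m s (z + h) = (max 0 (t + a)) ^ m" "bump m s z = (max 0 t) ^ m" for m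
      unfolding ta by (simp_all add: bump_def t_def)
    have sums: "(\<Sum>m<2. f m) = f 0 + f (1::nat)" "(\<Sum>m<3. f m) = f 0 + f 1 + f (2::nat)"
      "(\<Prod>m<2. f m) = f 0 * f (1::nat)" for f :: "nat \<Rightarrow> real"
      by (simp_all add: numeral_2_eq_2 numeral_3_eq_3)
    let ?R = "bump k s (z + h) - (bump k s z + k * bump (k - 1) s z * a
        + k * real (k - 1) * bump (k - 2) s z / 2 * a\<^sup>2)"
    have "\<bar>?R\<bar> \<le> real k ^ 3 * (s\<^sup>2) ^ (k - 3) * \<bar>a\<bar> ^ 3"
      using Taylor_pos_part_power[of 3 k t "s\<^sup>2" a] k by (simp add: sums t bump)
    also have "\<dots> \<le> real k ^ 3 * (s\<^sup>2) ^ (k - 3) * ((2 * s + 3) * norm h) ^ 3"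
      using bump_increment[OF s h True] unfolding a_def[symmetric]
      by (intro mult_left_mono power_mono) auto
    finally have 1: "\<bar>?R\<bar> \<le> real k ^ 3 * (s\<^sup>2) ^ (k - 3) * (2 * s + 3) ^ 3 * (norm h) ^ 3"
      by (simp add: power_mult_distrib mult.assoc)
    have "\<bar>z \<bullet> h\<bar> \<le> (s + 1) * norm h"
      using Cauchy_Schwarz_ineq2[of z h] mult_right_mono[OF True, of "norm h"] by simp
    then have "\<bar>z \<bullet> h\<bar> * (norm h)\<^sup>2 \<le> (s + 1) * norm h * (norm h)\<^sup>2"
      by (intro mult_right_mono) auto
    moreover have "(norm h)\<^sup>2 * (norm h)\<^sup>2 \<le> norm h * (norm h)\<^sup>2"
      using h by (intro mult_right_mono) (auto simp: power2_eq_square mult_left_le)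
    moreover have "(4 * (s + 1) + 1) * (norm h) ^ 3 = 4 * ((s + 1) * norm h * (norm h)\<^sup>2) + norm h * (norm h)\<^sup>2"
      by (simp add: power3_eq_cube power2_eq_square algebra_simps)
    moreover have "\<bar>4 * (z \<bullet> h) * (norm h)\<^sup>2 + (norm h)\<^sup>2 * (norm h)\<^sup>2\<bar>
        \<le> 4 * (\<bar>z \<bullet> h\<bar> * (norm h)\<^sup>2) + (norm h)\<^sup>2 * (norm h)\<^sup>2"
      by (rule order_trans[OF abs_triangle_ineq]) (simp add: abs_mult)
    ultimately have "\<bar>4 * (z \<bullet> h) * (norm h)\<^sup>2 + (norm h)\<^sup>2 * (norm h)\<^sup>2\<bar> \<le> (4 * (s + 1) + 1) * (norm h) ^ 3"
      by linarith
    then have 2: "\<bar>k * real (k - 1) / 2 * bump (k - 2) s z * (4 * (z \<bullet> h) * (norm h)\<^sup>2 + (norm h)\<^sup>2 * (norm h)\<^sup>2)\<bar>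
        \<le> real k * real (k - 1) / 2 * (s\<^sup>2) ^ (k - 2) * ((4 * (s + 1) + 1) * (norm h) ^ 3)"
      unfolding abs_mult[of "_ * bump _ _ _"]
      by (intro mult_mono) (auto simp: abs_mult intro!: mult_mono bump_le s)
    have "?L = ?R + k * real (k - 1) / 2 * bump (k - 2) s z * (4 * (z \<bullet> h) * (norm h)\<^sup>2 + (norm h)\<^sup>2 * (norm h)\<^sup>2)"
      unfolding power2_norm_eq_inner by (simp add: a_def power2_eq_square algebra_simps)
    moreover have "C * (norm h) ^ 3 = real k ^ 3 * (s\<^sup>2) ^ (k - 3) * (2 * s + 3) ^ 3 * (norm h) ^ 3
        + real k * real (k - 1) / 2 * (s\<^sup>2) ^ (k - 2) * ((4 * (s + 1) + 1) * (norm h) ^ 3)"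
      unfolding C_def by (simp only: distrib_right mult.assoc)
    ultimately show ?thesis using 1 2 by linarith
  qed
qed

subsection \<open>Convolutions\<close>

lemma integral_bounded_support:
  fixes f :: "'a::euclidean_space \<Rightarrow> real"
  assumes [measurable]: "f \<in> borel_measurable borel" and R: "0 \<le> R"
    and B: "\<And>y. \<bar>f y\<bar> \<le> B" and supp: "\<And>y. R < dist x y \<Longrightarrow> f y = 0"
  shows "integrable lborel f"
    and "\<bar>\<integral>y. f y \<partial>lborel\<bar> \<le> B * (unit_ball_vol DIM('a) * R ^ DIM('a))"
proof -
  have le: "\<bar>f y\<bar> \<le> B * indicator (cball x R) y" for y
    using B[of y] supp[of y] by (auto simp: indicator_def)
  have int: "integrable lborel (\<lambda>y. B * indicator (cball x R) y)"
    using emeasure_lborel_cball_finite[of x R] by (intro integrable_mult_right) auto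
  show f: "integrable lborel f"
    by (rule Bochner_Integration.integrable_bound[OF int]) (auto intro!: AE_I2 order_trans[OF le abs_ge_self])
  have "\<bar>\<integral>y. f y \<partial>lborel\<bar> \<le> (\<integral>y. \<bar>f y\<bar> \<partial>lborel)"
    by (rule integral_abs_bound)
  also have "\<dots> \<le> (\<integral>y. B * indicator (cball x R) y \<partial>lborel)"
    using f int le by (intro integral_mono) auto
  also have "\<dots> = B * (unit_ball_vol DIM('a) * R ^ DIM('a))"
    using R by (simp add: content_cball)
  finally show "\<bar>\<integral>y. f y \<partial>lborel\<bar> \<le> B * (unit_ball_vol DIM('a) * R ^ DIM('a))" .
qed

lemma continuous_bounded_support:
  fixes L :: "'a::euclidean_space \<Rightarrow> real"
  assumes "continuous_on UNIV L" "\<And>z. R \<le> norm z \<Longrightarrow> L z = 0"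
  obtains B where "0 \<le> B" "\<And>z. \<bar>L z\<bar> \<le> B"
proof -
  have "compact (L ` cball 0 R)"
    using assms by (intro compact_continuous_image) (auto intro: continuous_on_subset)
  then obtain B where B: "\<forall>y\<in>L ` cball 0 R. norm y \<le> B"
    using compact_imp_bounded bounded_iff by blast
  have "\<bar>L z\<bar> \<le> max 0 B" for z
    using B assms(2)[of z] by (cases "norm z \<le> R") force+
  then show ?thesis by (intro that[of "max 0 B"]) auto
qed

lemma integrable_convolution:
  fixes g L :: "'a::euclidean_space \<Rightarrow> real"
  assumes [measurable]: "g \<in> borel_measurable borel" and M: "\<And>y. \<bar>g y\<bar> \<le> M"
    and L: "continuous_on UNIV L" "\<And>z. R \<le> norm z \<Longrightarrow> L z = 0"
  shows "integrable lborel (\<lambda>y. g y * L (x - y))"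
proof -
  obtain B where B: "0 \<le> B" "\<And>z. \<bar>L z\<bar> \<le> B"
    using continuous_bounded_support[OF L] by blast
  have [measurable]: "L \<in> borel_measurable borel"
    using L by (intro borel_measurable_continuous_onI)
  have "0 \<le> M" using M[of 0] by linarith
  then show ?thesis
    by (intro integral_bounded_support(1)[where x=x and R="max 0 R" and B="M * B"])
       (auto simp: abs_mult dist_norm L intro!: mult_mono M B)
qed

text \<open>Differentiability in quantitative form: \<open>K' z v\<close> is the derivative of
  \<open>K\<close> at \<open>z\<close> in direction \<open>v\<close>, and the remainder constant is
  global. This form integrates directly and is stable under multiplication by linear functions,
  which is how second derivatives are reached.\<close>

definition C1_kernel :: "real \<Rightarrow> ('a::euclidean_space \<Rightarrow> real) \<Rightarrow> ('a \<Rightarrow> 'a \<Rightarrow> real) \<Rightarrow> bool" where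
  "C1_kernel R K K' \<longleftrightarrow> 0 \<le> R \<and> (\<forall>z. linear (K' z)) \<and> (\<forall>z. R \<le> norm z \<longrightarrow> K z = 0 \<and> (\<forall>v. K' z v = 0)) \<and>
     continuous_on UNIV K \<and> (\<forall>v. continuous_on UNIV (\<lambda>z. K' z v)) \<and>
     (\<exists>C\<ge>0. \<forall>z h. norm h \<le> 1 \<longrightarrow> \<bar>K (z + h) - K z - K' z h\<bar> \<le> C * (norm h)\<^sup>2)"

text \<open>The remainder estimate of the kernel is integrated against the bounded function
  \<open>g\<close>, so all smoothness comes from the kernel.\<close>

lemma has_derivative_convolution:
  fixes g :: "'a::euclidean_space \<Rightarrow> real"
  assumes [measurable]: "g \<in> borel_measurable borel" and M: "\<And>y. \<bar>g y\<bar> \<le> M"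
    and K: "C1_kernel R K K'"
  shows "((\<lambda>x. \<integral>y. g y * K (x - y) \<partial>lborel) has_derivative (\<lambda>h. \<integral>y. g y * K' (x - y) h \<partial>lborel)) (at x)"
proof -
  obtain C where C: "C \<ge> 0" "\<And>z h. norm h \<le> 1 \<Longrightarrow> \<bar>K (z + h) - K z - K' z h\<bar> \<le> C * (norm h)\<^sup>2"
    using K unfolding C1_kernel_def by blast
  have R: "R \<ge> 0" and lin: "\<And>z. linear (K' z)"
    and supp: "\<And>z. R \<le> norm z \<Longrightarrow> K z = 0" "\<And>z v. R \<le> norm z \<Longrightarrow> K' z v = 0"
    and cont: "continuous_on UNIV K" "\<And>v. continuous_on UNIV (\<lambda>z. K' z v)"
    using K unfolding C1_kernel_def by auto
  have [measurable]: "K \<in> borel_measurable borel" "(\<lambda>z. K' z v) \<in> borel_measurable borel" for v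
    using cont by (auto intro: borel_measurable_continuous_onI)
  have M0: "0 \<le> M" using M[of 0] by linarith
  note int = integrable_convolution[OF assms(1) M cont(1) supp(1)]
    integrable_convolution[OF assms(1) M cont(2) supp(2)]
  show ?thesis
  proof (rule has_derivative_quadratic_remainder)
    have "linear (\<lambda>h. \<integral>y. g y * K' (x - y) h \<partial>lborel)"
      by (rule linearI)
         (simp_all add: linear_add[OF lin] linear_scale[OF lin] distrib_left int mult.left_commute)
    then show "bounded_linear (\<lambda>h. \<integral>y. g y * K' (x - y) h \<partial>lborel)"
      by (simp add: linear_conv_bounded_linear)
    fix h :: 'a assume h: "norm h \<le> 1"
    have "(\<integral>y. g y * K (x + h - y) \<partial>lborel) - (\<integral>y. g y * K (x - y) \<partial>lborel) - (\<integral>y. g y * K' (x - y) h \<partial>lborel)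
       = (\<integral>y. g y * (K ((x - y) + h) - K (x - y) - K' (x - y) h) \<partial>lborel)"
    proof -
      have "(\<lambda>y. g y * (K ((x - y) + h) - K (x - y) - K' (x - y) h))
          = (\<lambda>y. g y * K (x + h - y) - g y * K (x - y) - g y * K' (x - y) h)"
        by (simp add: fun_eq_iff right_diff_distrib add_diff_eq diff_add_eq)
      then show ?thesis by (simp add: int)
    qed
    \<comment> \<open>Shifting by \<open>h\<close> of norm at most 1 enlarges the support radius
      from \<open>R\<close> to \<open>R + 1\<close>.\<close>
    also have "\<bar>\<dots>\<bar> \<le> (M * (C * (norm h)\<^sup>2)) * (unit_ball_vol DIM('a) * (R + 1) ^ DIM('a))"
    proof (rule integral_bounded_support(2)[where x=x])
      show "\<bar>g y * (K ((x - y) + h) - K (x - y) - K' (x - y) h)\<bar> \<le> M * (C * (norm h)\<^sup>2)" for y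
        unfolding abs_mult by (intro mult_mono M C h M0) auto
      show "g y * (K ((x - y) + h) - K (x - y) - K' (x - y) h) = 0" if "R + 1 < dist x y" for y
      proof -
        have "R \<le> norm (x - y)" "R \<le> norm ((x - y) + h)"
          using that h norm_diff_ineq[of "x - y" h] by (auto simp: dist_norm)
        then show ?thesis by (simp add: supp)
      qed
    qed (use R in auto)
    finally show "norm ((\<integral>y. g y * K (x + h - y) \<partial>lborel) - (\<integral>y. g y * K (x - y) \<partial>lborel)
        - (\<integral>y. g y * K' (x - y) h \<partial>lborel))
      \<le> M * C * (unit_ball_vol DIM('a) * (R + 1) ^ DIM('a)) * (norm h)\<^sup>2"
      by (simp add: ac_simps)
  qed
qed

lemma C1_kernel_bump:
  assumes k: "k \<ge> 3" and s: "0 \<le> s"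
  shows "C1_kernel s (bump k s) (\<lambda>z h. - 2 * real k * (z \<bullet> h) * bump (k - 1) s (z :: 'a::euclidean_space))"
proof -
  obtain C where "0 \<le> C" "\<And>z h :: 'a. norm h \<le> 1 \<Longrightarrow>
    \<bar>bump k s (z + h) - bump k s z + 2 * real k * (z \<bullet> h) * bump (k - 1) s z\<bar> \<le> C * (norm h)\<^sup>2"
    using bump_Taylor1[OF k s] by blast
  moreover have "linear (\<lambda>h. - 2 * real k * (z \<bullet> h) * bump (k - 1) s z)" for z :: 'a
    by (rule linearI) (simp_all add: inner_add_right algebra_simps)
  ultimately show ?thesis using k s unfolding C1_kernel_def
    by (auto simp: bump_eq_0 intro!: continuous_intros)
qed

text \<open>The derivatives along basis vectors are continuous with compact support, hence bounded;
  linearity extends the bound to every direction.\<close>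

lemma C1_kernel_Lipschitz:
  assumes K: "C1_kernel R K (K' :: 'a::euclidean_space \<Rightarrow> 'a \<Rightarrow> real)"
  obtains C where "C \<ge> 0" "\<And>z h. norm h \<le> 1 \<Longrightarrow> \<bar>K (z + h) - K z\<bar> \<le> C * norm h"
proof -
  obtain C where C: "C \<ge> 0" "\<And>z h. norm h \<le> 1 \<Longrightarrow> \<bar>K (z + h) - K z - K' z h\<bar> \<le> C * (norm h)\<^sup>2"
    using K unfolding C1_kernel_def by blast
  have lin: "\<And>z. linear (K' z)"
    and supp: "\<And>z v. R \<le> norm z \<Longrightarrow> K' z v = 0"
    and cont: "\<And>v. continuous_on UNIV (\<lambda>z. K' z v)"
    using K unfolding C1_kernel_def by auto
  have "\<forall>v. \<exists>B. 0 \<le> B \<and> (\<forall>z. \<bar>K' z v\<bar> \<le> B)"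
    using continuous_bounded_support[OF cont supp] by metis
  then obtain B where B: "\<And>v. 0 \<le> B v" "\<And>v z. \<bar>K' z v\<bar> \<le> B v" by metis
  have K': "\<bar>K' z h\<bar> \<le> (\<Sum>i\<in>Basis. B i) * norm h" for z h
  proof -
    have "K' z h = K' z (\<Sum>i\<in>Basis. (h \<bullet> i) *\<^sub>R i)" by (simp add: euclidean_representation)
    also have "\<dots> = (\<Sum>i\<in>Basis. (h \<bullet> i) * K' z i)"
      by (simp add: linear_sum[OF lin] linear_scale[OF lin])
    also have "\<bar>\<dots>\<bar> \<le> (\<Sum>i\<in>Basis. \<bar>(h \<bullet> i) * K' z i\<bar>)" by (rule sum_abs)
    also have "\<dots> \<le> (\<Sum>i\<in>Basis. norm h * B i)"
      by (intro sum_mono) (auto simp: abs_mult intro!: mult_mono B Basis_le_norm)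
    finally show ?thesis by (simp add: sum_distrib_left mult.commute)
  qed
  show ?thesis
  proof (rule that)
    show "C + (\<Sum>i\<in>Basis. B i) \<ge> 0" using C B by (simp add: sum_nonneg)
    fix z h :: 'a assume h: "norm h \<le> 1"
    have "C * (norm h)\<^sup>2 \<le> C * norm h"
      using C h by (intro mult_left_mono) (auto simp: power2_eq_square mult_left_le)
    then have "\<bar>K (z + h) - K z\<bar> \<le> C * norm h + (\<Sum>i\<in>Basis. B i) * norm h"
      using C(2)[OF h, of z] K'[of z h] by linarith
    then show "\<bar>K (z + h) - K z\<bar> \<le> (C + (\<Sum>i\<in>Basis. B i)) * norm h" by (simp add: distrib_right)
  qed
qed

text \<open>The remainder of the product is \<open>z \<bullet> v\<close> times the remainder of
  \<open>K\<close> plus \<open>h \<bullet> v\<close> times an increment of \<open>K\<close>, and the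
  Lipschitz bound makes the latter quadratic. Gradients of the kernels have this product form and
  can thus be differentiated again.\<close>

lemma C1_kernel_mult_inner:
  assumes K: "C1_kernel R K K'"
  shows "C1_kernel R (\<lambda>z. (z \<bullet> v) * K z) (\<lambda>z h. (h \<bullet> v) * K z + (z \<bullet> v) * K' z h)"
proof -
  obtain C where C: "C \<ge> 0" "\<And>z h. norm h \<le> 1 \<Longrightarrow> \<bar>K (z + h) - K z - K' z h\<bar> \<le> C * (norm h)\<^sup>2"
    using K unfolding C1_kernel_def by blast
  obtain C' where C': "C' \<ge> 0" "\<And>z h. norm h \<le> 1 \<Longrightarrow> \<bar>K (z + h) - K z\<bar> \<le> C' * norm h"
    using C1_kernel_Lipschitz[OF K] by blast
  have R: "R \<ge> 0" and lin: "\<And>z. linear (K' z)"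
    and supp: "\<And>z. R \<le> norm z \<Longrightarrow> K z = 0" "\<And>z v. R \<le> norm z \<Longrightarrow> K' z v = 0"
    and cont: "continuous_on UNIV K" "\<And>v. continuous_on UNIV (\<lambda>z. K' z v)"
    using K unfolding C1_kernel_def by auto
  have rem: "\<bar>((z + h) \<bullet> v) * K (z + h) - (z \<bullet> v) * K z - ((h \<bullet> v) * K z + (z \<bullet> v) * K' z h)\<bar>
      \<le> ((R + 1) * norm v * C + norm v * C') * (norm h)\<^sup>2" if h: "norm h \<le> 1" for z h
  proof (cases "norm z \<le> R + 1")
    case False
    then have "norm z \<ge> R" "norm (z + h) \<ge> R" using norm_diff_ineq[of z h] h by linarith+
    then show ?thesis using R C C' by (simp add: supp)
  next
    case True
    have "\<bar>z \<bullet> v\<bar> \<le> (R + 1) * norm v"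
      using Cauchy_Schwarz_ineq2[of z v] mult_right_mono[OF True, of "norm v"] by simp
    then have 1: "\<bar>(z \<bullet> v) * (K (z + h) - K z - K' z h)\<bar> \<le> ((R + 1) * norm v) * (C * (norm h)\<^sup>2)"
      unfolding abs_mult using C(2)[OF h] R by (intro mult_mono) auto
    have 2: "\<bar>(h \<bullet> v) * (K (z + h) - K z)\<bar> \<le> (norm h * norm v) * (C' * norm h)"
      unfolding abs_mult using C'(2)[OF h] by (intro mult_mono Cauchy_Schwarz_ineq2) auto
    have "((z + h) \<bullet> v) * K (z + h) - (z \<bullet> v) * K z - ((h \<bullet> v) * K z + (z \<bullet> v) * K' z h)
      = (z \<bullet> v) * (K (z + h) - K z - K' z h) + (h \<bullet> v) * (K (z + h) - K z)"
      by (simp add: inner_add_left algebra_simps)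
    moreover have "((R + 1) * norm v * C + norm v * C') * (norm h)\<^sup>2
      = ((R + 1) * norm v) * (C * (norm h)\<^sup>2) + (norm h * norm v) * (C' * norm h)"
      by (simp add: power2_eq_square algebra_simps)
    ultimately show ?thesis using 1 2 by linarith
  qed
  moreover have "linear (\<lambda>h. (h \<bullet> v) * K z + (z \<bullet> v) * K' z h)" for z
    by (rule linearI) (simp_all add: inner_add_left linear_add[OF lin] linear_scale[OF lin] algebra_simps)
  moreover have "0 \<le> (R + 1) * norm v * C + norm v * C'" using R C C' by simp
  ultimately show ?thesis unfolding C1_kernel_def using R
    by (auto simp: supp intro!: continuous_intros cont)
qed

section \<open>Convolutions with the kernels and with their derivatives\<close>

definition conv :: "('a::euclidean_space \<Rightarrow> real) \<Rightarrow> ('a \<Rightarrow> real) \<Rightarrow> 'a \<Rightarrow> real" where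
  "conv g L x = (\<integral>y. g y * L (x - y) \<partial>lborel)"

definition bump_grad :: "nat \<Rightarrow> real \<Rightarrow> 'a::euclidean_space \<Rightarrow> 'a \<Rightarrow> real" where
  "bump_grad k s v z = - 2 * real k * ((z \<bullet> v) * bump (k - 1) s z)"

text \<open>Kept in product-rule form so that it matches the derivative produced by
  \<open>C1_kernel_mult_inner\<close>; \<open>v\<close> is the direction of the first
  differentiation, \<open>w\<close> that of the second.\<close>

definition bump_hess :: "nat \<Rightarrow> real \<Rightarrow> 'a::euclidean_space \<Rightarrow> 'a \<Rightarrow> 'a \<Rightarrow> real" where
  "bump_hess k s v w z = - 2 * real k * ((w \<bullet> v) * bump (k - 1) s z
     + (z \<bullet> v) * (- 2 * real (k - 1) * (z \<bullet> w) * bump (k - 2) s z))"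

lemma conv_cmult: "conv g (\<lambda>z. c * L z) x = c * conv g L x"
  unfolding conv_def by (simp add: mult.left_commute)

lemma has_derivative_conv_bump:
  fixes g :: "'a::euclidean_space \<Rightarrow> real"
  assumes "g \<in> borel_measurable borel" "\<And>y. \<bar>g y\<bar> \<le> M" "k \<ge> 3" "0 \<le> s"
  shows "(conv g (bump k s) has_derivative (\<lambda>h. conv g (bump_grad k s h) x)) (at x)"
  using has_derivative_convolution[OF assms(1,2) C1_kernel_bump[OF assms(3,4)]]
  unfolding conv_def[abs_def] bump_grad_def by (simp add: mult.assoc)

lemma has_derivative_conv_bump_grad:
  fixes g :: "'a::euclidean_space \<Rightarrow> real"
  assumes g: "g \<in> borel_measurable borel" "\<And>y. \<bar>g y\<bar> \<le> M" and k: "k \<ge> 4" and s: "0 \<le> s"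
  shows "(conv g (bump_grad k s v) has_derivative (\<lambda>w. conv g (bump_hess k s v w) x)) (at x)"
proof -
  have "k - 1 \<ge> 3" "k - 1 - 1 = k - 2" using k by auto
  from has_derivative_convolution[OF g C1_kernel_mult_inner[OF C1_kernel_bump[OF this(1) s]]] this
  have "(conv g (\<lambda>z. (z \<bullet> v) * bump (k - 1) s z) has_derivative
      (\<lambda>w. conv g (\<lambda>z. (w \<bullet> v) * bump (k - 1) s z
         + (z \<bullet> v) * (- 2 * real (k - 1) * (z \<bullet> w) * bump (k - 2) s z)) x)) (at x)"
    unfolding conv_def[abs_def] by simp
  from has_derivative_mult_right[OF this, of "- 2 * real k"] show ?thesis
    unfolding bump_grad_def[abs_def] bump_hess_def[abs_def] conv_cmult[symmetric] by simp
qed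

text \<open>The Hessian kernel splits into two kernels whose convolutions are themselves
  differentiable, and continuity follows. The lower of the two orders, \<open>k - 2\<close>, has to
  be at least 3 for this, whence \<open>k \<ge> 5\<close>.\<close>

lemma continuous_on_conv_bump_hess:
  fixes g :: "'a::euclidean_space \<Rightarrow> real"
  assumes g: "g \<in> borel_measurable borel" "\<And>y. \<bar>g y\<bar> \<le> M" and k: "k \<ge> 5" and s: "0 \<le> s"
  shows "continuous_on UNIV (conv g (bump_hess k s v w))"
proof -
  have k': "k - 1 \<ge> 3" "k - 2 \<ge> 3" "k - 1 > 0" "k - 2 > 0" using k by auto
  note d1 = has_derivative_convolution[OF g C1_kernel_bump[OF k'(1) s]]
  note d2 = has_derivative_convolution[OF g
      C1_kernel_mult_inner[OF C1_kernel_mult_inner[OF C1_kernel_bump[OF k'(2) s], of w], of v]]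
  have c: "continuous_on UNIV (conv g (bump (k - 1) s))"
    "continuous_on UNIV (conv g (\<lambda>z. (z \<bullet> v) * ((z \<bullet> w) * bump (k - 2) s z)))"
    unfolding conv_def[abs_def] continuous_on_eq_continuous_at[OF open_UNIV]
    using has_derivative_continuous[OF d1] has_derivative_continuous[OF d2] by auto
  have i: "integrable lborel (\<lambda>y. g y * bump (k - 1) s (x - y))"
    "integrable lborel (\<lambda>y. g y * (((x - y) \<bullet> v) * (((x - y) \<bullet> w) * bump (k - 2) s (x - y))))" for x
    by (rule integrable_convolution[OF g, where R=s] 
        integrable_convolution[OF g, where R=s and L="\<lambda>z. (z \<bullet> v) * ((z \<bullet> w) * bump (k - 2) s z)"];
      use s k' in \<open>auto intro!: continuous_intros simp: bump_eq_0\<close>)+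
  have "conv g (bump_hess k s v w) x = - 2 * real k * (w \<bullet> v) * conv g (bump (k - 1) s) x
      + 4 * real k * real (k - 1) * conv g (\<lambda>z. (z \<bullet> v) * ((z \<bullet> w) * bump (k - 2) s z)) x" for x
  proof -
    have "g y * bump_hess k s v w (x - y) = (- 2 * real k * (w \<bullet> v)) * (g y * bump (k - 1) s (x - y))
      + (4 * real k * real (k - 1)) * (g y * (((x - y) \<bullet> v) * (((x - y) \<bullet> w) * bump (k - 2) s (x - y))))" for y
      unfolding bump_hess_def by (simp add: algebra_simps)
    then show ?thesis unfolding conv_def
      by (simp only: Bochner_Integration.integral_add integrable_mult_right i integral_mult_right_zero)
  qed
  then show ?thesis using c by (simp add: continuous_intros)
qed

lemma continuous_on_bump_hess: "continuous_on UNIV (bump_hess k s v w)"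
  unfolding bump_hess_def by (intro continuous_intros)

lemma bump_hess_eq_0: "0 \<le> s \<Longrightarrow> s \<le> norm z \<Longrightarrow> 3 \<le> k \<Longrightarrow> bump_hess k s v w z = 0"
  unfolding bump_hess_def by (simp add: bump_eq_0)

lemma sum_bump_hess: "(\<Sum>i\<in>Basis. bump_hess k s i i z) = bump_laplacian k s (z :: 'a::euclidean_space)"
proof -
  have "(\<Sum>i\<in>Basis. bump_hess k s i i z) = (\<Sum>i\<in>Basis. - 2 * real k * bump (k - 1) s z
      + 4 * real k * real (k - 1) * bump (k - 2) s z * ((z \<bullet> i) * (z \<bullet> i)))"
    unfolding bump_hess_def by (intro sum.cong) (auto simp: algebra_simps)
  also have "\<dots> = bump_laplacian k s z"
    unfolding sum.distrib sum_distrib_left[symmetric] bump_laplacian_def euclidean_inner[of z z]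
    by simp
  finally show ?thesis .
qed

lemma sum_conv_bump_hess:
  fixes g :: "'a::euclidean_space \<Rightarrow> real"
  assumes g: "g \<in> borel_measurable borel" "\<And>y. \<bar>g y\<bar> \<le> M" and k: "k \<ge> 3" and s: "0 \<le> s"
  shows "(\<Sum>i\<in>Basis. conv g (bump_hess k s i i) x) = conv g (bump_laplacian k s) x"
proof -
  have "(\<Sum>i\<in>Basis. conv g (bump_hess k s i i) x) = (\<integral>y. (\<Sum>i\<in>Basis. g y * bump_hess k s i i (x - y)) \<partial>lborel)"
    unfolding conv_def
    by (rule Bochner_Integration.integral_sum[symmetric])
       (rule integrable_convolution[OF g continuous_on_bump_hess, of s], simp add: bump_hess_eq_0 s k)
  then show ?thesis by (simp add: sum_bump_hess conv_def flip: sum_distrib_left)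
qed

lemma (in prob_space) abs_expectation_le:
  fixes f :: "'a \<Rightarrow> real"
  assumes "f \<in> borel_measurable M" "AE w in M. \<bar>f w\<bar> \<le> B"
  shows "\<bar>expectation f\<bar> \<le> B"
proof -
  have i: "integrable M f" using assms by (intro integrable_const_bound[of _ B]) auto
  have "\<bar>expectation f\<bar> \<le> (\<integral>w. \<bar>f w\<bar> \<partial>M)" by (rule integral_abs_bound)
  also have "\<dots> \<le> (\<integral>w. B \<partial>M)" using assms i by (intro integral_mono_AE) auto
  finally show ?thesis by (simp add: prob_space)
qed

text \<open>In the second-order expansion with \<open>h = \<epsilon> *\<^sub>R w\<close> the linear
  term averages to 0 and the second moments combine into the Laplacian.\<close>

lemma bump_mean_expansion:
  assumes k: "k \<ge> 4" and s: "0 \<le> s"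
  obtains c C where "c > 0" "C \<ge> 0" "\<And>\<epsilon> (z :: 'a::euclidean_space). 0 < \<epsilon> \<Longrightarrow> \<epsilon> \<le> 1 \<Longrightarrow>
    \<bar>(\<integral>w. bump k s (z + \<epsilon> *\<^sub>R w) \<partial>ball_prob) - bump k s z - \<epsilon>\<^sup>2 * (c * bump_laplacian k s z)\<bar> \<le> C * \<epsilon> ^ 3"
proof -
  obtain c where c: "c > 0" "\<And>z :: 'a. (\<integral>w. (z \<bullet> w)\<^sup>2 \<partial>ball_prob) = c * (z \<bullet> z)"
    "(\<integral>w. (w::'a) \<bullet> w \<partial>ball_prob) = c * DIM('a)"
    using integral_ball_prob_second_moment by blast
  obtain C where C: "0 \<le> C" "\<And>z h :: 'a::euclidean_space. norm h \<le> 1 \<Longrightarrow>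
    \<bar>bump k s (z + h) - bump k s z + 2 * real k * (z \<bullet> h) * bump (k - 1) s z
      + real k * (h \<bullet> h) * bump (k - 1) s z
      - 2 * real k * real (k - 1) * (z \<bullet> h)\<^sup>2 * bump (k - 2) s z\<bar> \<le> C * (norm h) ^ 3"
    using bump_Taylor2[OF k s] by blast
  show ?thesis
  \<comment> \<open>The covariance factor \<open>c\<close> times the 1/2 of the second Taylor
    coefficient.\<close>
  proof (rule that[of "c / 2" C])
    fix \<epsilon> :: real and z :: 'a assume \<epsilon>: "0 < \<epsilon>" "\<epsilon> \<le> 1"
    let ?E = "\<lambda>w. bump k s (z + \<epsilon> *\<^sub>R w) - bump k s z + (2 * real k * bump (k - 1) s z * \<epsilon>) * (z \<bullet> w)
      + (real k * bump (k - 1) s z * \<epsilon>\<^sup>2) * (w \<bullet> w)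
      - (2 * real k * real (k - 1) * bump (k - 2) s z * \<epsilon>\<^sup>2) * (z \<bullet> w)\<^sup>2"
    have m [measurable]: "(\<lambda>w. bump k s (z + \<epsilon> *\<^sub>R w)) \<in> borel_measurable borel"
      by (intro borel_measurable_continuous_onI continuous_intros)
    have i: "integrable ball_prob (\<lambda>w. bump k s (z + \<epsilon> *\<^sub>R w))"
      by (rule integrable_ball_prob_bounded[OF m, where B="(s\<^sup>2) ^ k"]) (simp add: bump_le s)
    have "(\<integral>w. ?E w \<partial>ball_prob) = (\<integral>w. bump k s (z + \<epsilon> *\<^sub>R w) \<partial>ball_prob) - bump k s z
      + (real k * bump (k - 1) s z * \<epsilon>\<^sup>2) * (c * DIM('a))
      - (2 * real k * real (k - 1) * bump (k - 2) s z * \<epsilon>\<^sup>2) * (c * (z \<bullet> z))"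
      using i ball_prob.prob_space[where 'a='a]
      by (simp add: integral_ball_prob_inner c)
    also have "\<dots> = (\<integral>w. bump k s (z + \<epsilon> *\<^sub>R w) \<partial>ball_prob) - bump k s z
        - \<epsilon>\<^sup>2 * (c / 2 * bump_laplacian k s z)"
      by (simp add: bump_laplacian_def field_simps)
    finally have eq: "(\<integral>w. bump k s (z + \<epsilon> *\<^sub>R w) \<partial>ball_prob) - bump k s z
        - \<epsilon>\<^sup>2 * (c / 2 * bump_laplacian k s z) = (\<integral>w. ?E w \<partial>ball_prob)" by simp
    have "\<bar>?E w\<bar> \<le> C * \<epsilon> ^ 3" if "norm w < 1" for w
    proof -
      have n: "norm (\<epsilon> *\<^sub>R w) \<le> \<epsilon>" using \<epsilon> that by (simp add: mult_left_le)
      then have "\<bar>?E w\<bar> \<le> C * (norm (\<epsilon> *\<^sub>R w)) ^ 3"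
        using C(2)[OF order_trans[OF n \<epsilon>(2)], of z] \<epsilon> by (simp add: power_mult_distrib power2_eq_square ac_simps)
      also have "\<dots> \<le> C * \<epsilon> ^ 3" using n C by (intro mult_left_mono power_mono) auto
      finally show ?thesis .
    qed
    then show "\<bar>(\<integral>w. bump k s (z + \<epsilon> *\<^sub>R w) \<partial>ball_prob) - bump k s z
        - \<epsilon>\<^sup>2 * (c / 2 * bump_laplacian k s z)\<bar> \<le> C * \<epsilon> ^ 3"
      unfolding eq using AE_ball_prob_norm[where 'a='a]
      by (intro ball_prob.abs_expectation_le) (auto elim!: eventually_mono)
  qed (use c C in auto)
qed

subsection \<open>Discrete mean values\<close>

lemma lborel_integral_translate:
  fixes f :: "'a::euclidean_space \<Rightarrow> real"
  assumes "f \<in> borel_measurable borel"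
  shows "(\<integral>y. f (y + c) \<partial>lborel) = (\<integral>y. f y \<partial>lborel)"
proof -
  have "(\<integral>y. f (c + y) \<partial>lborel) = integral\<^sup>L (distr lborel borel ((+) c)) f"
    using assms by (subst integral_distr) auto
  then show ?thesis by (simp add: lborel_distr_plus add.commute)
qed

lemma Fubini_ball_prob_lborel:
  fixes f :: "'a::euclidean_space \<Rightarrow> 'a \<Rightarrow> real"
  assumes [measurable]: "case_prod f \<in> borel_measurable (borel \<Otimes>\<^sub>M borel)"
    and int: "\<And>w. integrable lborel (f w)" and B: "\<And>w. (\<integral>y. \<bar>f w y\<bar> \<partial>lborel) \<le> B"
  shows "(\<integral>y. (\<integral>w. f w y \<partial>ball_prob) \<partial>lborel) = (\<integral>w. (\<integral>y. f w y \<partial>lborel) \<partial>ball_prob)"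
proof -
  interpret P: pair_sigma_finite "ball_prob :: 'a measure" "lborel :: 'a measure"
    by (intro pair_sigma_finite.intro ball_prob.sigma_finite_measure_axioms sigma_finite_lborel)
  have s: "sets ((ball_prob :: 'a measure) \<Otimes>\<^sub>M (lborel :: 'a measure)) = sets (borel \<Otimes>\<^sub>M borel)"
    by (rule sets_pair_measure_cong) auto
  have [measurable]: "case_prod f \<in> borel_measurable (ball_prob \<Otimes>\<^sub>M lborel)"
    using assms(1) by (simp cong: measurable_cong_sets add: s)
  have "integrable (ball_prob \<Otimes>\<^sub>M lborel) (case_prod f)"
  proof (rule P.Fubini_integrable)
    show "integrable ball_prob (\<lambda>w. \<integral>y. norm (case_prod f (w, y)) \<partial>lborel)"
      using B by (intro ball_prob.integrable_const_bound[of _ B]) auto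
  qed (use int in auto)
  then show ?thesis by (rule P.Fubini_integral)
qed

text \<open>Averaging is moved from the kernel onto \<open>W\<close> by Fubini and the substitution
  of \<open>y + \<epsilon> *\<^sub>R w\<close> for \<open>y\<close>. There the mean value property
  absorbs it, at those \<open>y\<close> where \<open>q (x - y)\<close> can be nonzero.\<close>

lemma integral_mean_kernel:
  fixes W q :: "'a::euclidean_space \<Rightarrow> real"
  assumes W [measurable]: "W \<in> borel_measurable borel" and M: "\<And>y. \<bar>W y\<bar> \<le> M" and s: "0 \<le> s"
    and q: "continuous_on UNIV q" "\<And>z. s \<le> norm z \<Longrightarrow> q z = 0"
    and mean: "\<And>y. norm (x - y) < s \<Longrightarrow> W y = (\<integral>w. W (y + \<epsilon> *\<^sub>R w) \<partial>ball_prob)"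
  shows "(\<integral>y. W y * (\<integral>w. q (x - y + \<epsilon> *\<^sub>R w) \<partial>ball_prob) \<partial>lborel) = (\<integral>y. W y * q (x - y) \<partial>lborel)"
proof -
  have [measurable]: "q \<in> borel_measurable borel"
    using q by (intro borel_measurable_continuous_onI)
  obtain B where B: "0 \<le> B" "\<And>z. \<bar>q z\<bar> \<le> B"
    using continuous_bounded_support[OF q] by blast
  have M0: "0 \<le> M" using M[of 0] by linarith
  have bd: "integrable lborel (\<lambda>y. V y * q (x' - y))"
    "(\<integral>y. \<bar>V y * q (x' - y)\<bar> \<partial>lborel) \<le> M * B * (unit_ball_vol DIM('a) * s ^ DIM('a))"
    if V [measurable]: "V \<in> borel_measurable borel" and VM: "\<And>y. \<bar>V y\<bar> \<le> M" for V x'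
  proof -
    show "integrable lborel (\<lambda>y. V y * q (x' - y))"
      by (rule integrable_convolution[OF V VM q])
    have "\<bar>\<integral>y. \<bar>V y * q (x' - y)\<bar> \<partial>lborel\<bar> \<le> M * B * (unit_ball_vol DIM('a) * s ^ DIM('a))"
      by (rule integral_bounded_support(2)[where x=x'])
         (auto simp: abs_mult s dist_norm q intro!: mult_mono VM B M0)
    then show "(\<integral>y. \<bar>V y * q (x' - y)\<bar> \<partial>lborel) \<le> M * B * (unit_ball_vol DIM('a) * s ^ DIM('a))"
      by linarith
  qed
  have "(\<integral>y. W y * (\<integral>w. q (x - y + \<epsilon> *\<^sub>R w) \<partial>ball_prob) \<partial>lborel)
      = (\<integral>y. (\<integral>w. W y * q (x + \<epsilon> *\<^sub>R w - y) \<partial>ball_prob) \<partial>lborel)"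
    by (simp add: algebra_simps)
  also have "\<dots> = (\<integral>w. (\<integral>y. W y * q (x + \<epsilon> *\<^sub>R w - y) \<partial>lborel) \<partial>ball_prob)"
    by (rule Fubini_ball_prob_lborel[OF _ bd[OF W M]]) simp
  also have "\<dots> = (\<integral>w. (\<integral>y. W (y + \<epsilon> *\<^sub>R w) * q (x - y) \<partial>lborel) \<partial>ball_prob)"
  proof (rule Bochner_Integration.integral_cong[OF refl])
    fix w
    show "(\<integral>y. W y * q (x + \<epsilon> *\<^sub>R w - y) \<partial>lborel) = (\<integral>y. W (y + \<epsilon> *\<^sub>R w) * q (x - y) \<partial>lborel)"
      by (subst lborel_integral_translate[symmetric, of _ "\<epsilon> *\<^sub>R w"]) auto
  qed
  also have "\<dots> = (\<integral>y. (\<integral>w. W (y + \<epsilon> *\<^sub>R w) * q (x - y) \<partial>ball_prob) \<partial>lborel)"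
    by (rule Fubini_ball_prob_lborel[OF _ bd, symmetric]) (auto intro: M)
  also have "\<dots> = (\<integral>y. W y * q (x - y) \<partial>lborel)"
  proof (rule Bochner_Integration.integral_cong[OF refl])
    fix y
    show "(\<integral>w. W (y + \<epsilon> *\<^sub>R w) * q (x - y) \<partial>ball_prob) = W y * q (x - y)"
      using mean[of y] q(2)[of "x - y"] by (cases "norm (x - y) < s") auto
  qed
  finally show ?thesis .
qed

lemma continuous_on_bump_laplacian: "continuous_on UNIV (bump_laplacian k s)"
  unfolding bump_laplacian_def[abs_def] by (intro continuous_intros)

lemma bump_laplacian_eq_0: "0 \<le> s \<Longrightarrow> s \<le> norm z \<Longrightarrow> 3 \<le> k \<Longrightarrow> bump_laplacian k s z = 0"
  unfolding bump_laplacian_def by (simp add: bump_eq_0)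

text \<open>Averaging the kernel leaves the convolution unchanged, yet by
  \<open>bump_mean_expansion\<close> it adds a multiple of \<open>\<epsilon>\<^sup>2\<close> times
  the Laplacian up to an error of order \<open>\<epsilon> ^ 3\<close>. The Laplacian term is
  therefore of order \<open>\<epsilon>\<close>, with a constant independent of \<open>W\<close>,
  \<open>M\<close>, \<open>\<epsilon>\<close> and \<open>x\<close>.\<close>

lemma conv_bump_laplacian_le:
  assumes k: "k \<ge> 4" and s: "0 \<le> s"
  obtains C where "C \<ge> 0"
    "\<And>W M \<epsilon> (x :: 'a::euclidean_space). W \<in> borel_measurable borel \<Longrightarrow> (\<And>y. \<bar>W y\<bar> \<le> M) \<Longrightarrow>
      0 < \<epsilon> \<Longrightarrow> \<epsilon> \<le> 1 \<Longrightarrow>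
      (\<And>y. norm (x - y) < s \<Longrightarrow> W y = (\<integral>w. W (y + \<epsilon> *\<^sub>R w) \<partial>ball_prob)) \<Longrightarrow>
      \<bar>conv W (bump_laplacian k s) x\<bar> \<le> C * M * \<epsilon>"
proof -
  obtain c C where c: "c > 0" and C: "C \<ge> 0" and exp: "\<And>\<epsilon> (z :: 'a). 0 < \<epsilon> \<Longrightarrow> \<epsilon> \<le> 1 \<Longrightarrow>
    \<bar>(\<integral>w. bump k s (z + \<epsilon> *\<^sub>R w) \<partial>ball_prob) - bump k s z - \<epsilon>\<^sup>2 * (c * bump_laplacian k s z)\<bar> \<le> C * \<epsilon> ^ 3"
    using bump_mean_expansion[OF k s] by blast
  \<comment> \<open>Volume of a ball that contains the support of the averaged kernel, as
    \<open>\<epsilon> \<le> 1\<close>.\<close>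
  define V where "V = unit_ball_vol DIM('a) * (s + 1) ^ DIM('a)"
  have V: "V \<ge> 0" using s by (simp add: V_def)
  show ?thesis
  proof (rule that[of "C * V / c"])
    show "0 \<le> C * V / c" using c C V by simp
    fix W :: "'a \<Rightarrow> real" and M \<epsilon> :: real and x :: 'a
    assume W [measurable]: "W \<in> borel_measurable borel" and M: "\<And>y. \<bar>W y\<bar> \<le> M"
      and \<epsilon>: "0 < \<epsilon>" "\<epsilon> \<le> 1"
      and mean: "\<And>y. norm (x - y) < s \<Longrightarrow> W y = (\<integral>w. W (y + \<epsilon> *\<^sub>R w) \<partial>ball_prob)"
    define A :: "'a \<Rightarrow> real" where "A = (\<lambda>z. \<integral>w. bump k s (z + \<epsilon> *\<^sub>R w) \<partial>ball_prob)"
    have M0: "0 \<le> M" using M[of 0] by linarith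
    have bump: "continuous_on UNIV (bump k s :: 'a \<Rightarrow> real)" "\<And>z::'a. s \<le> norm z \<Longrightarrow> bump k s z = 0"
      using k s by (auto simp: bump_eq_0 intro!: continuous_intros)
    have [measurable]: "bump k s \<in> borel_measurable (borel :: 'a measure)"
      "bump_laplacian k s \<in> borel_measurable (borel :: 'a measure)"
      using bump(1) continuous_on_bump_laplacian by (auto intro: borel_measurable_continuous_onI)
    have [measurable]: "A \<in> borel_measurable borel"
      unfolding A_def by measurable
    have A0: "A z = 0" if "s + 1 < norm z" for z
    proof -
      have "A z = (\<integral>w. 0 \<partial>(ball_prob :: 'a measure))"
        unfolding A_def
      proof (rule integral_cong_AE)
        show "AE w in ball_prob. bump k s (z + \<epsilon> *\<^sub>R w) = 0"
          using AE_ball_prob_norm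
        proof eventually_elim
          case (elim w)
          have "norm (\<epsilon> *\<^sub>R w) \<le> 1" using \<epsilon> elim by (simp add: mult_le_one)
          then show ?case using that norm_diff_ineq[of z "\<epsilon> *\<^sub>R w"] by (intro bump(2)) linarith
        qed
      qed auto
      then show ?thesis by simp
    qed
    have A_le: "\<bar>A z\<bar> \<le> (s\<^sup>2) ^ k" for z
      unfolding A_def by (rule ball_prob.abs_expectation_le) (auto simp: bump_le s)
    have ib: "integrable lborel (\<lambda>y. W y * bump k s (x - y))"
      by (rule integrable_convolution[OF W M bump])
    have iA: "integrable lborel (\<lambda>y. W y * A (x - y))"
      by (rule integral_bounded_support(1)[where x=x and R="s + 1" and B="M * (s\<^sup>2) ^ k"])
         (auto simp: abs_mult A0 s dist_norm intro!: mult_mono M A_le M0)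
    have il: "integrable lborel (\<lambda>y. W y * bump_laplacian k s (x - y))"
      by (rule integrable_convolution[OF W M continuous_on_bump_laplacian, of s])
         (use k s in \<open>simp add: bump_laplacian_eq_0\<close>)
    have eq: "(\<integral>y. W y * A (x - y) \<partial>lborel) = (\<integral>y. W y * bump k s (x - y) \<partial>lborel)"
      unfolding A_def by (rule integral_mean_kernel[OF W M s bump mean])
    have "(\<lambda>y. W y * (A (x - y) - bump k s (x - y) - \<epsilon>\<^sup>2 * (c * bump_laplacian k s (x - y))))
        = (\<lambda>y. W y * A (x - y) - W y * bump k s (x - y) - (\<epsilon>\<^sup>2 * c) * (W y * bump_laplacian k s (x - y)))"
      by (simp add: fun_eq_iff algebra_simps)
    then have "(\<epsilon>\<^sup>2 * c) * conv W (bump_laplacian k s) x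
       = - (\<integral>y. W y * (A (x - y) - bump k s (x - y) - \<epsilon>\<^sup>2 * (c * bump_laplacian k s (x - y))) \<partial>lborel)"
      using ib iA il eq by (simp add: conv_def)
    also have "\<bar>\<dots>\<bar> \<le> M * (C * \<epsilon> ^ 3) * V"
      unfolding V_def abs_minus
    proof (rule integral_bounded_support(2)[where x=x])
      show "\<bar>W y * (A (x - y) - bump k s (x - y) - \<epsilon>\<^sup>2 * (c * bump_laplacian k s (x - y)))\<bar>
          \<le> M * (C * \<epsilon> ^ 3)" for y
        unfolding abs_mult[of "W y"] using exp[OF \<epsilon>, of "x - y"] unfolding A_def
        by (intro mult_mono M M0) auto
    qed (use s k in \<open>auto simp: A0 bump bump_laplacian_eq_0 dist_norm\<close>)
    finally have "\<epsilon>\<^sup>2 * c * \<bar>conv W (bump_laplacian k s) x\<bar> \<le> \<epsilon>\<^sup>2 * c * (C * V / c * M * \<epsilon>)"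
      using \<epsilon> c by (simp add: abs_mult power2_eq_square power3_eq_cube ac_simps)
    then show "\<bar>conv W (bump_laplacian k s) x\<bar> \<le> C * V / c * M * \<epsilon>"
      using \<epsilon> c by (subst (asm) mult_le_cancel_left_pos) auto
  qed
qed

text \<open>\<open>v\<close> may fail to attain its supremum, so a strictly subharmonic perturbation
  is evaluated at a near-maximiser: averaging raises \<open>\<phi>\<close> there by the fixed amount
  \<open>\<kappa>\<close>, past the supremum. The bound \<open>B\<close> concerns only points
  outside \<open>S\<close> that are one step away from \<open>S\<close>.\<close>

lemma discrete_maximum_principle:
  fixes v :: "'a::euclidean_space \<Rightarrow> real"
  assumes v [measurable]: "v \<in> borel_measurable borel" and M: "\<And>y. \<bar>v y\<bar> \<le> M"
    and \<epsilon>: "0 < \<epsilon>" and S: "S \<subseteq> cball 0 R"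
    and mean: "\<And>x. x \<in> S \<Longrightarrow> v x = (\<integral>w. v (x + \<epsilon> *\<^sub>R w) \<partial>ball_prob)"
    and bdry: "\<And>x y. x \<in> S \<Longrightarrow> norm (y - x) < \<epsilon> \<Longrightarrow> y \<notin> S \<Longrightarrow> v y \<le> B"
    and x: "x \<in> S"
  shows "v x \<le> B"
proof (rule field_le_epsilon)
  fix e :: real assume e: "e > 0"
  obtain c where c: "c > 0" "\<And>z :: 'a. (\<integral>w. (z \<bullet> w)\<^sup>2 \<partial>ball_prob) = c * (z \<bullet> z)"
    "(\<integral>w. (w::'a) \<bullet> w \<partial>ball_prob) = c * DIM('a)"
    using integral_ball_prob_second_moment by blast
  \<comment> \<open>Makes the perturbation at most \<open>e\<close> on the ball of radius
    \<open>R + \<epsilon>\<close>, which contains every point one step from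
    \<open>S\<close>.\<close>
  define \<mu> where "\<mu> = e / (R + \<epsilon>)\<^sup>2"
  have "norm x \<le> R" using S x by auto
  then have R: "0 \<le> R" using norm_ge_zero[of x] by linarith
  then have \<mu>: "\<mu> > 0" "\<mu> * (R + \<epsilon>)\<^sup>2 = e" using e \<epsilon> by (auto simp: \<mu>_def)
  define \<phi> where "\<phi> y = v y + \<mu> * (norm y)\<^sup>2" for y
  have \<phi>_ge: "v y \<le> \<phi> y" for y using \<mu> by (simp add: \<phi>_def)
  have \<phi>_le: "\<phi> y \<le> M + \<mu> * R\<^sup>2" if "y \<in> S" for y
    using S that \<mu> M[of y] unfolding \<phi>_def
    by (intro add_mono mult_left_mono power_mono) auto
  then have bdd: "bdd_above (\<phi> ` S)" by (auto intro!: bdd_aboveI)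
  define \<sigma> where "\<sigma> = Sup (\<phi> ` S)"
  have \<sigma>: "\<phi> y \<le> \<sigma>" if "y \<in> S" for y
    unfolding \<sigma>_def using that bdd by (intro cSup_upper) auto
  have "\<sigma> \<le> B + e"
  proof (rule ccontr)
    assume "\<not> \<sigma> \<le> B + e"
    \<comment> \<open>The average of \<open>\<mu> * (norm y)\<^sup>2\<close> over one step exceeds
      its central value by exactly this amount.\<close>
    define \<kappa> where "\<kappa> = \<mu> * \<epsilon>\<^sup>2 * (c * DIM('a))"
    have "\<kappa> > 0" using \<mu> \<epsilon> c by (simp add: \<kappa>_def)
    then have "\<exists>y\<in>\<phi> ` S. \<sigma> - \<kappa> < y"
      unfolding \<sigma>_def using x bdd by (intro less_cSupD) auto
    then obtain y where y: "y \<in> S" "\<sigma> - \<kappa> < \<phi> y" by auto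
    have i1: "integrable ball_prob (\<lambda>w. v (y + \<epsilon> *\<^sub>R w))"
      by (rule integrable_ball_prob_bounded[where B=M]) (auto intro: M)
    have split: "\<phi> (y + \<epsilon> *\<^sub>R w) = v (y + \<epsilon> *\<^sub>R w)
        + (\<mu> * (norm y)\<^sup>2 + (2 * \<mu> * \<epsilon>) * (y \<bullet> w) + (\<mu> * \<epsilon>\<^sup>2) * (w \<bullet> w))" for w
      unfolding \<phi>_def power2_norm_eq_inner
      by (simp add: inner_add_left inner_add_right inner_commute power2_eq_square algebra_simps)
    have i2: "integrable ball_prob (\<lambda>w. \<phi> (y + \<epsilon> *\<^sub>R w))"
      unfolding split using i1 by simp
    have "(\<integral>w. \<phi> (y + \<epsilon> *\<^sub>R w) \<partial>ball_prob) = \<phi> y + \<kappa>"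
      unfolding split using i1 ball_prob.prob_space[where 'a='a]
      by (simp add: integral_ball_prob_inner c mean[OF y(1), symmetric] \<phi>_def \<kappa>_def)
    moreover have "(\<integral>w. \<phi> (y + \<epsilon> *\<^sub>R w) \<partial>ball_prob) \<le> \<sigma>"
    proof (rule ball_prob.integral_le_const[OF i2])
      show "AE w in ball_prob. \<phi> (y + \<epsilon> *\<^sub>R w) \<le> \<sigma>"
        using AE_ball_prob_norm
      proof eventually_elim
        case (elim w)
        have n: "norm (\<epsilon> *\<^sub>R w) < \<epsilon>" using \<epsilon> elim by simp
        show ?case
        proof (cases "y + \<epsilon> *\<^sub>R w \<in> S")
          case False
          then have "v (y + \<epsilon> *\<^sub>R w) \<le> B" using bdry[OF y(1), of "y + \<epsilon> *\<^sub>R w"] n by simp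
          moreover have "norm (y + \<epsilon> *\<^sub>R w) \<le> R + \<epsilon>"
            using n S y norm_triangle_ineq[of y "\<epsilon> *\<^sub>R w"] by auto
          then have "\<mu> * (norm (y + \<epsilon> *\<^sub>R w))\<^sup>2 \<le> e"
            unfolding \<mu>(2)[symmetric] using \<mu> by (intro mult_left_mono power_mono) auto
          ultimately show ?thesis using \<open>\<not> \<sigma> \<le> B + e\<close> unfolding \<phi>_def by linarith
        qed (use \<sigma> in auto)
      qed
    qed
    ultimately show False using y by linarith
  qed
  then show "v x \<le> B + e" using \<phi>_ge[of x] \<sigma>[OF x] by linarith
qed

subsection \<open>Maximum principles and harmonic functions\<close>

text \<open>Along the line in direction \<open>v\<close> the first derivative vanishes at the
  maximum; a positive second derivative would make it positive just after, and the mean value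
  theorem would produce a larger value.\<close>

lemma second_derivative_at_max_le_0:
  fixes g :: "'a::real_normed_vector \<Rightarrow> real"
  assumes U: "open U" "z \<in> U" and max: "\<And>y. y \<in> U \<Longrightarrow> g y \<le> g z"
    and g': "\<And>x. x \<in> U \<Longrightarrow> (g has_derivative g' x) (at x)"
    and g'': "((\<lambda>y. g' y v) has_derivative g'') (at z)"
  shows "g'' v \<le> 0"
proof (rule ccontr)
  assume "\<not> g'' v \<le> 0"
  define \<phi> where "\<phi> t = g (z + t *\<^sub>R v)" for t
  define \<psi> where "\<psi> t = g' (z + t *\<^sub>R v) v" for t
  have "open ((\<lambda>t. z + t *\<^sub>R v) -` U)"
    using U by (intro open_vimage continuous_intros)
  then obtain d where d: "d > 0" "\<And>t. \<bar>t\<bar> < d \<Longrightarrow> z + t *\<^sub>R v \<in> U"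
    using U by (auto simp: open_dist dist_real_def dest: bspec[where x=0])
  have \<phi>': "(\<phi> has_real_derivative \<psi> t) (at t)" if "\<bar>t\<bar> < d" for t
  proof -
    have "((\<lambda>t. z + t *\<^sub>R v) has_derivative (\<lambda>h. h *\<^sub>R v)) (at t)"
      by (auto intro!: derivative_eq_intros)
    from has_derivative_compose[OF this g'[OF d(2)[OF that]]]
    have "(\<phi> has_derivative (\<lambda>h. g' (z + t *\<^sub>R v) (h *\<^sub>R v))) (at t)"
      by (simp add: \<phi>_def[abs_def])
    moreover have "g' (z + t *\<^sub>R v) (h *\<^sub>R v) = \<psi> t * h" for h
      using linear_scale[OF has_derivative_linear[OF g'[OF d(2)[OF that]]], of h v] by (simp add: \<psi>_def)
    ultimately show ?thesis by (simp add: has_field_derivative_def)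
  qed
  have \<psi>': "(\<psi> has_real_derivative g'' v) (at 0)"
  proof -
    have "((\<lambda>t. z + t *\<^sub>R v) has_derivative (\<lambda>h. h *\<^sub>R v)) (at 0)"
      by (auto intro!: derivative_eq_intros)
    from has_derivative_compose[OF this, of "\<lambda>y. g' y v" g''] g''
    have "(\<psi> has_derivative (\<lambda>h. g'' (h *\<^sub>R v))) (at 0)"
      by (simp add: \<psi>_def[abs_def])
    moreover have "g'' (h *\<^sub>R v) = g'' v * h" for h
      using linear_scale[OF has_derivative_linear[OF g''], of h v] by simp
    ultimately show ?thesis by (simp add: has_field_derivative_def)
  qed
  have "\<psi> 0 = 0"
    by (rule DERIV_local_max[OF \<phi>' d(1)]) (use d max in \<open>auto simp: \<phi>_def\<close>)
  moreover obtain d' where d': "d' > 0" "\<And>h. h > 0 \<Longrightarrow> h < d' \<Longrightarrow> \<psi> 0 < \<psi> (0 + h)"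
    using DERIV_pos_inc_right[OF \<psi>'] \<open>\<not> g'' v \<le> 0\<close> by auto
  moreover define t where "t = min d d' / 2"
  moreover have t: "0 < t" "t < d" "t < d'" using d d' by (auto simp: t_def)
  moreover have "\<exists>\<xi>. \<xi> > 0 \<and> \<xi> < t \<and> \<phi> t - \<phi> 0 = (t - 0) * \<psi> \<xi>"
    by (rule MVT2) (use t in \<open>auto intro!: \<phi>'\<close>)
  ultimately obtain \<xi> where "\<phi> t - \<phi> 0 = t * \<psi> \<xi>" "\<psi> \<xi> > 0"
    by (metis add_0 diff_zero order.strict_trans)
  then have "\<phi> t > \<phi> 0" using t by (simp add: diff_eq_eq)
  then show False using max[OF d(2)[of t]] t by (simp add: \<phi>_def)
qed

text \<open>A slightly negative Laplacian is allowed: adding \<open>\<mu> * (y \<bullet> y)\<close>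
  contributes \<open>2 * \<mu> * DIM('a)\<close>, which exceeds \<open>\<kappa>\<close>, so the
  perturbed function has no maximum in \<open>U\<close>. The price is at most
  \<open>\<mu> * R\<^sup>2\<close>.\<close>

lemma laplacian_maximum_principle:
  fixes f :: "'a::euclidean_space \<Rightarrow> real"
  assumes K: "compact K" "K \<subseteq> cball 0 R" and U: "open U" "U \<subseteq> K" and f: "continuous_on K f"
    and f': "\<And>x. x \<in> U \<Longrightarrow> (f has_derivative f' x) (at x)"
    and f'': "\<And>x v. x \<in> U \<Longrightarrow> ((\<lambda>y. f' y v) has_derivative f'' x v) (at x)"
    and lap: "\<And>x. x \<in> U \<Longrightarrow> - \<kappa> \<le> (\<Sum>i\<in>Basis. f'' x i i)" and \<kappa>: "0 \<le> \<kappa>" "\<kappa> < 2 * \<mu>"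
    and B: "\<And>x. x \<in> K - U \<Longrightarrow> f x \<le> B" and x: "x \<in> K"
  shows "f x \<le> B + \<mu> * R\<^sup>2"
proof -
  define g where "g y = f y + \<mu> * (y \<bullet> y)" for y
  have "continuous_on K g" unfolding g_def by (intro continuous_intros f)
  then obtain z where z: "z \<in> K" "\<And>y. y \<in> K \<Longrightarrow> g y \<le> g z"
    using continuous_attains_sup[of K g] K x by blast
  have "z \<notin> U"
  proof
    assume zU: "z \<in> U"
    define g' where "g' y h = f' y h + \<mu> * (y \<bullet> h + h \<bullet> y)" for y h
    have "f'' z i i + 2 * \<mu> * (i \<bullet> i) \<le> 0" for i
    proof (rule second_derivative_at_max_le_0[OF U(1) zU, of g g' i "\<lambda>w. f'' z i w + 2 * \<mu> * (w \<bullet> i)"])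
      show "g y \<le> g z" if "y \<in> U" for y using z that U by auto
      show "(g has_derivative g' y) (at y)" if "y \<in> U" for y
        unfolding g_def[abs_def] g'_def by (auto intro!: derivative_eq_intros f' that)
      show "((\<lambda>y. g' y i) has_derivative (\<lambda>w. f'' z i w + 2 * \<mu> * (w \<bullet> i))) (at z)"
        unfolding g'_def by (auto intro!: derivative_eq_intros f'' zU simp: inner_commute algebra_simps)
    qed
    then have "(\<Sum>i\<in>Basis. f'' z i i + 2 * \<mu> * (i \<bullet> i)) \<le> 0" by (intro sum_nonpos) blast
    then have "(\<Sum>i\<in>Basis. f'' z i i) + 2 * \<mu> * DIM('a) \<le> 0" by (simp add: sum.distrib mult.commute)
    moreover have "2 * \<mu> * 1 \<le> 2 * \<mu> * DIM('a)"
      using \<kappa> DIM_positive[where 'a='a] by (intro mult_left_mono) linarith+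
    ultimately show False using lap[OF zU] \<kappa> by linarith
  qed
  have "f x \<le> g x" using \<kappa> by (simp add: g_def)
  also have "g x \<le> g z" using z x by blast
  also have "\<dots> \<le> B + \<mu> * R\<^sup>2"
  proof -
    have "norm z \<le> R" using K z by auto
    then have "z \<bullet> z \<le> R\<^sup>2" unfolding dot_square_norm by (intro power_mono) auto
    then show ?thesis unfolding g_def using B[of z] z \<open>z \<notin> U\<close> \<kappa> by (intro add_mono mult_left_mono) auto
  qed
  finally show ?thesis .
qed

text \<open>Applied in both directions this gives uniqueness. The difference has Laplacian 0, so an
  arbitrarily small perturbation suffices.\<close>

lemma harmonic_le_frontier:
  fixes D :: "'a::euclidean_space set"
  assumes D: "open D" "bounded D" and u: "continuous_on (closure D) u" "harmonic_on D u"
    and v: "continuous_on (closure D) v" "harmonic_on D v"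
    and le: "\<And>x. x \<in> frontier D \<Longrightarrow> u x \<le> v x" and x: "x \<in> closure D"
  shows "u x \<le> v x"
proof (rule field_le_epsilon)
  fix e :: real assume e: "e > 0"
  obtain u' u'' where u': "\<And>x. x \<in> D \<Longrightarrow> (u has_derivative u' x) (at x)"
    "\<And>x w. x \<in> D \<Longrightarrow> ((\<lambda>y. u' y w) has_derivative u'' x w) (at x)"
    "\<And>x. x \<in> D \<Longrightarrow> (\<Sum>i\<in>Basis. u'' x i i) = 0"
    using u(2) unfolding harmonic_on_def by blast
  obtain v' v'' where v': "\<And>x. x \<in> D \<Longrightarrow> (v has_derivative v' x) (at x)"
    "\<And>x w. x \<in> D \<Longrightarrow> ((\<lambda>y. v' y w) has_derivative v'' x w) (at x)"
    "\<And>x. x \<in> D \<Longrightarrow> (\<Sum>i\<in>Basis. v'' x i i) = 0"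
    using v(2) unfolding harmonic_on_def by blast
  obtain R where R: "R > 0" "closure D \<subseteq> cball 0 R"
    using bounded_closure[OF D(2)] by (auto simp: bounded_pos subset_iff)
  have "u x - v x \<le> 0 + (e / R\<^sup>2) * R\<^sup>2"
  proof (rule laplacian_maximum_principle[where U=D and K="closure D" and \<kappa>=0])
    show "compact (closure D)" using D by (simp add: compact_closure)
    show "((\<lambda>x. u x - v x) has_derivative (\<lambda>h. u' x h - v' x h)) (at x)" if "x \<in> D" for x
      by (intro has_derivative_diff u' v' that)
    show "((\<lambda>y. u' y w - v' y w) has_derivative (\<lambda>h. u'' x w h - v'' x w h)) (at x)" if "x \<in> D" for x w
      by (intro has_derivative_diff u' v' that)
    show "- 0 \<le> (\<Sum>i\<in>Basis. u'' x i i - v'' x i i)" if "x \<in> D" for x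
      using that by (simp add: sum_subtractf u' v')
    show "u x - v x \<le> 0" if "x \<in> closure D - D" for x
      using le[of x] that D by (simp add: frontier_def interior_open)
  qed (use D R u v x e closure_subset in \<open>auto intro!: continuous_intros\<close>)
  then show "u x \<le> v x + e" using R by simp
qed

text \<open>The derivatives in \<open>harmonic_on\<close> are existentially quantified and could
  vary with the neighbourhood; uniqueness of derivatives lets \<open>frechet_derivative\<close> glue
  them.\<close>

lemma harmonic_on_local:
  assumes "\<And>x. x \<in> D \<Longrightarrow> \<exists>S. open S \<and> x \<in> S \<and> harmonic_on S u"
  shows "harmonic_on D u"
proof -
  define u' where "u' x = frechet_derivative u (at x)" for x
  define u'' where "u'' x v = frechet_derivative (\<lambda>y. u' y v) (at x)" for x v
  have *: "(u has_derivative u' x) (at x) \<and> (\<forall>v. ((\<lambda>y. u' y v) has_derivative u'' x v) (at x)) \<and>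
      (\<forall>v w. isCont (\<lambda>y. u'' y v w) x) \<and> (\<Sum>i\<in>Basis. u'' x i i) = 0" if x: "x \<in> D" for x
  proof -
    obtain S where S: "open S" "x \<in> S" "harmonic_on S u" using assms[OF x] by blast
    then obtain a a' where a: "\<And>x. x \<in> S \<Longrightarrow> (u has_derivative a x) (at x)"
      "\<And>x w. x \<in> S \<Longrightarrow> ((\<lambda>y. a y w) has_derivative a' x w) (at x)"
      "\<And>v w. continuous_on S (\<lambda>y. a' y v w)"
      "\<And>x. x \<in> S \<Longrightarrow> (\<Sum>i\<in>Basis. a' x i i) = 0"
      unfolding harmonic_on_def by blast
    have 1: "u' y = a y" if "y \<in> S" for y
      unfolding u'_def using frechet_derivative_at[OF a(1)[OF that]] by simp
    have 2: "((\<lambda>y. u' y v) has_derivative a' y v) (at y)" if "y \<in> S" for y v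
      by (rule has_derivative_transform_within_open[OF a(2)[OF that] S(1) that]) (simp add: 1)
    have 3: "u'' y v = a' y v" if "y \<in> S" for y v
      unfolding u''_def using frechet_derivative_at[OF 2[OF that]] by simp
    have "continuous_on S (\<lambda>y. u'' y v w)" for v w
      using a(3) by (rule continuous_on_eq) (simp add: 3)
    then have "isCont (\<lambda>y. u'' y v w) x" for v w
      using S by (simp add: continuous_on_eq_continuous_at)
    then show ?thesis using a(1)[OF S(2)] 2[OF S(2)] 1[OF S(2)] 3[OF S(2)] a(4)[OF S(2)] by simp
  qed
  then show ?thesis unfolding harmonic_on_def
    by (intro exI[of _ u'] exI[of _ u'']) (auto intro!: continuous_at_imp_continuous_on)
qed

section \<open>Dependence on the radius, and the mean value formula\<close>

lemma conv_bump_laplacian_recurrence: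
  fixes g :: "'a::euclidean_space \<Rightarrow> real"
  assumes g: "g \<in> borel_measurable borel" "\<And>y. \<bar>g y\<bar> \<le> M" and j: "j \<ge> 2" and s: "0 \<le> s"
  shows "conv g (bump_laplacian (Suc j) s) x
    = 2 * real (Suc j) * (2 * real j * s\<^sup>2 * conv g (bump (j - 1) s) x - (DIM('a) + 2 * real j) * conv g (bump j s) x)"
proof -
  have bump: "integrable lborel (\<lambda>y. g y * bump m s (x - y))" if "m > 0" for m
    by (rule integrable_convolution[OF g, of _ s]) (auto simp: bump_eq_0 s that intro!: continuous_intros)
  \<comment> \<open>On the support, \<open>z \<bullet> z\<close> is \<open>s\<^sup>2\<close> minus
    the base of the power; this trades the quadratic factor for kernels of order
    \<open>j - 1\<close> and \<open>j\<close>.\<close>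
  have zz: "(z \<bullet> z) * bump (j - 1) s z = s\<^sup>2 * bump (j - 1) s z - bump j s z" for z :: 'a
  proof -
    obtain i where i: "j = Suc (Suc i)" using j by (metis add_2_eq_Suc le_Suc_ex)
    show ?thesis unfolding i bump_def by (cases "z \<bullet> z \<le> s\<^sup>2") (auto simp: max_def algebra_simps)
  qed
  have lap: "bump_laplacian (Suc j) s z = (2 * real (Suc j) * (2 * real j * s\<^sup>2)) * bump (j - 1) s z
      - (2 * real (Suc j) * (DIM('a) + 2 * real j)) * bump j s z" for z :: 'a
  proof -
    have "bump_laplacian (Suc j) s z = - 2 * real (Suc j) * DIM('a) * bump j s z
        + 4 * real (Suc j) * real j * ((z \<bullet> z) * bump (j - 1) s z)"
      using j by (simp add: bump_laplacian_def numeral_2_eq_2)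
    then show ?thesis unfolding zz by (simp add: algebra_simps)
  qed
  have "g y * bump_laplacian (Suc j) s (x - y)
      = (2 * real (Suc j) * (2 * real j * s\<^sup>2)) * (g y * bump (j - 1) s (x - y))
      - (2 * real (Suc j) * (DIM('a) + 2 * real j)) * (g y * bump j s (x - y))" for y
    unfolding lap by (simp add: algebra_simps)
  then have "conv g (bump_laplacian (Suc j) s) x
      = (2 * real (Suc j) * (2 * real j * s\<^sup>2)) * conv g (bump (j - 1) s) x
      - (2 * real (Suc j) * (DIM('a) + 2 * real j)) * conv g (bump j s) x"
    unfolding conv_def using j bump[of j] bump[of "j - 1"] by simp
  then show ?thesis by (simp add: algebra_simps)
qed

text \<open>Differentiation under the integral in the parameter \<open>s\<close>, again by a
  quadratic remainder uniform in \<open>z\<close>; the base of the power changes by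
  \<open>a = 2 * s * h + h\<^sup>2\<close>.\<close>

lemma has_derivative_conv_bump_radius:
  fixes g :: "'a::euclidean_space \<Rightarrow> real"
  assumes g: "g \<in> borel_measurable borel" "\<And>y. \<bar>g y\<bar> \<le> M" and j: "j \<ge> 3" and s: "0 \<le> s"
  shows "((\<lambda>s. conv g (bump j s) x) has_real_derivative 2 * real j * s * conv g (bump (j - 1) s) x) (at s)"
proof -
  \<comment> \<open>Stated with \<open>\<bar>s\<bar>\<close> because \<open>s + h\<close> may be
    negative below; the kernel depends only on the square of the radius.\<close>
  have bump0: "bump m s z = 0" if "m > 0" "\<bar>s\<bar> \<le> norm z" for m s and z :: 'a
    using that power_mono[OF that(2), of 2] by (simp add: bump_def dot_square_norm)
  have bump: "integrable lborel (\<lambda>y. g y * bump m s (x - y))" if "m > 0" for m s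
    by (rule integrable_convolution[OF g, of _ "\<bar>s\<bar>"]) (auto simp: bump0 that intro!: continuous_intros)
  have M0: "0 \<le> M" using g(2)[of 0] by linarith
  define C where "C = real j ^ 2 * ((s + 1)\<^sup>2) ^ (j - 2) * (2 * s + 1)\<^sup>2 + real j * (s\<^sup>2) ^ (j - 1)"
  have C0: "C \<ge> 0" by (simp add: C_def)
  have C: "\<bar>bump j (s + h) z - bump j s z - 2 * real j * s * bump (j - 1) s z * h\<bar> \<le> C * h\<^sup>2"
    if h: "\<bar>h\<bar> \<le> 1" for h and z :: 'a
  proof -
    define a where "a = 2 * s * h + h\<^sup>2"
    define t where "t = s\<^sup>2 - z \<bullet> z"
    have ta: "t + a = (s + h)\<^sup>2 - z \<bullet> z" by (simp add: a_def t_def power2_eq_square algebra_simps)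
    have "(s + h)\<^sup>2 \<le> (s + 1)\<^sup>2" using h s by (intro abs_le_square_iff[THEN iffD1]) auto
    moreover have "s\<^sup>2 \<le> (s + 1)\<^sup>2" using s by (intro power_mono) auto
    ultimately have t: "t + a \<le> (s + 1)\<^sup>2" "t \<le> (s + 1)\<^sup>2"
      unfolding ta unfolding t_def using inner_ge_zero[of z] by linarith+
    have bump: "bump m (s + h) z = (max 0 (t + a)) ^ m" "bump m s z = (max 0 t) ^ m" for m
      unfolding ta by (simp_all add: bump_def t_def)
    have sums: "(\<Sum>m<2. f m) = f 0 + f (1::nat)" for f :: "nat \<Rightarrow> real"
      by (simp add: numeral_2_eq_2)
    have "\<bar>bump j (s + h) z - (bump j s z + j * bump (j - 1) s z * a)\<bar> \<le> real j ^ 2 * ((s + 1)\<^sup>2) ^ (j - 2) * \<bar>a\<bar> ^ 2"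
      using Taylor_pos_part_power[of 2 j t "(s + 1)\<^sup>2" a] j by (simp add: sums t bump)
    also have "\<bar>a\<bar> \<le> (2 * s + 1) * \<bar>h\<bar>"
    proof -
      have "a = (2 * s + h) * h" by (simp add: a_def power2_eq_square algebra_simps)
      then show ?thesis using s h by (simp add: abs_mult mult_right_mono)
    qed
    then have "real j ^ 2 * ((s + 1)\<^sup>2) ^ (j - 2) * \<bar>a\<bar> ^ 2 \<le> real j ^ 2 * ((s + 1)\<^sup>2) ^ (j - 2) * ((2 * s + 1) * \<bar>h\<bar>) ^ 2"
      by (intro mult_left_mono power_mono) auto
    finally have 1: "\<bar>bump j (s + h) z - (bump j s z + j * bump (j - 1) s z * a)\<bar>
        \<le> real j ^ 2 * ((s + 1)\<^sup>2) ^ (j - 2) * (2 * s + 1)\<^sup>2 * h\<^sup>2"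
      by (simp add: power_mult_distrib mult.assoc)
    have 2: "\<bar>j * bump (j - 1) s z * h\<^sup>2\<bar> \<le> real j * (s\<^sup>2) ^ (j - 1) * h\<^sup>2"
      by (auto simp: abs_mult intro!: mult_mono bump_le s)
    have "bump j (s + h) z - bump j s z - 2 * real j * s * bump (j - 1) s z * h
       = (bump j (s + h) z - (bump j s z + j * bump (j - 1) s z * a)) + j * bump (j - 1) s z * h\<^sup>2"
      by (simp add: a_def algebra_simps)
    then show ?thesis using 1 2 unfolding C_def distrib_right by linarith
  qed
  have [measurable]: "g \<in> borel_measurable borel" "bump m s \<in> borel_measurable (borel :: 'a measure)" for m s
    using g by (auto intro!: borel_measurable_continuous_onI continuous_intros)
  have "((\<lambda>s. conv g (bump j s) x) has_derivative (*) (2 * real j * s * conv g (bump (j - 1) s) x)) (at s)"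
  proof (rule has_derivative_quadratic_remainder[OF bounded_linear_mult_right])
    fix h :: real assume h: "norm h \<le> 1"
    have "(\<lambda>y. g y * (bump j (s + h) (x - y) - bump j s (x - y) - 2 * real j * s * bump (j - 1) s (x - y) * h))
      = (\<lambda>y. g y * bump j (s + h) (x - y) - g y * bump j s (x - y) - (2 * real j * s * h) * (g y * bump (j - 1) s (x - y)))"
      by (simp add: fun_eq_iff algebra_simps)
    then have "conv g (bump j (s + h)) x - conv g (bump j s) x - 2 * real j * s * conv g (bump (j - 1) s) x * h
      = (\<integral>y. g y * (bump j (s + h) (x - y) - bump j s (x - y) - 2 * real j * s * bump (j - 1) s (x - y) * h) \<partial>lborel)"
      unfolding conv_def using bump[of j] bump[of "j - 1"] j by simp
    also have "\<bar>\<dots>\<bar> \<le> M * (C * h\<^sup>2) * (unit_ball_vol DIM('a) * (s + 1) ^ DIM('a))"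
    proof (rule integral_bounded_support(2)[where x=x])
      show "\<bar>g y * (bump j (s + h) (x - y) - bump j s (x - y) - 2 * real j * s * bump (j - 1) s (x - y) * h)\<bar>
          \<le> M * (C * h\<^sup>2)" for y
        unfolding abs_mult[of "g y"] using C[of h] h C0 by (intro mult_mono g M0) auto
      fix y assume "s + 1 < dist x y"
      then have "s + 1 < norm (x - y)" by (simp add: dist_norm)
      moreover have "\<bar>s + h\<bar> \<le> norm (x - y)" using s h calculation by auto
      then have "bump j (s + h) (x - y) = 0" using j by (intro bump0) auto
      ultimately show "g y * (bump j (s + h) (x - y) - bump j s (x - y) - 2 * real j * s * bump (j - 1) s (x - y) * h) = 0"
        using s j by (simp add: bump_eq_0)
    qed (use s in auto)
    finally show "norm (conv g (bump j (s + h)) x - conv g (bump j s) x - 2 * real j * s * conv g (bump (j - 1) s) x * h)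
      \<le> M * C * (unit_ball_vol DIM('a) * (s + 1) ^ DIM('a)) * (norm h)\<^sup>2"
      by (simp add: ac_simps)
  qed
  then show ?thesis by (simp add: has_field_derivative_def)
qed

text \<open>Where the Laplacian integral vanishes, the recurrence turns the radius derivative into
  Euler's equation for the power with exponent \<open>m = DIM('a) + 2 * j\<close>, so the quotient
  \<open>\<phi>\<close> is constant. The order \<open>Suc j\<close> occurs because its Laplacian
  involves the orders \<open>j - 1\<close> and \<open>j\<close>.\<close>

lemma conv_bump_power_law:
  fixes g :: "'a::euclidean_space \<Rightarrow> real"
  assumes g: "g \<in> borel_measurable borel" "\<And>y. \<bar>g y\<bar> \<le> M" and j: "j \<ge> 3"
    and lap: "\<And>s. 0 < s \<Longrightarrow> s < r \<Longrightarrow> conv g (bump_laplacian (Suc j) s) x = 0"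
  obtains c where "\<And>s. 0 < s \<Longrightarrow> s < r \<Longrightarrow> conv g (bump j s) x = c * s ^ (DIM('a) + 2 * j)"
proof -
  define m where "m = DIM('a) + 2 * j"
  define \<phi> where "\<phi> s = conv g (bump j s) x / s ^ m" for s
  have "\<exists>c. \<forall>s\<in>{0<..<r}. \<phi> s = c"
  proof (rule has_field_derivative_zero_constant)
    fix s assume s: "s \<in> {0<..<r}"
    have "2 * real j * s\<^sup>2 * conv g (bump (j - 1) s) x = (DIM('a) + 2 * real j) * conv g (bump j s) x"
      using conv_bump_laplacian_recurrence[OF g, of j s x] lap[of s] s j by simp
    then have rec: "2 * real j * s\<^sup>2 * conv g (bump (j - 1) s) x = real m * conv g (bump j s) x"
      by (simp add: m_def)
    obtain m' where m': "m = Suc m'" using j by (cases m) (auto simp: m_def)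
    have "(\<phi> has_real_derivative
        (2 * real j * s * conv g (bump (j - 1) s) x * s ^ m - conv g (bump j s) x * (real m * s ^ (m - 1)))
        / (s ^ m * s ^ m)) (at s)"
      unfolding \<phi>_def using s j
      by (auto intro!: derivative_eq_intros has_derivative_conv_bump_radius[OF g])
    also have "2 * real j * s * conv g (bump (j - 1) s) x * s ^ m - conv g (bump j s) x * (real m * s ^ (m - 1))
        = (2 * real j * s\<^sup>2 * conv g (bump (j - 1) s) x - real m * conv g (bump j s) x) * s ^ (m - 1)"
      by (simp add: m' power2_eq_square algebra_simps)
    also have "\<dots> = 0" unfolding rec by simp
    finally show "(\<phi> has_field_derivative 0) (at s within {0<..<r})"
      by (simp add: has_field_derivative_at_within)
  qed simp
  then obtain c where c: "\<And>s. 0 < s \<Longrightarrow> s < r \<Longrightarrow> \<phi> s = c" by auto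
  show ?thesis
  proof (rule that)
    fix s assume "0 < s" "s < r"
    then show "conv g (bump j s) x = c * s ^ (DIM('a) + 2 * j)"
      using c[of s] by (simp add: \<phi>_def m_def field_simps)
  qed
qed

lemma integral_bump_translate:
  "conv (\<lambda>_. 1) (bump k s) x = conv (\<lambda>_. 1) (bump k s) (0 :: 'a)" for x :: "'a::euclidean_space"
proof -
  have [measurable]: "bump k s \<in> borel_measurable (borel :: 'a measure)"
    by (auto intro!: borel_measurable_continuous_onI continuous_intros)
  have sym: "bump k s (x - y) = bump k s (y + - x)" for x y :: 'a
    unfolding bump_def by (simp add: inner_diff_left inner_diff_right inner_commute algebra_simps)
  have "conv (\<lambda>_. 1) (bump k s) x = (\<integral>y. bump k s (y :: 'a) \<partial>lborel)" for x :: 'a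
    unfolding conv_def sym using lborel_integral_translate[of "bump k s" "- x"] by simp
  then show ?thesis by metis
qed

lemma integral_bump_pos:
  assumes "0 < s" "0 < k"
  shows "0 < conv (\<lambda>_. 1) (bump k s) (x :: 'a::euclidean_space)"
proof -
  have [measurable]: "bump k s \<in> borel_measurable (borel :: 'a measure)"
    by (auto intro!: borel_measurable_continuous_onI continuous_intros)
  have int: "integrable lborel (\<lambda>y. 1 * bump k s (x - y))"
    by (rule integrable_convolution[where M=1 and R=s])
       (use assms in \<open>auto simp: bump_eq_0 intro!: continuous_intros\<close>)
  have "conv (\<lambda>_. 1) (bump k s) x \<noteq> 0"
  proof
    assume "conv (\<lambda>_. 1) (bump k s) x = 0"
    then have "AE y in lborel. 1 * bump k s (x - y) = 0"
      using int unfolding conv_def by (subst (asm) integral_nonneg_eq_0_iff_AE) auto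
    then have "AE y in lborel. y \<notin> ball x s"
    proof eventually_elim
      case (elim y)
      then have "s\<^sup>2 \<le> (norm (x - y))\<^sup>2"
        by (auto simp: bump_def dot_square_norm max_def split: if_splits)
      then show ?case using assms by (auto simp: dist_norm dest!: power2_le_imp_le)
    qed
    then have "ball x s \<in> null_sets lborel" by (simp add: AE_iff_null_sets)
    then have "negligible (ball x s)" by (simp add: negligible_iff_null_sets null_sets_completionI)
    then show False using assms open_not_negligible[of "ball x s"] by auto
  qed
  moreover have "conv (\<lambda>_. 1) (bump k s) x \<ge> 0" unfolding conv_def by simp
  ultimately show ?thesis by simp
qed

text \<open>Constants have the mean value property for every step size, so the bound of order
  \<open>\<epsilon>\<close> holds for all small \<open>\<epsilon>\<close>. This replaces an
  integration by parts.\<close>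

lemma conv_one_bump_laplacian:
  assumes "k \<ge> 4" "0 \<le> s"
  shows "conv (\<lambda>_. 1) (bump_laplacian k s) (x :: 'a::euclidean_space) = 0"
proof -
  obtain C where C: "C \<ge> 0"
    "\<And>W M \<epsilon> (x :: 'a). W \<in> borel_measurable borel \<Longrightarrow> (\<And>y. \<bar>W y\<bar> \<le> M) \<Longrightarrow>
      0 < \<epsilon> \<Longrightarrow> \<epsilon> \<le> 1 \<Longrightarrow>
      (\<And>y. norm (x - y) < s \<Longrightarrow> W y = (\<integral>w. W (y + \<epsilon> *\<^sub>R w) \<partial>ball_prob)) \<Longrightarrow>
      \<bar>conv W (bump_laplacian k s) x\<bar> \<le> C * M * \<epsilon>"
    using conv_bump_laplacian_le[OF assms] by metis
  have "\<bar>conv (\<lambda>_. 1) (bump_laplacian k s) x\<bar> \<le> 0 + e" if "e > 0" for e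
  proof -
    define \<epsilon> where "\<epsilon> = min 1 (e / (C + 1))"
    have "0 < \<epsilon>" "\<epsilon> \<le> 1" "\<epsilon> \<le> e / (C + 1)" using that C by (auto simp: \<epsilon>_def)
    then have "\<bar>conv (\<lambda>_. 1) (bump_laplacian k s) x\<bar> \<le> C * 1 * \<epsilon>"
      by (intro C(2)) (auto simp: ball_prob.prob_space[where 'a='a, simplified])
    also have "\<dots> \<le> (C + 1) * (e / (C + 1))"
      using C \<open>0 < \<epsilon>\<close> \<open>\<epsilon> \<le> e / (C + 1)\<close> by (intro mult_mono) auto
    also have "\<dots> = e" using C by simp
    finally show ?thesis by simp
  qed
  then have "\<bar>conv (\<lambda>_. 1) (bump_laplacian k s) x\<bar> \<le> 0" by (rule field_le_epsilon)
  then show ?thesis by simp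
qed

lemma conv_bump_diff_const_le:
  fixes g :: "'a::euclidean_space \<Rightarrow> real"
  assumes g: "g \<in> borel_measurable borel" "\<And>y. \<bar>g y\<bar> \<le> M" and s: "0 \<le> s" and k: "0 < k"
    and close: "\<And>y. norm (x - y) < s \<Longrightarrow> \<bar>g y - a\<bar> \<le> e"
  shows "\<bar>conv g (bump k s) x - a * conv (\<lambda>_. 1) (bump k s) x\<bar> \<le> e * conv (\<lambda>_. 1) (bump k s) x"
proof -
  have i: "integrable lborel (\<lambda>y. g y * bump k s (x - y))"
    by (rule integrable_convolution[OF g, of _ s]) (use s k in \<open>auto simp: bump_eq_0 intro!: continuous_intros\<close>)
  have i1: "integrable lborel (\<lambda>y. bump k s (x - y))"
    using integrable_convolution[of "\<lambda>_. 1" 1 "bump k s" s x] s k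
    by (simp add: bump_eq_0 continuous_on_bump continuous_on_id)
  have "conv g (bump k s) x - a * conv (\<lambda>_. 1) (bump k s) x = (\<integral>y. (g y - a) * bump k s (x - y) \<partial>lborel)"
    unfolding conv_def using i i1 by (simp add: left_diff_distrib)
  also have "\<bar>\<dots>\<bar> \<le> (\<integral>y. \<bar>(g y - a) * bump k s (x - y)\<bar> \<partial>lborel)" by (rule integral_abs_bound)
  also have "\<dots> \<le> (\<integral>y. e * bump k s (x - y) \<partial>lborel)"
  proof (rule integral_mono)
    show "integrable lborel (\<lambda>y. \<bar>(g y - a) * bump k s (x - y)\<bar>)"
      using i i1 by (simp add: left_diff_distrib)
    show "\<bar>(g y - a) * bump k s (x - y)\<bar> \<le> e * bump k s (x - y)" for y
      using close[of y] s k
      by (cases "norm (x - y) < s") (auto simp: abs_mult bump_eq_0 mult_right_mono)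
  qed (use i1 in simp)
  finally show ?thesis by (simp add: conv_def)
qed

text \<open>Both \<open>u\<close> and the constant 1 follow a power law with the same exponent.
  Continuity at \<open>x\<close> compares them as the radius shrinks and yields
  \<open>c = u x * c1\<close>, so the normalising integral is never computed.\<close>

lemma weakly_harmonic_mean_value:
  fixes u :: "'a::euclidean_space \<Rightarrow> real"
  assumes u: "u \<in> borel_measurable borel" "\<And>y. \<bar>u y\<bar> \<le> M" and cont: "isCont u x" and j: "j \<ge> 3"
    and lap: "\<And>s. 0 < s \<Longrightarrow> s < r \<Longrightarrow> conv u (bump_laplacian (Suc j) s) x = 0"
    and s: "0 < s" "s < r"
  shows "conv u (bump j s) x = u x * conv (\<lambda>_. 1) (bump j s) x"
proof -
  define m where "m = DIM('a) + 2 * j"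
  obtain c where c: "\<And>s. 0 < s \<Longrightarrow> s < r \<Longrightarrow> conv u (bump j s) x = c * s ^ m"
    unfolding m_def using conv_bump_power_law[OF u j lap] by blast
  obtain c1 where c1: "\<And>s. 0 < s \<Longrightarrow> s < r \<Longrightarrow> conv (\<lambda>_. 1) (bump j s) x = c1 * s ^ m"
    unfolding m_def
    using conv_bump_power_law[of "\<lambda>_. 1" 1 j r x] conv_one_bump_laplacian[of "Suc j" _ x] j by auto
  have "c1 > 0" using integral_bump_pos[OF s(1), of j x] c1[OF s] s j by (simp add: zero_less_mult_iff)
  have "\<bar>c - u x * c1\<bar> \<le> 0 + e" if "e > 0" for e
  proof -
    obtain d where d: "d > 0" "\<And>y. dist y x < d \<Longrightarrow> dist (u y) (u x) < e / c1"
      using cont \<open>e > 0\<close> \<open>c1 > 0\<close> unfolding continuous_at_eps_delta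
      by (meson divide_pos_pos)
    define t where "t = min s d"
    have t: "0 < t" "t < r" "t \<le> d" using s d by (auto simp: t_def)
    have "\<bar>conv u (bump j t) x - u x * conv (\<lambda>_. 1) (bump j t) x\<bar> \<le> e / c1 * conv (\<lambda>_. 1) (bump j t) x"
    proof (rule conv_bump_diff_const_le[OF u])
      show "\<bar>u y - u x\<bar> \<le> e / c1" if "norm (x - y) < t" for y
        using d(2)[of y] that t by (simp add: dist_norm norm_minus_commute)
    qed (use t j in auto)
    then have "\<bar>(c - u x * c1) * t ^ m\<bar> \<le> e * t ^ m"
      unfolding c[OF t(1,2)] c1[OF t(1,2)] using \<open>c1 > 0\<close> by (simp add: algebra_simps)
    then show ?thesis using t by (simp add: abs_mult)
  qed
  then have "\<bar>c - u x * c1\<bar> \<le> 0" by (rule field_le_epsilon)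
  then show ?thesis using c[OF s] c1[OF s] by simp
qed

text \<open>The mean value formula exhibits \<open>u\<close> locally as a convolution with a polynomial kernel, which
  gives both its regularity and, by weak harmonicity, the vanishing of its Laplacian.\<close>

lemma weakly_harmonic_imp_harmonic_on:
  fixes u :: "'a::euclidean_space \<Rightarrow> real"
  assumes D: "open D" and u: "u \<in> borel_measurable borel" "\<And>y. \<bar>u y\<bar> \<le> M" and cont: "continuous_on D u"
    and lap: "\<And>x s k. 0 < s \<Longrightarrow> cball x s \<subseteq> D \<Longrightarrow> k \<ge> 4 \<Longrightarrow> conv u (bump_laplacian k s) x = 0"
  shows "harmonic_on D u"
proof (rule harmonic_on_local)
  fix x0 assume "x0 \<in> D"
  then obtain r' where "r' > 0" "cball x0 r' \<subseteq> D" using D by (meson open_contains_cball)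
  \<comment> \<open>Half the radius, so that balls of radius below \<open>r\<close> around points of
    \<open>ball x0 r\<close> stay in \<open>D\<close>.\<close>
  define r where "r = r' / 2"
  have r: "r > 0" using \<open>r' > 0\<close> by (simp add: r_def)
  have cb: "cball x s \<subseteq> D" if "x \<in> ball x0 r" "s < r" for x s
  proof
    fix y assume "y \<in> cball x s"
    then have "dist x0 y \<le> r'" using that dist_triangle[of x0 y x] by (auto simp: r_def)
    then show "y \<in> D" using \<open>cball x0 r' \<subseteq> D\<close> by auto
  qed
  define s where "s = r / 2"
  have s: "0 < s" "s < r" "0 \<le> s" using r by (auto simp: s_def)
  \<comment> \<open>Total mass of the kernel, the same for every centre. Order 6 meets the
    requirement \<open>k \<ge> 5\<close> for a continuous Hessian.\<close>
  define T where "T = conv (\<lambda>_. 1) (bump 6 s) (0::'a)"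
  have T: "T > 0" unfolding T_def by (rule integral_bump_pos) (use s in auto)
  have ueq: "conv u (bump 6 s) x / T = u x" if x: "x \<in> ball x0 r" for x
  proof -
    have "x \<in> D" using cb[OF x s(2)] s by auto
    then have "isCont u x" using cont D by (simp add: continuous_on_eq_continuous_at)
    then have "conv u (bump 6 s) x = u x * conv (\<lambda>_. 1) (bump 6 s) x"
      by (rule weakly_harmonic_mean_value[OF u]) (use lap cb[OF x] s in auto)
    then have "conv u (bump 6 s) x = u x * T"
      using integral_bump_translate[of 6 s x] by (simp add: T_def)
    then show ?thesis using T by simp
  qed
  have "harmonic_on (ball x0 r) u"
    unfolding harmonic_on_def
  proof (intro exI conjI ballI allI)
    fix x assume x: "x \<in> ball x0 r"
    have "((\<lambda>x. conv u (bump 6 s) x / T) has_derivative (\<lambda>h. conv u (bump_grad 6 s h) x / T)) (at x)"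
      using has_derivative_mult_right[OF has_derivative_conv_bump[OF u, of 6 s x], of "1 / T"] s by simp
    then show "(u has_derivative (\<lambda>h. conv u (bump_grad 6 s h) x / T)) (at x)"
      by (rule has_derivative_transform_within_open[OF _ open_ball x]) (rule ueq)
    show "((\<lambda>y. conv u (bump_grad 6 s v) y / T) has_derivative (\<lambda>w. conv u (bump_hess 6 s v w) x / T)) (at x)" for v
      using has_derivative_mult_right[OF has_derivative_conv_bump_grad[OF u, of 6 s v x], of "1 / T"] s by simp
    show "(\<Sum>i\<in>Basis. conv u (bump_hess 6 s i i) x / T) = 0"
      using sum_conv_bump_hess[OF u, of 6 s x] lap[OF s(1) cb[OF x s(2)], of 6] s
      by (simp flip: sum_divide_distrib)
  next
    show "continuous_on (ball x0 r) (\<lambda>y. conv u (bump_hess 6 s v w) y / T)" for v w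
      using continuous_on_conv_bump_hess[OF u, of 6 s v w] s T
      by (auto intro!: continuous_intros intro: continuous_on_subset)
  qed
  then show "\<exists>S. open S \<and> x0 \<in> S \<and> harmonic_on S u" using r by (intro exI[of _ "ball x0 r"]) auto
qed

subsection \<open>Limits of families with the discrete mean value property\<close>

text \<open>A ball is connected: meeting both \<open>D\<close> and its complement, it would meet the
  frontier at a distance below the infimum.\<close>

lemma ball_infdist_frontier_subset:
  fixes D :: "'a::euclidean_space set"
  assumes "x \<in> D" shows "ball x (infdist x (frontier D)) \<subseteq> D"
proof (rule ccontr)
  assume "\<not> ?thesis"
  moreover from this have "x \<in> ball x (infdist x (frontier D))"
    by (metis ball_empty centre_in_ball empty_subsetI not_le)
  ultimately have "ball x (infdist x (frontier D)) \<inter> frontier D \<noteq> {}"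
    using assms by (intro connected_Int_frontier[OF connected_ball]) blast+
  then show False using infdist_le[of _ "frontier D" x] by (force simp: not_less)
qed

text \<open>Interface between the probabilistic and the analytic half. The mean value property is
  asked only where a full step stays in \<open>D\<close>, the boundary estimate is uniform in the
  frontier point, and the value 0 outside \<open>closure D\<close> allows estimates over the whole
  space.\<close>

locale mean_value_family =
  fixes D :: "'a::euclidean_space set" and F :: "'a \<Rightarrow> real" and W :: "real \<Rightarrow> 'a \<Rightarrow> real" and M :: real
  assumes D: "open D" "bounded D" "D \<noteq> {}"
    and W_measurable: "\<And>\<epsilon>. W \<epsilon> \<in> borel_measurable borel"
    and W_le: "\<And>\<epsilon> y. \<bar>W \<epsilon> y\<bar> \<le> M"
    and W_outside: "\<And>\<epsilon> y. y \<notin> closure D \<Longrightarrow> W \<epsilon> y = 0"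
    and W_mean: "\<And>\<epsilon> x. 0 < \<epsilon> \<Longrightarrow> x \<in> D \<Longrightarrow> \<epsilon> \<le> infdist x (frontier D) \<Longrightarrow>
      W \<epsilon> x = (\<integral>w. W \<epsilon> (x + \<epsilon> *\<^sub>R w) \<partial>ball_prob)"
    and W_frontier: "\<And>\<eta>. \<eta> > 0 \<Longrightarrow> \<exists>\<delta>>0. \<exists>\<epsilon>0>0. \<forall>\<epsilon> x y. 0 < \<epsilon> \<longrightarrow> \<epsilon> < \<epsilon>0 \<longrightarrow> x \<in> closure D \<longrightarrow>
      y \<in> frontier D \<longrightarrow> dist x y < \<delta> \<longrightarrow> \<bar>W \<epsilon> x - F y\<bar> \<le> \<eta>"
begin

section \<open>Elementary geometry near the frontier\<close>

lemma M_nonneg: "0 \<le> M"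
  using W_le[of 0 0] by linarith

lemma frontier_nonempty: "frontier D \<noteq> {}"
  using D frontier_eq_empty[of D] not_bounded_UNIV by auto

lemma obtain_near_frontier:
  assumes "infdist x (frontier D) < d"
  obtains a where "a \<in> frontier D" "dist x a < d"
  using infdist_attains_inf[OF frontier_closed[of D] frontier_nonempty, of x] assms by metis

lemma mem_D_if: "x \<in> D \<Longrightarrow> dist x y < infdist x (frontier D) \<Longrightarrow> y \<in> D"
  using ball_infdist_frontier_subset[of x D] by auto

lemma mem_D_of_closure: "x \<in> closure D \<Longrightarrow> 0 < infdist x (frontier D) \<Longrightarrow> x \<in> D"
  using D by (cases "x \<in> frontier D") (auto simp: frontier_def interior_open)

lemma closure_D: "x \<in> D \<Longrightarrow> x \<in> closure D" "x \<in> frontier D \<Longrightarrow> x \<in> closure D"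
  using closure_subset by (auto simp: frontier_def)

text \<open>The translation difference \<open>W \<epsilon> (x + h) - W \<epsilon> x\<close> has the mean value property as well, so the
  discrete maximum principle transports its smallness near the boundary into the interior.\<close>

lemma W_equicontinuous:
  assumes \<eta>: "\<eta> > 0"
  obtains \<delta> \<epsilon>0 where "\<delta> > 0" "\<epsilon>0 > 0" "\<And>\<epsilon> x y. 0 < \<epsilon> \<Longrightarrow> \<epsilon> < \<epsilon>0 \<Longrightarrow> x \<in> closure D \<Longrightarrow> y \<in> closure D \<Longrightarrow>
    dist x y < \<delta> \<Longrightarrow> \<bar>W \<epsilon> x - W \<epsilon> y\<bar> \<le> \<eta>"
proof -
  from W_frontier[of "\<eta> / 2"] \<eta> obtain \<delta>1 \<epsilon>1 where *: "\<delta>1 > 0" "\<epsilon>1 > 0"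
    and near: "\<And>\<epsilon> x y. 0 < \<epsilon> \<Longrightarrow> \<epsilon> < \<epsilon>1 \<Longrightarrow> x \<in> closure D \<Longrightarrow> y \<in> frontier D \<Longrightarrow> dist x y < \<delta>1 \<Longrightarrow>
      \<bar>W \<epsilon> x - F y\<bar> \<le> \<eta> / 2"
    by (metis half_gt_zero)
  obtain R where R: "D \<subseteq> cball 0 R"
    using D(2) by (auto simp: bounded_iff subset_iff)
  \<comment> \<open>With \<open>norm h\<close> and \<open>\<epsilon>\<close> below
    \<open>\<delta>1 / 4\<close>, a full step from \<open>x\<close> or from \<open>x + h\<close>
    remains in \<open>D\<close> for every \<open>x\<close> in this set.\<close>
  define S where "S = {x \<in> D. \<delta>1 / 2 \<le> infdist x (frontier D)}"
  \<comment> \<open>The sign \<open>\<sigma>\<close> turns the one-sided principle into a bound on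
    the absolute value.\<close>
  have main: "\<sigma> * (W \<epsilon> (x + h) - W \<epsilon> x) \<le> \<eta>"
    if \<sigma>: "\<bar>\<sigma>\<bar> = 1" and \<epsilon>: "0 < \<epsilon>" "\<epsilon> < \<epsilon>1" "\<epsilon> < \<delta>1 / 4" and h: "norm h < \<delta>1 / 4" and x: "x \<in> S"
    for \<sigma> \<epsilon> h x
  proof (rule discrete_maximum_principle[where S=S and \<epsilon>=\<epsilon> and R=R and M="2 * M"])
    have [measurable]: "W \<epsilon> \<in> borel_measurable borel" by (rule W_measurable)
    show "(\<lambda>x. \<sigma> * (W \<epsilon> (x + h) - W \<epsilon> x)) \<in> borel_measurable borel" by measurable
    show "\<bar>\<sigma> * (W \<epsilon> (y + h) - W \<epsilon> y)\<bar> \<le> 2 * M" for y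
      using W_le[of \<epsilon> "y + h"] W_le[of \<epsilon> y] by (simp add: abs_mult \<sigma>)
    show "S \<subseteq> cball 0 R" using R by (auto simp: S_def)
    have i: "integrable ball_prob (\<lambda>w. W \<epsilon> (y + \<epsilon> *\<^sub>R w))" for y
      by (rule integrable_ball_prob_bounded[where B=M]) (auto intro: W_le)
    fix x assume x: "x \<in> S"
    then have xD: "x \<in> D" and xi: "\<delta>1 / 2 \<le> infdist x (frontier D)" by (auto simp: S_def)
    have "x + h \<in> D" by (rule mem_D_if[OF xD]) (use h xi * in \<open>auto simp: dist_norm\<close>)
    moreover have "\<epsilon> \<le> infdist (x + h) (frontier D)"
      using infdist_triangle[of x "frontier D" "x + h"] xi h \<epsilon> by (simp add: dist_norm)
    ultimately have "W \<epsilon> (x + h) = (\<integral>w. W \<epsilon> (x + h + \<epsilon> *\<^sub>R w) \<partial>ball_prob)"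
      using \<epsilon> by (intro W_mean) auto
    moreover have "W \<epsilon> x = (\<integral>w. W \<epsilon> (x + \<epsilon> *\<^sub>R w) \<partial>ball_prob)"
      using \<epsilon> xD xi * by (intro W_mean) auto
    moreover have swap: "x + \<epsilon> *\<^sub>R w + h = x + h + \<epsilon> *\<^sub>R w" for w by simp
    ultimately show "\<sigma> * (W \<epsilon> (x + h) - W \<epsilon> x) = (\<integral>w. \<sigma> * (W \<epsilon> (x + \<epsilon> *\<^sub>R w + h) - W \<epsilon> (x + \<epsilon> *\<^sub>R w)) \<partial>ball_prob)"
      unfolding swap using i[of x] i[of "x + h"] by simp
    fix y assume y: "norm (y - x) < \<epsilon>" "y \<notin> S"
    have yD: "y \<in> D" by (rule mem_D_if[OF xD]) (use y xi \<epsilon> in \<open>auto simp: dist_norm norm_minus_commute\<close>)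
    have yhD: "y + h \<in> D"
    proof (rule mem_D_if[OF xD])
      have "dist x (y + h) \<le> norm (y - x) + norm h"
        using norm_triangle_ineq[of "y - x" h] by (simp add: dist_norm norm_minus_commute algebra_simps)
      then show "dist x (y + h) < infdist x (frontier D)" using y h xi \<epsilon> by linarith
    qed
    \<comment> \<open>A point one step from \<open>S\<close> but outside it lies within
      \<open>\<delta>1 / 2\<close> of a frontier point \<open>a\<close>, and its translate within
      \<open>\<delta>1\<close> of the same \<open>a\<close>; both values are then close to
      \<open>F a\<close>.\<close>
    obtain a where a: "a \<in> frontier D" "dist y a < \<delta>1 / 2"
      using obtain_near_frontier[of y "\<delta>1 / 2"] y yD by (auto simp: S_def)
    have "dist (y + h) a < \<delta>1"
      using dist_triangle[of "y + h" a y] a h * by (simp add: dist_norm)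
    then have "\<bar>W \<epsilon> (y + h) - F a\<bar> \<le> \<eta> / 2" using a \<epsilon> yhD by (intro near) (auto simp: closure_D)
    moreover have "\<bar>W \<epsilon> y - F a\<bar> \<le> \<eta> / 2" using a \<epsilon> yD * by (intro near) (auto simp: closure_D)
    ultimately have "\<bar>W \<epsilon> (y + h) - W \<epsilon> y\<bar> \<le> \<eta>" by linarith
    then have "\<bar>\<sigma> * (W \<epsilon> (y + h) - W \<epsilon> y)\<bar> \<le> \<eta>" by (simp add: abs_mult \<sigma>)
    then show "\<sigma> * (W \<epsilon> (y + h) - W \<epsilon> y) \<le> \<eta>" by linarith
  qed (use \<epsilon> x in auto)
  show ?thesis
  proof (rule that[of "\<delta>1 / 4" "min \<epsilon>1 (\<delta>1 / 4)"])
    fix \<epsilon> x y assume \<epsilon>: "0 < \<epsilon>" "\<epsilon> < min \<epsilon>1 (\<delta>1 / 4)"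
      and xy: "x \<in> closure D" "y \<in> closure D" "dist x y < \<delta>1 / 4"
    show "\<bar>W \<epsilon> x - W \<epsilon> y\<bar> \<le> \<eta>"
    proof (cases "infdist x (frontier D) < \<delta>1 / 2")
      case True
      then obtain a where a: "a \<in> frontier D" "dist x a < \<delta>1 / 2" by (rule obtain_near_frontier)
      then have "dist y a < \<delta>1" "dist x a < \<delta>1"
        using xy dist_triangle[of y a x] * by (auto simp: dist_commute)
      then have "\<bar>W \<epsilon> x - F a\<bar> \<le> \<eta> / 2" "\<bar>W \<epsilon> y - F a\<bar> \<le> \<eta> / 2" using near \<epsilon> xy a by auto
      then show ?thesis by linarith
    next
      case False
      then have "x \<in> D" using xy * by (intro mem_D_of_closure) auto
      then have "x \<in> S" using False by (simp add: S_def)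
      then have "\<sigma> * (W \<epsilon> (x + (y - x)) - W \<epsilon> x) \<le> \<eta>" if "\<bar>\<sigma>\<bar> = 1" for \<sigma>
        using \<epsilon> xy that by (intro main) (auto simp: dist_norm norm_minus_commute)
      from this[of 1] this[of "-1"] show ?thesis by simp
    qed
  qed (use * in auto)
qed

text \<open>Mollification makes \<open>W \<epsilon>\<close> smooth with Laplacian of order \<open>\<epsilon>\<close>, so two members of the family are
  compared by the classical maximum principle.\<close>

lemma W_Cauchy:
  assumes \<eta>: "\<eta> > 0"
  obtains \<epsilon>0 where "\<epsilon>0 > 0" "\<And>\<epsilon> \<epsilon>' x. 0 < \<epsilon> \<Longrightarrow> \<epsilon> < \<epsilon>0 \<Longrightarrow> 0 < \<epsilon>' \<Longrightarrow> \<epsilon>' < \<epsilon>0 \<Longrightarrow> \<bar>W \<epsilon> x - W \<epsilon>' x\<bar> \<le> \<eta>"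
proof -
  \<comment> \<open>Seven parts: two for the values near the frontier, two for mollifying them, one
    for the perturbation \<open>\<mu> * R\<^sup>2\<close>, and two for mollification at
    \<open>x\<close>.\<close>
  define \<eta>1 where "\<eta>1 = \<eta> / 7"
  have \<eta>1: "\<eta>1 > 0" using \<eta> by (simp add: \<eta>1_def)
  obtain \<delta>2 \<epsilon>2 where 2: "\<delta>2 > 0" "\<epsilon>2 > 0" and eq: "\<And>\<epsilon> x y. 0 < \<epsilon> \<Longrightarrow> \<epsilon> < \<epsilon>2 \<Longrightarrow> x \<in> closure D \<Longrightarrow>
    y \<in> closure D \<Longrightarrow> dist x y < \<delta>2 \<Longrightarrow> \<bar>W \<epsilon> x - W \<epsilon> y\<bar> \<le> \<eta>1"
    using W_equicontinuous[OF \<eta>1] by blast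
  obtain \<delta>3 \<epsilon>3 where 3: "\<delta>3 > 0" "\<epsilon>3 > 0"
    and near: "\<And>\<epsilon> x y. 0 < \<epsilon> \<Longrightarrow> \<epsilon> < \<epsilon>3 \<Longrightarrow> x \<in> closure D \<Longrightarrow> y \<in> frontier D \<Longrightarrow> dist x y < \<delta>3 \<Longrightarrow>
      \<bar>W \<epsilon> x - F y\<bar> \<le> \<eta>1"
    using W_frontier[OF \<eta>1] by metis
  \<comment> \<open>The mollification radius lies below the equicontinuity scale, and the collar of
    width \<open>2 * r\<close> lies within reach of the boundary estimate.\<close>
  define r where "r = min \<delta>2 \<delta>3 / 4"
  have r: "r > 0" "r < \<delta>2" "2 * r < \<delta>3" using 2 3 by (auto simp: r_def)
  then have r0: "0 \<le> r" by simp
  have six: "(6::nat) \<ge> 4" by simp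
  obtain C where C: "C \<ge> 0"
    "\<And>W M \<epsilon> (x :: 'a). W \<in> borel_measurable borel \<Longrightarrow> (\<And>y. \<bar>W y\<bar> \<le> M) \<Longrightarrow>
      0 < \<epsilon> \<Longrightarrow> \<epsilon> \<le> 1 \<Longrightarrow>
      (\<And>y. norm (x - y) < r \<Longrightarrow> W y = (\<integral>w. W (y + \<epsilon> *\<^sub>R w) \<partial>ball_prob)) \<Longrightarrow>
      \<bar>conv W (bump_laplacian 6 r) x\<bar> \<le> C * M * \<epsilon>"
    using conv_bump_laplacian_le[OF six r0] by metis
  define T where "T = conv (\<lambda>_. 1) (bump 6 r) (0::'a)"
  have T: "T > 0" unfolding T_def by (rule integral_bump_pos) (use r in auto)
  define V where "V \<epsilon> x = conv (W \<epsilon>) (bump 6 r) x / T" for \<epsilon> x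
  obtain R where R: "R > 0" "closure D \<subseteq> cball 0 R"
    using bounded_closure[OF D(2)] by (auto simp: bounded_pos subset_iff)
  define \<mu> where "\<mu> = \<eta>1 / R\<^sup>2"
  have \<mu>: "\<mu> > 0" "\<mu> * R\<^sup>2 = \<eta>1" using R \<eta>1 by (auto simp: \<mu>_def)
  \<comment> \<open>Around a point of \<open>K\<close> the whole mollification ball keeps distance
    \<open>r\<close> from the frontier, so the mean value property is available there for
    \<open>\<epsilon> < r\<close>.\<close>
  define K where "K = {x \<in> closure D. 2 * r \<le> infdist x (frontier D)}"
  define U where "U = {x \<in> D. 2 * r < infdist x (frontier D)}"
  have inf_cont: "continuous_on A (\<lambda>x. infdist x (frontier D))" for A
    by (intro continuous_intros)
  have "closed {x. 2 * r \<le> infdist x (frontier D)}"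
    by (intro closed_Collect_le inf_cont continuous_intros)
  then have K: "compact K"
    unfolding K_def Collect_conj_eq using D by (simp add: compact_closure compact_Int_closed)
  have "open {x. 2 * r < infdist x (frontier D)}"
    by (intro open_Collect_less inf_cont continuous_intros)
  then have U: "open U" unfolding U_def Collect_conj_eq using D by (simp add: open_Int)
  have UK: "U \<subseteq> K" using closure_D by (auto simp: U_def K_def)
  have KD: "x \<in> D" if "x \<in> K" for x
    using that r by (intro mem_D_of_closure) (auto simp: K_def)
  have inner: "y \<in> D" "r \<le> infdist y (frontier D)" if "x \<in> K" "norm (x - y) < r" for x y
  proof -
    show "y \<in> D" by (rule mem_D_if[OF KD[OF that(1)]]) (use that r in \<open>auto simp: K_def dist_norm\<close>)
    show "r \<le> infdist y (frontier D)"
      using infdist_triangle[of x "frontier D" y] that by (simp add: K_def dist_norm)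
  qed
  have VW: "\<bar>V \<epsilon> x - W \<epsilon> x\<bar> \<le> \<eta>1" if \<epsilon>: "0 < \<epsilon>" "\<epsilon> < \<epsilon>2" and x: "x \<in> K" for \<epsilon> x
  proof -
    have "\<bar>conv (W \<epsilon>) (bump 6 r) x - W \<epsilon> x * conv (\<lambda>_. 1) (bump 6 r) x\<bar> \<le> \<eta>1 * conv (\<lambda>_. 1) (bump 6 r) x"
    proof (rule conv_bump_diff_const_le[OF W_measurable W_le r0])
      show "\<bar>W \<epsilon> y - W \<epsilon> x\<bar> \<le> \<eta>1" if "norm (x - y) < r" for y
        using inner[OF x that] x that r \<epsilon>
        by (intro eq) (auto simp: closure_D K_def dist_norm norm_minus_commute)
    qed simp
    moreover have "conv (\<lambda>_. 1) (bump 6 r) x = T" using integral_bump_translate[of 6 r x] by (simp add: T_def)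
    moreover have "conv (W \<epsilon>) (bump 6 r) x = V \<epsilon> x * T" using T by (simp add: V_def)
    ultimately have "\<bar>(V \<epsilon> x - W \<epsilon> x) * T\<bar> \<le> \<eta>1 * T" by (simp add: left_diff_distrib)
    then show ?thesis using T by (simp add: abs_mult)
  qed
  have far: "\<bar>W \<epsilon> x - W \<epsilon>' x\<bar> \<le> 2 * \<eta>1"
    if A: "0 < \<epsilon>" "\<epsilon> < \<epsilon>3" "0 < \<epsilon>'" "\<epsilon>' < \<epsilon>3" "x \<in> closure D" "infdist x (frontier D) \<le> 2 * r" for \<epsilon> \<epsilon>' x
  proof -
    obtain a where "a \<in> frontier D" "dist x a < \<delta>3"
      using obtain_near_frontier[of x \<delta>3] A r by auto
    then have "\<bar>W \<epsilon> x - F a\<bar> \<le> \<eta>1" "\<bar>W \<epsilon>' x - F a\<bar> \<le> \<eta>1" using near A by auto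
    then show ?thesis by linarith
  qed
  \<comment> \<open>The last entry bounds each mollified Laplacian by \<open>\<mu> / 2\<close>,
    hence that of the difference from below by \<open>- \<mu>\<close>; the \<open>+ 1\<close>
    excludes division by zero.\<close>
  define \<epsilon>0 where "\<epsilon>0 = Min {\<epsilon>2, \<epsilon>3, r, 1, \<mu> * T / (2 * (C * M + 1))}"
  have CM: "0 \<le> C * M" using C M_nonneg by simp
  have \<epsilon>0: "\<epsilon>0 > 0" using 2 3 r \<mu> T CM by (simp add: \<epsilon>0_def)
  have le\<epsilon>: "\<epsilon> < \<epsilon>2" "\<epsilon> < \<epsilon>3" "\<epsilon> < r" "\<epsilon> \<le> 1" "\<epsilon> < \<mu> * T / (2 * (C * M + 1))" if "\<epsilon> < \<epsilon>0" for \<epsilon>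
    using that by (auto simp: \<epsilon>0_def)
  have lap: "\<bar>conv (W \<epsilon>) (bump_laplacian 6 r) x / T\<bar> \<le> \<mu> / 2" if \<epsilon>: "0 < \<epsilon>" "\<epsilon> < \<epsilon>0" and x: "x \<in> U" for \<epsilon> x
  proof -
    have "\<bar>conv (W \<epsilon>) (bump_laplacian 6 r) x\<bar> \<le> C * M * \<epsilon>"
    proof (rule C(2)[OF W_measurable W_le])
      show "W \<epsilon> y = (\<integral>w. W \<epsilon> (y + \<epsilon> *\<^sub>R w) \<partial>ball_prob)" if "norm (x - y) < r" for y
        using inner[of x y] that x UK \<epsilon> le\<epsilon>[OF \<epsilon>(2)] by (intro W_mean) auto
    qed (use \<epsilon> le\<epsilon> in auto)
    also have "\<dots> \<le> (C * M + 1) * (\<mu> * T / (2 * (C * M + 1)))"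
      using CM \<epsilon> le\<epsilon>[OF \<epsilon>(2)] by (intro mult_mono) auto
    also have "\<dots> = \<mu> * T / 2" using CM by (simp add: field_simps)
    finally show ?thesis using T by (simp add: field_simps)
  qed
  have one_sided: "W \<epsilon> x - W \<epsilon>' x \<le> \<eta>" if \<epsilon>: "0 < \<epsilon>" "\<epsilon> < \<epsilon>0" and \<epsilon>': "0 < \<epsilon>'" "\<epsilon>' < \<epsilon>0" for \<epsilon> \<epsilon>' x
  proof (cases "x \<in> K")
    case False
    show ?thesis
    proof (cases "x \<in> closure D")
      case True
      then have "\<bar>W \<epsilon> x - W \<epsilon>' x\<bar> \<le> 2 * \<eta>1"
        using \<epsilon> \<epsilon>' le\<epsilon> False by (intro far) (auto simp: K_def)
      then show ?thesis using \<eta> unfolding \<eta>1_def by linarith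
    qed (use W_outside \<eta> in auto)
  next
    case True
    have "V \<epsilon> x - V \<epsilon>' x \<le> 4 * \<eta>1 + \<mu> * R\<^sup>2"
    proof (rule laplacian_maximum_principle[where U=U and K=K and \<kappa>=\<mu>])
      show "((\<lambda>x. V \<epsilon> x - V \<epsilon>' x) has_derivative
          (\<lambda>h. conv (W \<epsilon>) (bump_grad 6 r h) x / T - conv (W \<epsilon>') (bump_grad 6 r h) x / T)) (at x)" for x
        unfolding V_def
        using has_derivative_mult_right[OF has_derivative_conv_bump[OF W_measurable W_le, of 6 r _ x], of "1 / T"] r0
        by (intro has_derivative_diff) simp_all
      then have "continuous_on UNIV (\<lambda>x. V \<epsilon> x - V \<epsilon>' x)"
        by (intro continuous_at_imp_continuous_on ballI has_derivative_continuous)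
      then show "continuous_on K (\<lambda>x. V \<epsilon> x - V \<epsilon>' x)" by (rule continuous_on_subset) simp
      show "((\<lambda>y. conv (W \<epsilon>) (bump_grad 6 r v) y / T - conv (W \<epsilon>') (bump_grad 6 r v) y / T) has_derivative
          (\<lambda>w. conv (W \<epsilon>) (bump_hess 6 r v w) x / T - conv (W \<epsilon>') (bump_hess 6 r v w) x / T)) (at x)" for x v
        using has_derivative_mult_right[OF has_derivative_conv_bump_grad[OF W_measurable W_le, of 6 r _ v x], of "1 / T"] r0
        by (intro has_derivative_diff) simp_all
      show "- \<mu> \<le> (\<Sum>i\<in>Basis. conv (W \<epsilon>) (bump_hess 6 r i i) x / T - conv (W \<epsilon>') (bump_hess 6 r i i) x / T)"
        if "x \<in> U" for x
      proof -
        have "(\<Sum>i\<in>Basis. conv (W \<epsilon>) (bump_hess 6 r i i) x / T - conv (W \<epsilon>') (bump_hess 6 r i i) x / T)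
          = conv (W \<epsilon>) (bump_laplacian 6 r) x / T - conv (W \<epsilon>') (bump_laplacian 6 r) x / T"
          using sum_conv_bump_hess[OF W_measurable W_le, of 6 r _ x] r0
          by (simp add: sum_subtractf flip: sum_divide_distrib)
        then show ?thesis using lap[OF \<epsilon> that] lap[OF \<epsilon>' that] by linarith
      qed
      show "V \<epsilon> x - V \<epsilon>' x \<le> 4 * \<eta>1" if "x \<in> K - U" for x
      proof -
        have "infdist x (frontier D) \<le> 2 * r" using that KD by (auto simp: U_def)
        then have "\<bar>W \<epsilon> x - W \<epsilon>' x\<bar> \<le> 2 * \<eta>1" using that \<epsilon> \<epsilon>' le\<epsilon> by (intro far) (auto simp: K_def)
        moreover have "\<bar>V \<epsilon> x - W \<epsilon> x\<bar> \<le> \<eta>1" "\<bar>V \<epsilon>' x - W \<epsilon>' x\<bar> \<le> \<eta>1"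
          using that \<epsilon> \<epsilon>' le\<epsilon> by (auto intro!: VW)
        ultimately show ?thesis by linarith
      qed
      show "K \<subseteq> cball 0 R" using R by (auto simp: K_def)
    qed (use K U UK \<mu> True in auto)
    moreover have "\<bar>V \<epsilon> x - W \<epsilon> x\<bar> \<le> \<eta>1" "\<bar>V \<epsilon>' x - W \<epsilon>' x\<bar> \<le> \<eta>1"
      using True \<epsilon> \<epsilon>' le\<epsilon> by (auto intro!: VW)
    ultimately have "W \<epsilon> x - W \<epsilon>' x \<le> 7 * \<eta>1" using \<mu>(2) by linarith
    then show ?thesis by (simp add: \<eta>1_def)
  qed
  show ?thesis
  proof (rule that[OF \<epsilon>0])
    fix \<epsilon> \<epsilon>' x assume "0 < \<epsilon>" "\<epsilon> < \<epsilon>0" "0 < \<epsilon>'" "\<epsilon>' < \<epsilon>0"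
    then show "\<bar>W \<epsilon> x - W \<epsilon>' x\<bar> \<le> \<eta>"
      using one_sided[of \<epsilon> \<epsilon>' x] one_sided[of \<epsilon>' \<epsilon> x] by linarith
  qed
qed

text \<open>The limit is taken along a sequence so that \<open>u\<close> is Borel measurable; the
  Cauchy estimate then extends the convergence, uniformly on the whole space, to all small
  \<open>\<epsilon>\<close>.\<close>

lemma W_limit:
  obtains u where "u \<in> borel_measurable borel" "\<And>x. \<bar>u x\<bar> \<le> M"
    "\<And>\<eta>. \<eta> > 0 \<Longrightarrow> \<exists>\<epsilon>0>0. \<forall>\<epsilon> x. 0 < \<epsilon> \<longrightarrow> \<epsilon> < \<epsilon>0 \<longrightarrow> \<bar>W \<epsilon> x - u x\<bar> \<le> \<eta>"
proof -
  define e :: "nat \<Rightarrow> real" where "e n = 1 / (real n + 1)" for n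
  have e: "e \<longlonglongrightarrow> 0" "\<And>n. e n > 0"
    using LIMSEQ_inverse_real_of_nat by (auto simp: e_def[abs_def] inverse_eq_divide add.commute)
  have small: "eventually (\<lambda>n. e n < d) sequentially" if "d > 0" for d
    using order_tendstoD(2)[OF e(1) that] .
  define u where "u x = lim (\<lambda>n. W (e n) x)" for x
  have lim: "(\<lambda>n. W (e n) x) \<longlonglongrightarrow> u x" for x
  proof -
    have "Cauchy (\<lambda>n. W (e n) x)"
    proof (rule metric_CauchyI)
      fix d :: real assume "d > 0"
      then obtain \<epsilon>0 where \<epsilon>0: "\<epsilon>0 > 0"
        "\<And>\<epsilon> \<epsilon>' x. 0 < \<epsilon> \<Longrightarrow> \<epsilon> < \<epsilon>0 \<Longrightarrow> 0 < \<epsilon>' \<Longrightarrow> \<epsilon>' < \<epsilon>0 \<Longrightarrow> \<bar>W \<epsilon> x - W \<epsilon>' x\<bar> \<le> d / 2"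
        using W_Cauchy[of "d / 2"] by (metis half_gt_zero)
      from small[OF \<epsilon>0(1)] obtain N where N: "\<And>n. n \<ge> N \<Longrightarrow> e n < \<epsilon>0"
        by (auto simp: eventually_sequentially)
      have "dist (W (e m) x) (W (e n) x) < d" if "m \<ge> N" "n \<ge> N" for m n
      proof -
        have "\<bar>W (e m) x - W (e n) x\<bar> \<le> d / 2" using that N e by (intro \<epsilon>0) auto
        then show ?thesis using \<open>d > 0\<close> by (simp add: dist_real_def)
      qed
      then show "\<exists>N. \<forall>m\<ge>N. \<forall>n\<ge>N. dist (W (e m) x) (W (e n) x) < d" by blast
    qed
    then show ?thesis unfolding u_def by (simp add: Cauchy_convergent_iff convergent_LIMSEQ_iff)
  qed
  show ?thesis
  proof (rule that)
    show "u \<in> borel_measurable borel"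
      by (rule borel_measurable_LIMSEQ_real[OF lim W_measurable])
    show "\<bar>u x\<bar> \<le> M" for x
      by (rule LIMSEQ_le_const2[OF tendsto_rabs[OF lim]]) (use W_le in auto)
    fix \<eta> :: real assume "\<eta> > 0"
    then obtain \<epsilon>0 where \<epsilon>0: "\<epsilon>0 > 0"
      "\<And>\<epsilon> \<epsilon>' x. 0 < \<epsilon> \<Longrightarrow> \<epsilon> < \<epsilon>0 \<Longrightarrow> 0 < \<epsilon>' \<Longrightarrow> \<epsilon>' < \<epsilon>0 \<Longrightarrow> \<bar>W \<epsilon> x - W \<epsilon>' x\<bar> \<le> \<eta>"
      using W_Cauchy[of \<eta>] by metis
    have "\<bar>W \<epsilon> x - u x\<bar> \<le> \<eta>" if "0 < \<epsilon>" "\<epsilon> < \<epsilon>0" for \<epsilon> x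
    proof (rule tendsto_upperbound)
      show "(\<lambda>n. \<bar>W \<epsilon> x - W (e n) x\<bar>) \<longlonglongrightarrow> \<bar>W \<epsilon> x - u x\<bar>"
        by (intro tendsto_intros lim)
      show "eventually (\<lambda>n. \<bar>W \<epsilon> x - W (e n) x\<bar> \<le> \<eta>) sequentially"
        using small[OF \<epsilon>0(1)] by eventually_elim (use \<epsilon>0 that e in auto)
    qed simp
    then show "\<exists>\<epsilon>0>0. \<forall>\<epsilon> x. 0 < \<epsilon> \<longrightarrow> \<epsilon> < \<epsilon>0 \<longrightarrow> \<bar>W \<epsilon> x - u x\<bar> \<le> \<eta>"
      using \<epsilon>0(1) by blast
  qed
qed

text \<open>The Laplacian integral of \<open>W \<epsilon>\<close> is of order
  \<open>\<epsilon>\<close>, and uniform convergence passes its vanishing in the limit on to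
  \<open>u\<close>.\<close>

lemma limit_weakly_harmonic:
  assumes u: "u \<in> borel_measurable borel" "\<And>x. \<bar>u x\<bar> \<le> M"
    and lim: "\<And>\<eta>. \<eta> > 0 \<Longrightarrow> \<exists>\<epsilon>0>0. \<forall>\<epsilon> x. 0 < \<epsilon> \<longrightarrow> \<epsilon> < \<epsilon>0 \<longrightarrow> \<bar>W \<epsilon> x - u x\<bar> \<le> \<eta>"
    and s: "0 < s" "cball x s \<subseteq> D" and k: "k \<ge> 4"
  shows "conv u (bump_laplacian k s) x = 0"
proof -
  have s0: "0 \<le> s" using s by simp
  obtain C where C: "C \<ge> 0"
    "\<And>W M \<epsilon> (x :: 'a). W \<in> borel_measurable borel \<Longrightarrow> (\<And>y. \<bar>W y\<bar> \<le> M) \<Longrightarrow>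
      0 < \<epsilon> \<Longrightarrow> \<epsilon> \<le> 1 \<Longrightarrow>
      (\<And>y. norm (x - y) < s \<Longrightarrow> W y = (\<integral>w. W (y + \<epsilon> *\<^sub>R w) \<partial>ball_prob)) \<Longrightarrow>
      \<bar>conv W (bump_laplacian k s) x\<bar> \<le> C * M * \<epsilon>"
    using conv_bump_laplacian_le[OF k s0] by metis
  have lap0: "s \<le> norm z \<Longrightarrow> bump_laplacian k s z = 0" for z :: 'a
    using k s0 by (intro bump_laplacian_eq_0) auto
  obtain L where L: "0 \<le> L" "\<And>z::'a. \<bar>bump_laplacian k s z\<bar> \<le> L"
    using continuous_bounded_support[OF continuous_on_bump_laplacian lap0] by blast
  define Q where "Q = L * (unit_ball_vol DIM('a) * s ^ DIM('a))"
  have Q: "Q \<ge> 0" using L s by (simp add: Q_def)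
  \<comment> \<open>A compact ball inside \<open>D\<close> has a positive distance \<open>d\<close>
    from the frontier, so the mean value property holds throughout it once
    \<open>\<epsilon> \<le> d\<close>.\<close>
  have "cball x s \<inter> frontier D = {}" using s D(1) by (auto simp: frontier_def interior_open)
  then obtain d where d: "d > 0" "\<And>y a. y \<in> cball x s \<Longrightarrow> a \<in> frontier D \<Longrightarrow> d \<le> dist y a"
    using separate_compact_closed[of "cball x s" "frontier D"] frontier_closed by (metis compact_cball)
  have far: "d \<le> infdist y (frontier D)" if "y \<in> cball x s" for y
    using infdist_attains_inf[OF frontier_closed[of D] frontier_nonempty, of y] d that by metis
  have "\<bar>conv u (bump_laplacian k s) x\<bar> \<le> 0 + e" if e: "e > 0" for e
  proof -
    obtain \<epsilon>0 where \<epsilon>0: "\<epsilon>0 > 0"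
      "\<And>\<epsilon> x. 0 < \<epsilon> \<Longrightarrow> \<epsilon> < \<epsilon>0 \<Longrightarrow> \<bar>W \<epsilon> x - u x\<bar> \<le> e / (2 * (Q + 1))"
      using lim[of "e / (2 * (Q + 1))"] e Q by auto
    define \<epsilon> where "\<epsilon> = Min {\<epsilon>0 / 2, d, 1, e / (2 * (C * M + 1))}"
    have CM: "0 \<le> C * M" using C M_nonneg by simp
    have \<epsilon>: "0 < \<epsilon>" "\<epsilon> < \<epsilon>0" "\<epsilon> \<le> d" "\<epsilon> \<le> 1" "\<epsilon> \<le> e / (2 * (C * M + 1))"
      using \<epsilon>0(1) d(1) that CM by (auto simp: \<epsilon>_def min_less_iff_disj)
    have "\<bar>conv (W \<epsilon>) (bump_laplacian k s) x\<bar> \<le> C * M * \<epsilon>"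
    proof (rule C(2)[OF W_measurable W_le \<epsilon>(1,4)])
      show "W \<epsilon> y = (\<integral>w. W \<epsilon> (y + \<epsilon> *\<^sub>R w) \<partial>ball_prob)" if "norm (x - y) < s" for y
        using that far[of y] \<epsilon> s by (intro W_mean) (auto simp: dist_norm)
    qed
    also have "\<dots> \<le> (C * M + 1) * (e / (2 * (C * M + 1)))"
      using CM \<epsilon> by (intro mult_mono) auto
    also have "\<dots> = e / 2" using CM by (simp add: field_simps)
    finally have 1: "\<bar>conv (W \<epsilon>) (bump_laplacian k s) x\<bar> \<le> e / 2" .
    have [measurable]: "bump_laplacian k s \<in> borel_measurable (borel :: 'a measure)" "W \<epsilon> \<in> borel_measurable borel"
      "u \<in> borel_measurable borel"
      using continuous_on_bump_laplacian W_measurable u by (auto intro: borel_measurable_continuous_onI)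
    have "conv (W \<epsilon>) (bump_laplacian k s) x - conv u (bump_laplacian k s) x
        = (\<integral>y. (W \<epsilon> y - u y) * bump_laplacian k s (x - y) \<partial>lborel)"
      using integrable_convolution[OF W_measurable W_le continuous_on_bump_laplacian lap0]
        integrable_convolution[OF u continuous_on_bump_laplacian lap0]
      by (simp add: conv_def left_diff_distrib)
    also have "\<bar>\<dots>\<bar> \<le> (e / (2 * (Q + 1)) * L) * (unit_ball_vol DIM('a) * s ^ DIM('a))"
    proof (rule integral_bounded_support(2)[where x=x])
      show "\<bar>(W \<epsilon> y - u y) * bump_laplacian k s (x - y)\<bar> \<le> e / (2 * (Q + 1)) * L" for y
        unfolding abs_mult using \<epsilon>0(2)[OF \<epsilon>(1,2)] L Q \<open>e > 0\<close> by (intro mult_mono) auto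
    qed (use s0 lap0 in \<open>auto simp: dist_norm\<close>)
    also have "\<dots> = e / (2 * (Q + 1)) * Q" by (simp add: Q_def)
    also have "\<dots> \<le> e / (2 * (Q + 1)) * (Q + 1)" using Q \<open>e > 0\<close> by (intro mult_left_mono) auto
    also have "\<dots> = e / 2" using Q by (simp add: field_simps)
    finally show ?thesis using 1 by linarith
  qed
  then have "\<bar>conv u (bump_laplacian k s) x\<bar> \<le> 0" by (rule field_le_epsilon)
  then show ?thesis by simp
qed

lemma harmonic_limit:
  obtains u where "continuous_on (closure D) u" "harmonic_on D u" "\<And>x. x \<in> frontier D \<Longrightarrow> u x = F x"
    "uniform_limit (closure D) W u (at_right 0)"
proof -
  obtain u where u: "u \<in> borel_measurable borel" "\<And>x. \<bar>u x\<bar> \<le> M"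
    and lim: "\<And>\<eta>. \<eta> > 0 \<Longrightarrow> \<exists>\<epsilon>0>0. \<forall>\<epsilon> x. 0 < \<epsilon> \<longrightarrow> \<epsilon> < \<epsilon>0 \<longrightarrow> \<bar>W \<epsilon> x - u x\<bar> \<le> \<eta>"
    using W_limit by blast
  \<comment> \<open>No single \<open>W \<epsilon>\<close> is known to be continuous; equicontinuity
    at one small \<open>\<epsilon>\<close> plus two uniform errors of \<open>e / 4\<close> gives
    continuity of the limit.\<close>
  have cont: "continuous_on (closure D) u"
    unfolding continuous_on_iff
  proof (intro ballI allI impI)
    fix x and e :: real assume x: "x \<in> closure D" and "e > 0"
    then have e: "e / 4 > 0" by simp
    obtain \<delta> \<epsilon>1 where \<delta>: "\<delta> > 0" "\<epsilon>1 > 0" "\<And>\<epsilon> x y. 0 < \<epsilon> \<Longrightarrow> \<epsilon> < \<epsilon>1 \<Longrightarrow> x \<in> closure D \<Longrightarrow>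
        y \<in> closure D \<Longrightarrow> dist x y < \<delta> \<Longrightarrow> \<bar>W \<epsilon> x - W \<epsilon> y\<bar> \<le> e / 4"
      using W_equicontinuous[OF e] by blast
    obtain \<epsilon>2 where \<epsilon>2: "\<epsilon>2 > 0" "\<And>\<epsilon> x. 0 < \<epsilon> \<Longrightarrow> \<epsilon> < \<epsilon>2 \<Longrightarrow> \<bar>W \<epsilon> x - u x\<bar> \<le> e / 4"
      using lim[OF e] by blast
    define \<epsilon> where "\<epsilon> = min \<epsilon>1 \<epsilon>2 / 2"
    have \<epsilon>: "0 < \<epsilon>" "\<epsilon> < \<epsilon>1" "\<epsilon> < \<epsilon>2" using \<delta> \<epsilon>2 by (auto simp: \<epsilon>_def)
    have "dist (u y) (u x) < e" if "y \<in> closure D" "dist y x < \<delta>" for y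
      using \<delta>(3)[OF \<epsilon>(1,2) that(1) x that(2)] \<epsilon>2(2)[OF \<epsilon>(1,3), of x] \<epsilon>2(2)[OF \<epsilon>(1,3), of y] \<open>e > 0\<close>
      unfolding dist_real_def by linarith
    then show "\<exists>d>0. \<forall>y\<in>closure D. dist y x < d \<longrightarrow> dist (u y) (u x) < e" using \<delta>(1) by blast
  qed
  have uF: "u x = F x" if x: "x \<in> frontier D" for x
  proof -
    have "\<bar>u x - F x\<bar> \<le> 0 + e" if "e > 0" for e
    proof -
      have e: "e / 2 > 0" using that by simp
      obtain \<delta> \<epsilon>1 where \<delta>: "\<delta> > 0" "\<epsilon>1 > 0" "\<And>\<epsilon> x y. 0 < \<epsilon> \<Longrightarrow> \<epsilon> < \<epsilon>1 \<Longrightarrow> x \<in> closure D \<Longrightarrow>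
          y \<in> frontier D \<Longrightarrow> dist x y < \<delta> \<Longrightarrow> \<bar>W \<epsilon> x - F y\<bar> \<le> e / 2"
        using W_frontier[OF e] by metis
      obtain \<epsilon>2 where \<epsilon>2: "\<epsilon>2 > 0" "\<And>\<epsilon> x. 0 < \<epsilon> \<Longrightarrow> \<epsilon> < \<epsilon>2 \<Longrightarrow> \<bar>W \<epsilon> x - u x\<bar> \<le> e / 2"
        using lim[OF e] by blast
      define \<epsilon> where "\<epsilon> = min \<epsilon>1 \<epsilon>2 / 2"
      have \<epsilon>: "0 < \<epsilon>" "\<epsilon> < \<epsilon>1" "\<epsilon> < \<epsilon>2" using \<delta> \<epsilon>2 by (auto simp: \<epsilon>_def)
      have "\<bar>W \<epsilon> x - F x\<bar> \<le> e / 2" using \<delta>(1) x by (intro \<delta>(3)[OF \<epsilon>(1,2)]) (auto simp: closure_D)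
      then show ?thesis using \<epsilon>2(2)[OF \<epsilon>(1,3), of x] by linarith
    qed
    then have "\<bar>u x - F x\<bar> \<le> 0" by (rule field_le_epsilon)
    then show ?thesis by simp
  qed
  have harm: "harmonic_on D u"
  proof (rule weakly_harmonic_imp_harmonic_on[OF D(1) u])
    show "continuous_on D u" using cont closure_subset by (rule continuous_on_subset)
  qed (rule limit_weakly_harmonic[OF u lim])
  have "uniform_limit (closure D) W u (at_right 0)"
  proof (rule uniform_limitI)
    fix e :: real assume "e > 0"
    then obtain \<epsilon>0 where \<epsilon>0: "\<epsilon>0 > 0" "\<And>\<epsilon> x. 0 < \<epsilon> \<Longrightarrow> \<epsilon> < \<epsilon>0 \<Longrightarrow> \<bar>W \<epsilon> x - u x\<bar> \<le> e / 2"
      using lim[of "e / 2"] by auto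
    have "dist (W \<epsilon> x) (u x) < e" if "0 < \<epsilon>" "\<epsilon> < \<epsilon>0" for \<epsilon> x
      using \<epsilon>0(2)[OF that, of x] \<open>e > 0\<close> by (simp add: dist_real_def)
    then show "eventually (\<lambda>\<epsilon>. \<forall>x\<in>closure D. dist (W \<epsilon> x) (u x) < e) (at_right 0)"
      using \<epsilon>0(1) by (auto simp: eventually_at_right[of 0 1])
  qed
  with cont harm uF show ?thesis by (rule that)
qed

end

subsection \<open>The ball walk\<close>

interpretation ball_seq: sequence_space "ball_prob :: 'a::euclidean_space measure"
  by unfold_locales

abbreviation path_measure :: "(nat \<Rightarrow> 'a::euclidean_space) measure" where
  "path_measure \<equiv> PiM UNIV (\<lambda>_. ball_prob)"

text \<open>Fubini after splitting off coordinate 0; the source of the Markov property.\<close>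

lemma integral_path_measure_iter:
  fixes f :: "(nat \<Rightarrow> 'a::euclidean_space) \<Rightarrow> real"
  assumes [measurable]: "f \<in> borel_measurable path_measure" and B: "\<And>\<omega>. \<bar>f \<omega>\<bar> \<le> B"
  shows "(\<integral>\<omega>. f \<omega> \<partial>path_measure) = (\<integral>s. (\<integral>\<omega>. f (case_nat s \<omega>) \<partial>path_measure) \<partial>ball_prob)"
proof -
  interpret P: pair_prob_space "ball_prob :: 'a measure" "path_measure :: (nat \<Rightarrow> 'a) measure" ..
  let ?g = "\<lambda>(s, \<omega>). case_nat s \<omega> :: nat \<Rightarrow> 'a"
  have [measurable]: "?g \<in> ball_prob \<Otimes>\<^sub>M path_measure \<rightarrow>\<^sub>M path_measure"
    by measurable
  have "(\<integral>\<omega>. f \<omega> \<partial>path_measure) = integral\<^sup>L (distr (ball_prob \<Otimes>\<^sub>M path_measure) path_measure ?g) f"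
    by (simp add: ball_seq.PiM_iter)
  also have "\<dots> = (\<integral>p. f (?g p) \<partial>(ball_prob \<Otimes>\<^sub>M path_measure))"
    by (rule integral_distr) auto
  also have "\<dots> = (\<integral>s. (\<integral>\<omega>. f (?g (s, \<omega>)) \<partial>path_measure) \<partial>ball_prob)"
    by (rule P.integral_fst'[symmetric], rule P.integrable_const_bound[where B=B]) (auto intro: B)
  finally show ?thesis by simp
qed

section \<open>Dependence of the walk on its increments, and measurability\<close>

lemma walk_cong:
  "(\<And>n. \<omega> (Suc n) = \<omega>' (Suc n)) \<Longrightarrow> walk D \<epsilon> x \<omega> n = walk D \<epsilon> x \<omega>' n"
  by (induction n) auto

lemma walk_limit_cong:
  "(\<And>n. \<omega> (Suc n) = \<omega>' (Suc n)) \<Longrightarrow> walk_limit D \<epsilon> x \<omega> = walk_limit D \<epsilon> x \<omega>'"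
  unfolding walk_limit_def using walk_cong[of \<omega> \<omega>' D \<epsilon> x] by presburger

lemma walk_shift:
  "walk D \<epsilon> x \<omega> (Suc n)
    = walk D \<epsilon> (x + min \<epsilon> (infdist x (frontier D)) *\<^sub>R \<omega> 1) (\<lambda>i. \<omega> (Suc i)) n"
  by (induction n) auto

text \<open>Divergent walks are included: \<open>lim\<close> is a definite description over the
  limit predicate, and that predicate is unchanged when the sequence is shifted.\<close>

lemma walk_limit_shift:
  "walk_limit D \<epsilon> x \<omega>
    = walk_limit D \<epsilon> (x + min \<epsilon> (infdist x (frontier D)) *\<^sub>R \<omega> 1) (\<lambda>i. \<omega> (Suc i))"
  unfolding walk_limit_def lim_def walk_shift[symmetric]
  by (simp only: filterlim_sequentially_Suc)

lemma borel_measurable_infdist [measurable]: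
  "(\<lambda>x. infdist x A) \<in> borel_measurable (borel :: 'a::euclidean_space measure)"
  by (intro borel_measurable_continuous_onI continuous_intros)

text \<open>Joint measurability in starting point and path, because the mean value formula
  randomises the starting point.\<close>

lemma measurable_walk [measurable]:
  "(\<lambda>(x, \<omega>). walk D \<epsilon> x \<omega> n) \<in> borel_measurable (borel \<Otimes>\<^sub>M (path_measure :: (nat \<Rightarrow> 'a::euclidean_space) measure))"
proof (induction n)
  case (Suc n)
  note [measurable] = Suc
  have [measurable]: "(\<lambda>p. snd p (Suc n)) \<in> borel_measurable (borel \<Otimes>\<^sub>M (path_measure :: (nat \<Rightarrow> 'a) measure))"
    by measurable
  show ?case by (simp add: case_prod_beta') measurable
qed simp

lemma measurable_walk_limit [measurable]:
  "(\<lambda>(x, \<omega>). walk_limit D \<epsilon> x \<omega>) \<in> borel_measurable (borel \<Otimes>\<^sub>M (path_measure :: (nat \<Rightarrow> 'a::euclidean_space) measure))"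
  unfolding walk_limit_def case_prod_beta'
  by (rule borel_measurable_lim_metric) (use measurable_walk in \<open>simp add: case_prod_beta'\<close>)

lemma measurable_walk_limit' [measurable]:
  "walk_limit D \<epsilon> x \<in> borel_measurable (path_measure :: (nat \<Rightarrow> 'a::euclidean_space) measure)"
  using measurable_compose[OF measurable_Pair1'[of x borel] measurable_walk_limit[of D \<epsilon>]] by simp

text \<open>A sequence tending to 0 eventually stays in the ball of radius 1/2, whose probability
  \<open>p\<close> is less than 1; by independence each such tail event is null, and there are
  countably many.\<close>

lemma AE_path_not_tendsto_0: "AE \<omega> in path_measure. \<not> (\<omega> \<longlonglongrightarrow> (0 :: 'a::euclidean_space))"
proof -
  define p where "p = measure ball_prob (ball (0::'a) (1 / 2))"
  have "ball (0::'a) 1 \<inter> ball 0 (1 / 2) = ball 0 (1 / 2)" by auto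
  moreover have nz: "unit_ball_vol (real DIM('a)) \<noteq> 0"
    using unit_ball_vol_pos[of "real DIM('a)"] by (metis less_irrefl of_nat_0_le_iff)
  ultimately have "p = (1 / 2) ^ DIM('a)"
    unfolding p_def ball_prob_def
    by (subst measure_uniform_measure) (use emeasure_lborel_unit_ball[where 'a='a] nz in \<open>auto simp: content_ball\<close>)
  then have p: "0 \<le> p" "p < 1" by (auto simp: power_less_one_iff)
  have "AE \<omega> in path_measure. \<omega> \<notin> {\<omega>. \<forall>i\<ge>m. norm (\<omega> i :: 'a) < 1 / 2}" for m
  proof -
    \<comment> \<open>The first \<open>m\<close> coordinates are free, so only the factors from
      index \<open>m\<close> on contribute powers of \<open>p\<close>.\<close>
    define E :: "nat \<Rightarrow> 'a set" where "E i = (if i < m then UNIV else ball 0 (1 / 2))" for i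
    have E: "E i \<in> sets ball_prob" for i by (simp add: E_def)
    have mE: "measure ball_prob (E i) = (if i < m then 1 else p)" for i
      using ball_prob.prob_space[where 'a='a] by (simp add: E_def p_def)
    have "(\<Prod>i\<le>n + m. measure ball_prob (E i)) = p ^ Suc n" for n
    proof (induction n)
      case 0
      have "{..m} = insert m {..<m}" by auto
      then show ?case by (simp add: mE)
    next
      case (Suc n)
      then show ?case using mE[of "Suc (n + m)"] by (simp add: mult.commute)
    qed
    moreover have "(\<lambda>n. \<Prod>i\<le>n + m. measure ball_prob (E i)) \<longlonglongrightarrow> measure path_measure (Pi UNIV E)"
      using ball_seq.measure_PiM_countable[OF E] by (rule LIMSEQ_ignore_initial_segment)
    moreover have "(\<lambda>n. p ^ Suc n) \<longlonglongrightarrow> 0"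
      using p by (intro LIMSEQ_Suc LIMSEQ_realpow_zero) auto
    ultimately have "measure path_measure (Pi UNIV E) = 0" by (auto dest: LIMSEQ_unique)
    then have "Pi UNIV E \<in> null_sets path_measure"
      using ball_seq.infprod_in_sets[OF E] by (simp add: ball_seq.P.emeasure_eq_measure null_sets_def)
    moreover have "w \<in> E i \<longleftrightarrow> (i \<ge> m \<longrightarrow> norm w < 1 / 2)" for i w
      by (simp add: E_def not_less)
    then have "Pi UNIV E = {\<omega>. \<forall>i\<ge>m. norm (\<omega> i) < 1 / 2}" by (simp add: Pi_def)
    ultimately show ?thesis using AE_not_in[of "Pi UNIV E" path_measure] by simp
  qed
  then have "AE \<omega> in path_measure. \<forall>m. \<omega> \<notin> {\<omega>. \<forall>i\<ge>m. norm (\<omega> i :: 'a) < 1 / 2}"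
    by (simp add: AE_all_countable)
  then show ?thesis
  proof eventually_elim
    case (elim \<omega>)
    show ?case
    proof
      assume "\<omega> \<longlonglongrightarrow> 0"
      then obtain m where "\<forall>i\<ge>m. norm (\<omega> i - 0) < 1 / 2" using LIMSEQ_D[of \<omega> 0 "1 / 2"] by auto
      then show False using elim by auto
    qed
  qed
qed

lemma walk_frontier: "0 < \<epsilon> \<Longrightarrow> x \<in> frontier D \<Longrightarrow> walk D \<epsilon> x \<omega> n = x"
  by (induction n) (auto simp: min_def)

lemma walk_limit_frontier: "0 < \<epsilon> \<Longrightarrow> x \<in> frontier D \<Longrightarrow> walk_limit D \<epsilon> x \<omega> = x"
  unfolding walk_limit_def by (rule limI, subst tendsto_cong[of _ "\<lambda>_. x"]) (auto simp: walk_frontier)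

text \<open>If the walk converged to an interior point, its step sizes would stay bounded below and the
  increments \<open>\<omega> n\<close> would have to tend to 0.\<close>

lemma walk_tendsto_in_frontier:
  fixes D :: "'a::euclidean_space set"
  assumes D: "open D" "bounded D" and \<epsilon>: "0 < \<epsilon>" and x: "x \<in> D"
    and \<omega>: "\<not> (\<omega> \<longlonglongrightarrow> 0)" and L: "walk D \<epsilon> x \<omega> \<longlonglongrightarrow> L"
  shows "L \<in> frontier D"
proof (rule ccontr)
  assume "L \<notin> frontier D"
  have "frontier D \<noteq> {}" using D x frontier_eq_empty[of D] not_bounded_UNIV by auto
  then have "infdist L (frontier D) > 0"
    using \<open>L \<notin> frontier D\<close> in_closed_iff_infdist_zero[OF frontier_closed[of D]] infdist_nonneg[of L "frontier D"]
    by (metis order_le_less)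
  define \<rho> where "\<rho> y = min \<epsilon> (infdist y (frontier D))" for y
  have "\<rho> L > 0" using \<epsilon> \<open>infdist L (frontier D) > 0\<close> by (simp add: \<rho>_def)
  have lim\<rho>: "(\<lambda>n. \<rho> (walk D \<epsilon> x \<omega> n)) \<longlonglongrightarrow> \<rho> L"
    unfolding \<rho>_def by (intro tendsto_min tendsto_const tendsto_infdist L)
  have "(\<lambda>n. walk D \<epsilon> x \<omega> (Suc n) - walk D \<epsilon> x \<omega> n) \<longlonglongrightarrow> L - L"
    by (intro tendsto_diff L LIMSEQ_Suc)
  then have "(\<lambda>n. inverse (\<rho> (walk D \<epsilon> x \<omega> n)) *\<^sub>R (\<rho> (walk D \<epsilon> x \<omega> n) *\<^sub>R \<omega> (Suc n))) \<longlonglongrightarrow> inverse (\<rho> L) *\<^sub>R 0"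
    using \<open>\<rho> L > 0\<close> by (intro tendsto_scaleR tendsto_inverse lim\<rho>) (auto simp: \<rho>_def)
  moreover have "eventually (\<lambda>n. inverse (\<rho> (walk D \<epsilon> x \<omega> n)) *\<^sub>R (\<rho> (walk D \<epsilon> x \<omega> n) *\<^sub>R \<omega> (Suc n)) = \<omega> (Suc n)) sequentially"
    using order_tendstoD(1)[OF lim\<rho> \<open>\<rho> L > 0\<close>] by eventually_elim auto
  ultimately have "(\<lambda>n. \<omega> (Suc n)) \<longlonglongrightarrow> 0" by (simp add: tendsto_cong)
  then have "\<omega> \<longlonglongrightarrow> 0" by (simp only: filterlim_sequentially_Suc)
  then show False using \<omega> by simp
qed

text \<open>On a divergent walk, \<open>lim\<close> takes the fixed junk value \<open>THE L. False\<close>. That divergence has probability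
  zero is never needed: walk regularity already controls the junk value.\<close>

lemma AE_walk_limit:
  fixes D :: "'a::euclidean_space set"
  assumes D: "open D" "bounded D" and \<epsilon>: "0 < \<epsilon>" and x: "x \<in> closure D"
  shows "AE \<omega> in path_measure. walk_limit D \<epsilon> x \<omega> \<in> insert (THE L. False) (frontier D)"
proof (cases "x \<in> frontier D")
  case True
  then show ?thesis by (simp add: walk_limit_frontier \<epsilon>)
next
  case False
  then have xD: "x \<in> D" using x D by (simp add: frontier_def interior_open)
  show ?thesis
    using AE_path_not_tendsto_0
  proof eventually_elim
    case (elim \<omega>)
    show ?case
    proof (cases "convergent (walk D \<epsilon> x \<omega>)")
      case True
      then have "walk D \<epsilon> x \<omega> \<longlonglongrightarrow> walk_limit D \<epsilon> x \<omega>"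
        by (simp add: walk_limit_def convergent_LIMSEQ_iff)
      then show ?thesis using walk_tendsto_in_frontier[OF D \<epsilon> xD] elim by blast
    next
      case False
      then have "walk_limit D \<epsilon> x \<omega> = (THE L. False)"
        unfolding walk_limit_def lim_def convergent_def by simp
      then show ?thesis by simp
    qed
  qed
qed

section \<open>Expectations of the boundary values\<close>

lemma borel_measurable_completion_cong_AE:
  assumes f: "f \<in> borel_measurable M" and ae: "AE x in M. f x = g x"
  shows "g \<in> borel_measurable (completion M)"
proof (rule measurableI)
  fix A :: "'b set" assume A: "A \<in> sets borel"
  show "g -` A \<inter> space (completion M) \<in> sets (completion M)"
  proof (rule completion.in_sets_AE)
    show "f -` A \<inter> space M \<in> sets (completion M)" using measurable_sets[OF f A] by simp
    show "AE x in completion M. (x \<in> f -` A \<inter> space M) = (x \<in> g -` A \<inter> space (completion M))"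
      using AE_completion[OF ae] by eventually_elim auto
  qed simp
qed simp

text \<open>\<open>F\<close> is arbitrary away from the frontier, hence possibly not Borel there.
  The constant used instead is the value of \<open>F\<close> at the result of \<open>lim\<close> on
  divergent sequences, so composing with the walk limit changes the integrand on a null set
  only.\<close>

definition frontier_ext :: "'a::euclidean_space set \<Rightarrow> ('a \<Rightarrow> real) \<Rightarrow> 'a \<Rightarrow> real" where
  "frontier_ext D F y = (if y \<in> frontier D then F y else F (THE L. False))"

definition walk_mean :: "'a::euclidean_space set \<Rightarrow> ('a \<Rightarrow> real) \<Rightarrow> real \<Rightarrow> 'a \<Rightarrow> real" where
  "walk_mean D F \<epsilon> x = (\<integral>\<omega>. frontier_ext D F (walk_limit D \<epsilon> x \<omega>) \<partial>path_measure)"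

lemma measurable_frontier_ext:
  assumes "continuous_on (frontier D) F"
  shows "frontier_ext D F \<in> borel_measurable borel"
proof -
  have "(\<lambda>y. indicator (frontier D) y *\<^sub>R F y) \<in> borel_measurable borel"
    using assms by (intro borel_measurable_continuous_on_indicator) (auto simp: frontier_closed borel_closed)
  then have "(\<lambda>y. if y \<in> frontier D then indicator (frontier D) y *\<^sub>R F y else F (THE L. False)) \<in> borel_measurable borel"
    by (intro measurable_If_set) (auto simp: frontier_closed borel_closed)
  also have "(\<lambda>y. if y \<in> frontier D then indicator (frontier D) y *\<^sub>R F y else F (THE L. False)) = frontier_ext D F"
    by (auto simp: frontier_ext_def fun_eq_iff)
  finally show ?thesis .
qed

lemma frontier_ext_bounded:
  assumes "bounded D" "continuous_on (frontier D) F"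
  obtains M where "\<And>y. \<bar>frontier_ext D F y\<bar> \<le> M"
proof -
  have "compact (F ` frontier D)"
    using assms by (intro compact_continuous_image compact_frontier_bounded)
  then obtain B where B: "\<And>y. y \<in> frontier D \<Longrightarrow> \<bar>F y\<bar> \<le> B"
    using compact_imp_bounded[of "F ` frontier D"] by (auto simp: bounded_iff)
  have "\<bar>frontier_ext D F y\<bar> \<le> max B \<bar>F (THE L. False)\<bar>" for y
    using B[of y] by (auto simp: frontier_ext_def)
  then show ?thesis by (rule that)
qed

text \<open>The original integrand agrees almost everywhere with a Borel one and is therefore
  measurable for the completion, which leaves the integral of the Borel one unchanged.\<close>

lemma u_eps_eq_walk_mean:
  assumes D: "open D" "bounded D" and F: "continuous_on (frontier D) F" and "0 < \<epsilon>" "x \<in> closure D"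
  shows "u_eps D F \<epsilon> x = walk_mean D F \<epsilon> x"
proof -
  note [measurable] = measurable_frontier_ext[OF F]
  let ?g = "\<lambda>\<omega>. frontier_ext D F (walk_limit D \<epsilon> x \<omega>)"
  have ae: "AE \<omega> in path_measure. ?g \<omega> = F (walk_limit D \<epsilon> x \<omega>)"
    using AE_walk_limit[OF D assms(4,5)] by eventually_elim (auto simp: frontier_ext_def)
  have m: "?g \<in> borel_measurable path_measure" by measurable
  have "u_eps D F \<epsilon> x = (\<integral>\<omega>. ?g \<omega> \<partial>completion path_measure)"
    unfolding u_eps_def walk_space_def
    using borel_measurable_completion_cong_AE[OF m ae] measurable_completion[OF m] AE_completion[OF ae]
    by (intro integral_cong_AE) auto
  then show ?thesis unfolding walk_mean_def using integral_completion[OF m] by simp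
qed

lemma measurable_walk_mean:
  assumes F: "continuous_on (frontier D) F"
  shows "walk_mean D F \<epsilon> \<in> borel_measurable borel"
proof -
  note [measurable] = measurable_frontier_ext[OF F]
  show ?thesis unfolding walk_mean_def[abs_def] by measurable
qed

lemma walk_mean_le:
  assumes "continuous_on (frontier D) F" "\<And>y. \<bar>frontier_ext D F y\<bar> \<le> M"
  shows "\<bar>walk_mean D F \<epsilon> x\<bar> \<le> M"
proof -
  note [measurable] = measurable_frontier_ext[OF assms(1)]
  show ?thesis unfolding walk_mean_def by (rule ball_seq.P.abs_expectation_le) (auto simp: assms)
qed

text \<open>The Markov property at the first step. Since coordinate 0 is idle, it takes two
  splittings: the first discards that coordinate and moves the first increment into its place, the
  second integrates this increment out.\<close>

lemma walk_mean_mean_value: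
  fixes D :: "'a::euclidean_space set"
  assumes F: "continuous_on (frontier D) F" and M: "\<And>y. \<bar>frontier_ext D F y\<bar> \<le> M"
  shows "walk_mean D F \<epsilon> x
    = (\<integral>w. walk_mean D F \<epsilon> (x + min \<epsilon> (infdist x (frontier D)) *\<^sub>R w) \<partial>ball_prob)"
proof -
  note [measurable] = measurable_frontier_ext[OF F]
  define g where "g y \<omega> = frontier_ext D F (walk_limit D \<epsilon> y \<omega>)" for y \<omega>
  define \<rho> where "\<rho> = min \<epsilon> (infdist x (frontier D))"
  have g_le: "\<bar>g y \<omega>\<bar> \<le> M" for y \<omega> by (simp add: g_def M)
  have [measurable]: "g y \<in> borel_measurable path_measure" for y
    unfolding g_def by measurable
  have gx: "g x (case_nat s \<omega>) = g (x + \<rho> *\<^sub>R \<omega> 0) \<omega>" for s \<omega>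
    unfolding g_def \<rho>_def by (subst walk_limit_shift) simp
  \<comment> \<open>The idle coordinate is fixed at 0, which makes the value visibly independent of
    it.\<close>
  define H where "H y \<omega> = g y (case_nat 0 \<omega>)" for y \<omega>
  have gc: "g y (case_nat s \<omega>) = H y \<omega>" for y s \<omega>
    unfolding H_def g_def by (rule arg_cong[where f="frontier_ext D F"], rule walk_limit_cong) simp
  have mean: "walk_mean D F \<epsilon> y = (\<integral>\<omega>. g y \<omega> \<partial>path_measure)" for y
    by (simp add: walk_mean_def g_def)
  have A: "walk_mean D F \<epsilon> y = (\<integral>\<omega>. H y \<omega> \<partial>path_measure)" for y
    unfolding mean
    by (subst integral_path_measure_iter[OF _ g_le])
       (use ball_prob.prob_space[where 'a='a] in \<open>auto simp: gc\<close>)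
  have [measurable]: "(\<lambda>\<omega>. g (x + \<rho> *\<^sub>R \<omega> 0) \<omega>) \<in> borel_measurable path_measure"
  proof -
    have "(\<lambda>\<omega>. (x + \<rho> *\<^sub>R \<omega> 0, \<omega>)) \<in> path_measure \<rightarrow>\<^sub>M borel \<Otimes>\<^sub>M path_measure" by measurable
    from measurable_compose[OF this measurable_walk_limit[of D \<epsilon>]]
    have [measurable]: "(\<lambda>\<omega>. walk_limit D \<epsilon> (x + \<rho> *\<^sub>R \<omega> 0) \<omega>) \<in> borel_measurable path_measure" by simp
    show ?thesis unfolding g_def by measurable
  qed
  have "walk_mean D F \<epsilon> x = (\<integral>\<omega>. g (x + \<rho> *\<^sub>R \<omega> 0) \<omega> \<partial>path_measure)"
    unfolding mean
    by (subst integral_path_measure_iter[OF _ g_le])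
       (use ball_prob.prob_space[where 'a='a] in \<open>auto simp: gx\<close>)
  also have "\<dots> = (\<integral>s. (\<integral>\<omega>. g (x + \<rho> *\<^sub>R s) (case_nat s \<omega>) \<partial>path_measure) \<partial>ball_prob)"
    by (subst integral_path_measure_iter[OF _ g_le]) auto
  also have "\<dots> = (\<integral>s. walk_mean D F \<epsilon> (x + \<rho> *\<^sub>R s) \<partial>ball_prob)"
    by (simp only: A gc)
  finally show ?thesis by (simp add: \<rho>_def)
qed

text \<open>On the event that the walk ends near \<open>y0\<close> continuity of \<open>F\<close>
  applies; the remaining event has probability at most \<open>\<eta>'\<close>, and there the
  integrand is off by at most \<open>2 * M\<close>. The last conclusion shares the radius
  \<open>\<delta>\<close>, so that a compactness argument can change the frontier point.\<close>

lemma walk_mean_near_regular_point: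
  fixes D :: "'a::euclidean_space set"
  assumes D: "open D" "bounded D" and F: "continuous_on (frontier D) F"
    and reg: "walk_regular_point D y0" and y0: "y0 \<in> frontier D" and \<eta>: "\<eta> > 0"
  obtains \<delta> \<epsilon>0 where "\<delta> > 0" "\<epsilon>0 > 0"
    "\<And>\<epsilon> x. 0 < \<epsilon> \<Longrightarrow> \<epsilon> < \<epsilon>0 \<Longrightarrow> x \<in> closure D \<Longrightarrow> dist y0 x < \<delta> \<Longrightarrow> \<bar>walk_mean D F \<epsilon> x - F y0\<bar> \<le> \<eta>"
    "\<And>y. y \<in> frontier D \<Longrightarrow> dist y0 y < \<delta> \<Longrightarrow> \<bar>F y - F y0\<bar> \<le> \<eta>"
proof -
  obtain M where M: "\<And>y. \<bar>frontier_ext D F y\<bar> \<le> M"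
    using frontier_ext_bounded[OF D(2) F] by blast
  have M0: "0 \<le> M" using M[of 0] by linarith
  note [measurable] = measurable_frontier_ext[OF F]
  obtain \<delta>1 where \<delta>1: "\<delta>1 > 0" "\<And>y. y \<in> frontier D \<Longrightarrow> dist y y0 < \<delta>1 \<Longrightarrow> dist (F y) (F y0) < \<eta> / 2"
    using F y0 \<eta> unfolding continuous_on_iff by (meson half_gt_zero)
  define J :: 'a where "J = (THE L. False)"
  \<comment> \<open>This radius excludes the junk value \<open>J\<close> from the ball around
    \<open>y0\<close>, unless \<open>J\<close> is \<open>y0\<close> itself and so a frontier
    point.\<close>
  define \<delta> where "\<delta> = (if J = y0 then \<delta>1 else min \<delta>1 (dist J y0))"
  have \<delta>: "\<delta> > 0" "\<delta> \<le> \<delta>1" "J \<noteq> y0 \<Longrightarrow> \<delta> \<le> dist J y0" using \<delta>1 by (auto simp: \<delta>_def)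
  \<comment> \<open>Makes the bad event cost at most \<open>\<eta> / 2\<close>; the
    \<open>+ 1\<close> covers \<open>M = 0\<close>.\<close>
  define \<eta>' where "\<eta>' = \<eta> / (4 * (M + 1))"
  have \<eta>': "\<eta>' > 0" "2 * M * \<eta>' \<le> \<eta> / 2" using \<eta> M0 by (auto simp: \<eta>'_def field_simps)
  obtain \<delta>' \<epsilon>' where \<delta>': "0 < \<delta>'" "\<delta>' < \<delta>" "0 < \<epsilon>'"
    and prob: "\<And>\<epsilon> x. 0 < \<epsilon> \<Longrightarrow> \<epsilon> < \<epsilon>' \<Longrightarrow> x \<in> ball y0 \<delta>' \<inter> D \<Longrightarrow>
      measure walk_space {\<omega> \<in> space walk_space. walk_limit D \<epsilon> x \<omega> \<in> ball y0 \<delta>} \<ge> 1 - \<eta>'"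
    using reg[unfolded walk_regular_point_def, rule_format, OF \<eta>'(1) \<delta>(1)] by blast
  have Fnear: "\<bar>F y - F y0\<bar> \<le> \<eta> / 2" if "y \<in> frontier D" "dist y0 y < \<delta>" for y
    using \<delta>1(2)[of y] that \<delta> by (simp add: dist_real_def dist_commute)
  have main: "\<bar>walk_mean D F \<epsilon> x - F y0\<bar> \<le> \<eta>"
    if \<epsilon>: "0 < \<epsilon>" "\<epsilon> < \<epsilon>'" and x: "x \<in> D" "dist y0 x < \<delta>'" for \<epsilon> x
  proof -
    let ?G = "\<lambda>\<omega>. frontier_ext D F (walk_limit D \<epsilon> x \<omega>)"
    define A where "A = {\<omega> \<in> space path_measure. walk_limit D \<epsilon> x \<omega> \<in> ball y0 \<delta>}"
    have A [measurable]: "A \<in> sets path_measure"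
      using measurable_sets[OF measurable_walk_limit'[of D \<epsilon> x], of "ball y0 \<delta>"]
      by (simp add: A_def vimage_def Int_def conj_commute)
    have "measure walk_space A \<ge> 1 - \<eta>'"
      using prob[OF \<epsilon>, of x] x by (simp add: A_def walk_space_def)
    then have PA: "measure path_measure A \<ge> 1 - \<eta>'" by (simp add: walk_space_def)
    have xc: "x \<in> closure D" using x closure_subset by auto
    have iG: "integrable path_measure ?G"
      by (rule ball_seq.P.integrable_const_bound[where B=M]) (auto simp: M)
    have iA: "integrable path_measure (\<lambda>\<omega>. indicat_real (space path_measure - A) \<omega>)"
      by (rule ball_seq.P.integrable_const_bound[where B=1]) auto
    have "walk_mean D F \<epsilon> x - F y0 = (\<integral>\<omega>. ?G \<omega> - F y0 \<partial>path_measure)"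
      using iG ball_seq.P.prob_space[where 'a='a] by (simp add: walk_mean_def)
    also have "\<bar>\<dots>\<bar> \<le> (\<integral>\<omega>. \<bar>?G \<omega> - F y0\<bar> \<partial>path_measure)" by (rule integral_abs_bound)
    also have "\<dots> \<le> (\<integral>\<omega>. \<eta> / 2 + 2 * M * indicator (space path_measure - A) \<omega> \<partial>path_measure)"
    proof (rule integral_mono_AE)
      show "AE \<omega> in path_measure. \<bar>?G \<omega> - F y0\<bar> \<le> \<eta> / 2 + 2 * M * indicator (space path_measure - A) \<omega>"
        using AE_walk_limit[OF D \<epsilon>(1) xc] AE_space
      proof eventually_elim
        case (elim \<omega>)
        show ?case
        proof (cases "\<omega> \<in> A")
          case True
          then have near: "dist y0 (walk_limit D \<epsilon> x \<omega>) < \<delta>" by (simp add: A_def)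
          have "walk_limit D \<epsilon> x \<omega> \<in> frontier D"
          proof (rule ccontr)
            assume nf: "\<not> ?thesis"
            then have "walk_limit D \<epsilon> x \<omega> = J" using elim by (simp add: J_def)
            moreover have "J \<noteq> y0" using calculation nf y0 by auto
            ultimately show False using near \<delta>(3) by (simp add: dist_commute)
          qed
          then show ?thesis using Fnear[OF _ near] M0 by (simp add: frontier_ext_def add_increasing2)
        next
          case False
          have "\<bar>?G \<omega> - F y0\<bar> \<le> 2 * M"
            using M[of "walk_limit D \<epsilon> x \<omega>"] M[of y0] y0 by (simp add: frontier_ext_def split: if_splits)
          then show ?thesis using False elim \<eta> by (simp add: indicator_def)
        qed
      qed
    qed (use iG iA in auto)
    also have "\<dots> = \<eta> / 2 + 2 * M * (1 - measure path_measure A)"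
      using ball_seq.P.prob_compl[OF A] ball_seq.P.prob_space[where 'a='a] iA by simp
    also have "\<dots> \<le> \<eta> / 2 + 2 * M * \<eta>'" using PA M0 by (intro add_mono mult_left_mono) auto
    finally show ?thesis using \<eta>'(2) by linarith
  qed
  show ?thesis
  proof (rule that[OF \<delta>'(1,3)])
    fix \<epsilon> x assume \<epsilon>: "0 < \<epsilon>" "\<epsilon> < \<epsilon>'" and x: "x \<in> closure D" "dist y0 x < \<delta>'"
    show "\<bar>walk_mean D F \<epsilon> x - F y0\<bar> \<le> \<eta>"
    proof (cases "x \<in> frontier D")
      case True
      then have "walk_mean D F \<epsilon> x = F x"
        using ball_seq.P.prob_space[where 'a='a] \<epsilon> by (simp add: walk_mean_def walk_limit_frontier frontier_ext_def)
      then show ?thesis using Fnear[OF True] x \<delta>' \<eta> by simp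
    next
      case False
      then show ?thesis using main[OF \<epsilon>] x D by (simp add: frontier_def interior_open)
    qed
  next
    fix y assume "y \<in> frontier D" "dist y0 y < \<delta>'"
    then show "\<bar>F y - F y0\<bar> \<le> \<eta>" using Fnear[of y] \<delta>' \<eta> by simp
  qed
qed

text \<open>Walk regularity is a pointwise condition; compactness of the frontier makes the radius
  and the threshold uniform.\<close>

lemma walk_mean_near_frontier:
  fixes D :: "'a::euclidean_space set"
  assumes D: "open D" "bounded D" "frontier D \<noteq> {}" and F: "continuous_on (frontier D) F"
    and reg: "walk_regular D" and \<eta>: "\<eta> > 0"
  shows "\<exists>\<delta>>0. \<exists>\<epsilon>0>0. \<forall>\<epsilon> x y. 0 < \<epsilon> \<longrightarrow> \<epsilon> < \<epsilon>0 \<longrightarrow> x \<in> closure D \<longrightarrow> y \<in> frontier D \<longrightarrow>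
    dist x y < \<delta> \<longrightarrow> \<bar>walk_mean D F \<epsilon> x - F y\<bar> \<le> \<eta>"
proof -
  define Q where "Q y0 \<delta> \<epsilon>0 \<longleftrightarrow> \<delta> > 0 \<and> \<epsilon>0 > 0 \<and>
    (\<forall>\<epsilon> x. 0 < \<epsilon> \<longrightarrow> \<epsilon> < \<epsilon>0 \<longrightarrow> x \<in> closure D \<longrightarrow> dist y0 x < \<delta> \<longrightarrow> \<bar>walk_mean D F \<epsilon> x - F y0\<bar> \<le> \<eta> / 2) \<and>
    (\<forall>y. y \<in> frontier D \<longrightarrow> dist y0 y < \<delta> \<longrightarrow> \<bar>F y - F y0\<bar> \<le> \<eta> / 2)" for y0 \<delta> \<epsilon>0
  have "\<exists>\<delta> \<epsilon>0. Q y0 \<delta> \<epsilon>0" if y0: "y0 \<in> frontier D" for y0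
  proof -
    have "walk_regular_point D y0" using reg y0 by (simp add: walk_regular_def)
    from walk_mean_near_regular_point[OF D(1,2) F this y0 half_gt_zero[OF \<eta>]]
    show ?thesis unfolding Q_def by metis
  qed
  then obtain d e where Q: "\<And>y0. y0 \<in> frontier D \<Longrightarrow> Q y0 (d y0) (e y0)" by metis
  have d: "d y > 0" and e: "e y > 0" if "y \<in> frontier D" for y
    using Q[OF that] by (auto simp: Q_def)
  have near: "\<bar>walk_mean D F \<epsilon> x - F y0\<bar> \<le> \<eta> / 2"
    if "y0 \<in> frontier D" "0 < \<epsilon>" "\<epsilon> < e y0" "x \<in> closure D" "dist y0 x < d y0" for y0 \<epsilon> x
    using Q[OF that(1)] that by (simp add: Q_def)
  have nearF: "\<bar>F y - F y0\<bar> \<le> \<eta> / 2" if "y0 \<in> frontier D" "y \<in> frontier D" "dist y0 y < d y0" for y0 y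
    using Q[OF that(1)] that by (simp add: Q_def)
  have cpt: "compact (frontier D)" using D by (simp add: compact_frontier_bounded)
  \<comment> \<open>Half radii leave room: a point within \<open>\<delta>\<close> of
    \<open>y\<close> is still within \<open>d y0\<close> of the centre \<open>y0\<close> of the ball
    that covers \<open>y\<close>.\<close>
  have cover: "frontier D \<subseteq> (\<Union>y\<in>frontier D. ball y (d y / 2))"
    using d by force
  obtain Y where Y: "Y \<subseteq> frontier D" "finite Y" "frontier D \<subseteq> (\<Union>y\<in>Y. ball y (d y / 2))"
    by (rule compactE_image[OF cpt _ cover]) auto
  have Y_ne: "Y \<noteq> {}" using Y D by auto
  define \<delta> where "\<delta> = Min ((\<lambda>y. d y / 2) ` Y)"
  define \<epsilon>0 where "\<epsilon>0 = Min (e ` Y)"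
  have "\<delta> > 0" "\<epsilon>0 > 0" using Y Y_ne d e by (auto simp: \<delta>_def \<epsilon>0_def)
  moreover have "\<bar>walk_mean D F \<epsilon> x - F y\<bar> \<le> \<eta>"
    if \<epsilon>: "0 < \<epsilon>" "\<epsilon> < \<epsilon>0" and x: "x \<in> closure D" and y: "y \<in> frontier D" and xy: "dist x y < \<delta>" for \<epsilon> x y
  proof -
    obtain y0 where y0: "y0 \<in> Y" "dist y0 y < d y0 / 2" using Y(3) y by auto
    have fr: "y0 \<in> frontier D" using y0 Y by auto
    have "\<delta> \<le> d y0 / 2"
      unfolding \<delta>_def by (rule Min_le) (use Y(2) y0(1) in auto)
    then have "dist y0 x < d y0"
      using dist_triangle[of y0 x y] xy y0 by (simp add: dist_commute)
    moreover have "\<epsilon>0 \<le> e y0"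
      unfolding \<epsilon>0_def by (rule Min_le) (use Y(2) y0(1) in auto)
    ultimately have "\<bar>walk_mean D F \<epsilon> x - F y0\<bar> \<le> \<eta> / 2"
      using \<epsilon> x by (intro near[OF fr]) auto
    moreover have "\<bar>F y - F y0\<bar> \<le> \<eta> / 2"
      using y0 d[OF fr] by (intro nearF[OF fr y]) simp
    ultimately show ?thesis by linarith
  qed
  ultimately show ?thesis by blast
qed

theorem theorem2p14:
  fixes D :: "'a::euclidean_space set" and F :: "'a \<Rightarrow> real"
  assumes "open D" and "bounded D" and "connected D" and "walk_regular D"
    and "continuous_on (frontier D) F"
  shows "\<exists>u. continuous_on (closure D) u \<and> harmonic_on D u \<and> (\<forall>x\<in>frontier D. u x = F x) \<and>
           (\<forall>v. continuous_on (closure D) v \<and> harmonic_on D v \<and> (\<forall>x\<in>frontier D. v x = F x)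
                 \<longrightarrow> (\<forall>x\<in>closure D. v x = u x)) \<and>
           uniform_limit (closure D) (u_eps D F) u (at_right 0)"
\<comment> \<open>\<open>mean_value_family\<close> requires a nonempty domain; for the empty one
  closure and frontier are empty and every claim is trivial.\<close>
proof (cases "D = {}")
  case True
  then show ?thesis by (auto simp: harmonic_on_def intro!: uniform_limitI)
next
  case False
  note dom = assms(1,2) and F = assms(5)
  have fr: "frontier D \<noteq> {}" using dom False frontier_eq_empty[of D] not_bounded_UNIV by auto
  obtain M where M: "\<And>y. \<bar>frontier_ext D F y\<bar> \<le> M"
    using frontier_ext_bounded[OF dom(2) F] by blast
  have M0: "0 \<le> M" using M[of 0] by linarith
  \<comment> \<open>The cut-off supplies \<open>W_outside\<close>; averages at points of
    \<open>D\<close> with room for a full step do not see it.\<close>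
  define W where "W \<epsilon> x = (if x \<in> closure D then walk_mean D F \<epsilon> x else 0)" for \<epsilon> x
  have W_meas: "W \<epsilon> \<in> borel_measurable borel" for \<epsilon>
    unfolding W_def[abs_def] using measurable_walk_mean[OF F] by (intro measurable_If_set) auto
  interpret mean_value_family D F W M
  proof
    show "open D" "bounded D" "D \<noteq> {}" using dom False by auto
    show "W \<epsilon> \<in> borel_measurable borel" for \<epsilon> by (rule W_meas)
    show "\<bar>W \<epsilon> y\<bar> \<le> M" for \<epsilon> y
      using walk_mean_le[OF F M] M0 by (simp add: W_def)
    show "W \<epsilon> y = 0" if "y \<notin> closure D" for \<epsilon> y using that by (simp add: W_def)
    show "W \<epsilon> x = (\<integral>w. W \<epsilon> (x + \<epsilon> *\<^sub>R w) \<partial>ball_prob)"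
      if \<epsilon>: "0 < \<epsilon>" "\<epsilon> \<le> infdist x (frontier D)" and x: "x \<in> D" for \<epsilon> x
    proof -
      note [measurable] = measurable_walk_mean[OF F] W_meas
      have "W \<epsilon> x = (\<integral>w. walk_mean D F \<epsilon> (x + \<epsilon> *\<^sub>R w) \<partial>ball_prob)"
        using walk_mean_mean_value[OF F M, of \<epsilon> x] \<epsilon> x closure_subset[of D] by (auto simp: W_def min_absorb1)
      also have "\<dots> = (\<integral>w. W \<epsilon> (x + \<epsilon> *\<^sub>R w) \<partial>ball_prob)"
      proof (rule integral_cong_AE)
        show "AE w in ball_prob. walk_mean D F \<epsilon> (x + \<epsilon> *\<^sub>R w) = W \<epsilon> (x + \<epsilon> *\<^sub>R w)"
          using AE_ball_prob_norm
        proof eventually_elim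
          case (elim w)
          then have "\<epsilon> * norm w < \<epsilon>" using \<epsilon> by simp
          moreover have "dist x (x + \<epsilon> *\<^sub>R w) = \<epsilon> * norm w" using \<epsilon> by (simp add: dist_norm)
          ultimately have "x + \<epsilon> *\<^sub>R w \<in> ball x (infdist x (frontier D))"
            unfolding mem_ball using \<epsilon> by linarith
          then have "x + \<epsilon> *\<^sub>R w \<in> closure D"
            using ball_infdist_frontier_subset[OF x] closure_subset[of D] by blast
          then show ?case by (simp add: W_def)
        qed
      qed measurable
      finally show ?thesis .
    qed
    show "\<exists>\<delta>>0. \<exists>\<epsilon>0>0. \<forall>\<epsilon> x y. 0 < \<epsilon> \<longrightarrow> \<epsilon> < \<epsilon>0 \<longrightarrow> x \<in> closure D \<longrightarrow>
      y \<in> frontier D \<longrightarrow> dist x y < \<delta> \<longrightarrow> \<bar>W \<epsilon> x - F y\<bar> \<le> \<eta>" if "\<eta> > 0" for \<eta>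
      using walk_mean_near_frontier[OF dom fr F assms(4) that] unfolding W_def by simp
  qed
  obtain u where u: "continuous_on (closure D) u" "harmonic_on D u" "\<And>x. x \<in> frontier D \<Longrightarrow> u x = F x"
    and lim: "uniform_limit (closure D) W u (at_right 0)"
    using harmonic_limit by blast
  have "v x = u x" if v: "continuous_on (closure D) v" "harmonic_on D v" "\<forall>x\<in>frontier D. v x = F x"
    and x: "x \<in> closure D" for v x
    using harmonic_le_frontier[OF dom v(1,2) u(1,2) _ x] harmonic_le_frontier[OF dom u(1,2) v(1,2) _ x] v(3) u(3)
    by (auto intro!: antisym)
  moreover have "uniform_limit (closure D) (u_eps D F) u (at_right 0)"
  \<comment> \<open>\<open>u_eps\<close> and \<open>W\<close> are identified for positive
    \<open>\<epsilon>\<close>, which holds eventually in \<open>at_right 0\<close>.\<close>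
  proof (rule uniform_limit_cong[THEN iffD1, OF _ _ lim])
    show "\<forall>\<^sub>F \<epsilon> in at_right 0. \<forall>x\<in>closure D. W \<epsilon> x = u_eps D F \<epsilon> x"
      using eventually_at_right_less[of "0::real"]
      by eventually_elim (simp add: W_def u_eps_eq_walk_mean[OF dom F])
  qed simp
  ultimately show ?thesis using u(1,2) u(3) by (intro exI[of _ u] conjI allI impI ballI) blast+
qed

end
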